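(* Let $\operatorname{L}$ be a symmetric diffusion Markov generator on the probability space $(E,\mathcal{F},\mu)$ with discrete spectrum $\{-\lambda_k : k\geq 0\}$, $0=\lambda_0<\lambda_1<\lambda_2<\cdots$. Fix integers $d\geq 1$ and $k_1,\dots,k_d\geq 1$, and let $F_n=(F_{1,n},\dots,F_{d,n})$, $n\geq 1$, be a sequence of chaotic vectors such that $F_{i,n}\in\ker(\operatorname{L}+\lambda_{k_i}\operatorname{Id})$ for $1\leq i\leq d$ and all $n\geq 1$. Assume that $\lim_{n\to\infty}\operatorname{Cov}F_n=C$ for some $d\times d$ matrix $C$, and denote by $Z=(Z_1,\dots,Z_d)$ a centered Gaussian random vector with covariance matrix $C$, defined on some probability space $(\Omega,\mathscr{F},\mathbb{P})$ with expectation $\mathbb{E}$. Consider the following asymptotic relations, as $n\to\infty$: (i) $F_n\xrightarrow{d}Z$; (ii) both of the following hold: (ii)$_a$ for every $i=1,\dots,d$, $F_{i,n}\xrightarrow{d}Z_i$; and (ii)$_b$ for every $1\leq i,j\leq d$, $\displaystyle\int_E F_{i,n}^2F_{j,n}^2\,d\mu\to\mathbb{E}[Z_i^2Z_j^2]$. Then (ii) implies (i). Moreover, the converse implication (i) $\Rightarrow$ (ii) holds whenever the sequence $\{F_{i,n}^2F_{j,n}^2 : n\geq 1\}$ is uniformly integrable for every $1\leq i,j\leq d$.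
   Context: Setting. $(E,\mathcal{F},\mu)$ is a probability space and $\operatorname{L}$ is a symmetric Markov generator with state space $E$ and invariant measure $\mu$: a self-adjoint linear operator on (a dense domain of) the real space $L^2(E,\mu)$ with $\operatorname{L}1=0$. Its spectrum is discrete, equal to $\{-\lambda_k:k\geq 0\}$ with $0=\lambda_0<\lambda_1<\lambda_2<\cdots$, and $L^2(E,\mu)=\bigoplus_{k=0}^\infty\ker(\operatorname{L}+\lambda_k\operatorname{Id})$ (orthogonal direct sum). Carré du champ. $\Gamma(F,G)=\frac12\left(\operatorname{L}(FG)-F\operatorname{L}G-G\operatorname{L}F\right)$ whenever the right-hand side exists. Since $\operatorname{L}$ is self-adjoint and $\operatorname{L}1=0$, one has the integration by parts formula $\int_E\Gamma(F,G)\,d\mu=-\int_E F\operatorname{L}G\,d\mu=-\int_E G\operatorname{L}F\,d\mu$. Diffusion. $\operatorname{L}$ is called diffusive (a diffusion Markov generator) if $\operatorname{L}\phi(F)=\phi'(F)\operatorname{L}F+\phi''(F)\Gamma(F,F)$ for all smooth test functions $\phi:\mathbb{R}\to\mathbb{R}$ and any $F\in L^2(E,\mu)$ (for which the expressions make sense); equivalently, $\Gamma$ is a derivation: $\Gamma(\phi(F),G)=\phi'(F)\Gamma(F,G)$. For vectors $F=(F_1,\dots,F_d)$ and smooth $\varphi:\mathbb{R}^d\to\mathbb{R}$ this yields $\operatorname{L}\varphi(F)=\sum_{i}\frac{\partial\varphi}{\partial x_i}(F)\operatorname{L}F_i+\sum_{i,j}\frac{\partial^2\varphi}{\partial x_i\partial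 x_j}(F)\Gamma(F_i,F_j)$ and $\Gamma(\varphi(F),G)=\sum_i\frac{\partial\varphi}{\partial x_i}(F)\Gamma(F_i,G)$. Chaotic vectors. Two eigenfunctions $F_i\in\ker(\operatorname{L}+\lambda_{k_i}\operatorname{Id})$ and $F_j\in\ker(\operatorname{L}+\lambda_{k_j}\operatorname{Id})$ are jointly chaotic if $F_iF_j\in\bigoplus_{r:\,\lambda_r\leq\lambda_{k_i}+\lambda_{k_j}}\ker(\operatorname{L}+\lambda_r\operatorname{Id})$ (in particular $F_iF_j\in L^2(E,\mu)$). A vector $F=(F_1,\dots,F_d)$ of eigenfunctions, with $F_i\in\ker(\operatorname{L}+\lambda_{k_i}\operatorname{Id})$, is chaotic if any two of its components (possibly the same one) are jointly chaotic. Elements of $L^2(E,\mu)$ are regarded as random variables on $(E,\mathcal{F},\mu)$; $\operatorname{Cov}F_n$ is the covariance matrix of $F_n$ under $\mu$, and $\xrightarrow{d}$ denotes convergence in distribution. *)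

theory Defs
  imports "HOL-Probability.Probability"
begin

section \<open>The real Hilbert space $L^2(E,\mu)$\<close>

text \<open>Elements of $L^2$ are represented by measurable functions; equality in $L^2$ is
  equality almost everywhere.\<close>

definition L2 :: "'a measure \<Rightarrow> ('a \<Rightarrow> real) set" where
  "L2 M = {f \<in> borel_measurable M. integrable M (\<lambda>x. (f x)\<^sup>2)}"

definition L2_inner :: "'a measure \<Rightarrow> ('a \<Rightarrow> real) \<Rightarrow> ('a \<Rightarrow> real) \<Rightarrow> real" where
  "L2_inner M f g = (\<integral>x. f x * g x \<partial>M)"

definition L2_norm :: "'a measure \<Rightarrow> ('a \<Rightarrow> real) \<Rightarrow> real" where
  "L2_norm M f = sqrt (L2_inner M f f)"


section \<open>Unbounded operators on $L^2$\<close>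

text \<open>An unbounded operator is a domain \<open>D\<close> together with a map \<open>L\<close>, whose values outside
  \<open>D\<close> are irrelevant. The congruence clause says that both only depend on classes of functions
  modulo null sets.\<close>

definition L2_operator ::
    "'a measure \<Rightarrow> ('a \<Rightarrow> real) set \<Rightarrow> (('a \<Rightarrow> real) \<Rightarrow> 'a \<Rightarrow> real) \<Rightarrow> bool" where
  "L2_operator M D L \<longleftrightarrow>
     D \<subseteq> L2 M \<and> (\<forall>f\<in>D. L f \<in> L2 M) \<and>
     (\<forall>f\<in>D. \<forall>g\<in>borel_measurable M. (AE x in M. f x = g x) \<longrightarrow>
        g \<in> D \<and> (AE x in M. L f x = L g x)) \<and>
     (\<lambda>_. 0) \<in> D \<and>
     (\<forall>f\<in>D. \<forall>g\<in>D. (\<lambda>x. f x + g x) \<in> D \<and>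
        (AE x in M. L (\<lambda>x. f x + g x) x = L f x + L g x)) \<and>
     (\<forall>f\<in>D. \<forall>c. (\<lambda>x. c * f x) \<in> D \<and> (AE x in M. L (\<lambda>x. c * f x) x = c * L f x))"

definition densely_defined :: "'a measure \<Rightarrow> ('a \<Rightarrow> real) set \<Rightarrow> bool" where
  "densely_defined M D \<longleftrightarrow>
     (\<forall>f\<in>L2 M. \<forall>e>0. \<exists>g\<in>D. L2_norm M (\<lambda>x. f x - g x) < e)"

text \<open>The graph of the Hilbert space adjoint $L^*$.\<close>

definition adjoint_graph ::
    "'a measure \<Rightarrow> ('a \<Rightarrow> real) set \<Rightarrow> (('a \<Rightarrow> real) \<Rightarrow> 'a \<Rightarrow> real)
      \<Rightarrow> (('a \<Rightarrow> real) \<times> ('a \<Rightarrow> real)) set" where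
  "adjoint_graph M D L =
     {(u, v). u \<in> L2 M \<and> v \<in> L2 M \<and> (\<forall>f\<in>D. L2_inner M (L f) u = L2_inner M f v)}"

text \<open>Self-adjointness in the sense of unbounded operators, $L^* = L$ including equality of the
  domains (not merely symmetry).\<close>

definition self_adjoint ::
    "'a measure \<Rightarrow> ('a \<Rightarrow> real) set \<Rightarrow> (('a \<Rightarrow> real) \<Rightarrow> 'a \<Rightarrow> real) \<Rightarrow> bool" where
  "self_adjoint M D L \<longleftrightarrow>
     densely_defined M D \<and>
     adjoint_graph M D L = {(u, v). u \<in> D \<and> v \<in> L2 M \<and> (AE x in M. L u x = v x)}"

text \<open>The point \<open>z\<close> is in the resolvent set if $L - z$ maps \<open>D\<close> onto $L^2$ and is bounded
  below, i.e. is injective with bounded inverse. Only real \<open>z\<close> are considered, which for a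
  self-adjoint operator loses nothing.\<close>

definition resolvent_set ::
    "'a measure \<Rightarrow> ('a \<Rightarrow> real) set \<Rightarrow> (('a \<Rightarrow> real) \<Rightarrow> 'a \<Rightarrow> real) \<Rightarrow> real set" where
  "resolvent_set M D L =
     {z. (\<forall>g\<in>L2 M. \<exists>f\<in>D. AE x in M. L f x - z * f x = g x) \<and>
         (\<exists>c>0. \<forall>f\<in>D. c * L2_norm M f \<le> L2_norm M (\<lambda>x. L f x - z * f x))}"

definition op_spectrum ::
    "'a measure \<Rightarrow> ('a \<Rightarrow> real) set \<Rightarrow> (('a \<Rightarrow> real) \<Rightarrow> 'a \<Rightarrow> real) \<Rightarrow> real set" where
  "op_spectrum M D L = - resolvent_set M D L"

text \<open>$\ker(L + a\,\mathrm{Id})$\<close>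

definition eigenspace ::
    "'a measure \<Rightarrow> ('a \<Rightarrow> real) set \<Rightarrow> (('a \<Rightarrow> real) \<Rightarrow> 'a \<Rightarrow> real) \<Rightarrow> real \<Rightarrow> ('a \<Rightarrow> real) set" where
  "eigenspace M D L a = {f \<in> D. AE x in M. L f x + a * f x = 0}"

text \<open>The Hilbert space direct sum $\bigoplus_{r\in I}\ker(L+\lambda_r\,\mathrm{Id})$: all
  $L^2$-convergent series of elements of the summands. (Eigenspaces of a self-adjoint operator
  for distinct eigenvalues are orthogonal.)\<close>

definition eigen_sum ::
    "'a measure \<Rightarrow> ('a \<Rightarrow> real) set \<Rightarrow> (('a \<Rightarrow> real) \<Rightarrow> 'a \<Rightarrow> real) \<Rightarrow> (nat \<Rightarrow> real) \<Rightarrow> nat set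
      \<Rightarrow> ('a \<Rightarrow> real) set" where
  "eigen_sum M D L lam I =
     {f \<in> L2 M. \<exists>u. (\<forall>r\<in>I. u r \<in> eigenspace M D L (lam r)) \<and>
        (\<lambda>n. L2_norm M (\<lambda>x. f x - (\<Sum>r\<in>I \<inter> {..<n}. u r x))) \<longlonglongrightarrow> 0}"


section \<open>Symmetric diffusion Markov generators\<close>

definition symmetric_markov_generator ::
    "'a measure \<Rightarrow> ('a \<Rightarrow> real) set \<Rightarrow> (('a \<Rightarrow> real) \<Rightarrow> 'a \<Rightarrow> real) \<Rightarrow> bool" where
  "symmetric_markov_generator M D L \<longleftrightarrow>
     prob_space M \<and> L2_operator M D L \<and> self_adjoint M D L \<and>
     (\<lambda>_. 1) \<in> D \<and> (AE x in M. L (\<lambda>_. 1) x = 0)"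

definition has_discrete_spectrum ::
    "'a measure \<Rightarrow> ('a \<Rightarrow> real) set \<Rightarrow> (('a \<Rightarrow> real) \<Rightarrow> 'a \<Rightarrow> real) \<Rightarrow> (nat \<Rightarrow> real) \<Rightarrow> bool" where
  "has_discrete_spectrum M D L lam \<longleftrightarrow>
     lam 0 = 0 \<and> strict_mono lam \<and> op_spectrum M D L = range (\<lambda>k. - lam k) \<and>
     (\<forall>k l. k \<noteq> l \<longrightarrow> (\<forall>f\<in>eigenspace M D L (lam k). \<forall>g\<in>eigenspace M D L (lam l).
        L2_inner M f g = 0)) \<and>
     eigen_sum M D L lam UNIV = L2 M"

text \<open>The carre du champ operator; it is meaningful if \<open>F\<close>, \<open>G\<close> and \<open>F G\<close> all lie in the
  domain of \<open>L\<close>.\<close>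

definition carre_du_champ ::
    "(('a \<Rightarrow> real) \<Rightarrow> 'a \<Rightarrow> real) \<Rightarrow> ('a \<Rightarrow> real) \<Rightarrow> ('a \<Rightarrow> real) \<Rightarrow> 'a \<Rightarrow> real" where
  "carre_du_champ L F G x = (L (\<lambda>y. F y * G y) x - F x * L G x - G x * L F x) / 2"

definition smooth_test_function :: "(real \<Rightarrow> real) \<Rightarrow> bool" where
  "smooth_test_function \<phi> \<longleftrightarrow>
     (\<forall>m x. ((deriv ^^ m) \<phi>) field_differentiable (at x)) \<and>
     compact (closure {x. \<phi> x \<noteq> 0})"

text \<open>The diffusion property is required for those \<open>F\<close> for which $\Gamma(F,F)$ exists. The
  right-hand side is then an element of $L^2$: \<open>\<phi>\<close> has compact support, so \<open>\<phi>''(F) F\<close> is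
  bounded. Hence the equation makes sense on the right, and it is read as including that
  \<open>\<phi>(F)\<close> belongs to the domain.\<close>

definition diffusive ::
    "'a measure \<Rightarrow> ('a \<Rightarrow> real) set \<Rightarrow> (('a \<Rightarrow> real) \<Rightarrow> 'a \<Rightarrow> real) \<Rightarrow> bool" where
  "diffusive M D L \<longleftrightarrow>
     (\<forall>\<phi> F. smooth_test_function \<phi> \<longrightarrow> F \<in> D \<longrightarrow> (\<lambda>x. F x * F x) \<in> D \<longrightarrow>
        (\<lambda>x. \<phi> (F x)) \<in> D \<and>
        (AE x in M. L (\<lambda>x. \<phi> (F x)) x =
           deriv \<phi> (F x) * L F x + deriv (deriv \<phi>) (F x) * carre_du_champ L F F x))"


section \<open>Chaotic vectors\<close>

definition jointly_chaotic ::
    "'a measure \<Rightarrow> ('a \<Rightarrow> real) set \<Rightarrow> (('a \<Rightarrow> real) \<Rightarrow> 'a \<Rightarrow> real) \<Rightarrow> (nat \<Rightarrow> real)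
      \<Rightarrow> nat \<Rightarrow> ('a \<Rightarrow> real) \<Rightarrow> nat \<Rightarrow> ('a \<Rightarrow> real) \<Rightarrow> bool" where
  "jointly_chaotic M D L lam k F l G \<longleftrightarrow>
     F \<in> eigenspace M D L (lam k) \<and> G \<in> eigenspace M D L (lam l) \<and>
     (\<lambda>x. F x * G x) \<in> eigen_sum M D L lam {r. lam r \<le> lam k + lam l}"

definition chaotic_vector ::
    "'a measure \<Rightarrow> ('a \<Rightarrow> real) set \<Rightarrow> (('a \<Rightarrow> real) \<Rightarrow> 'a \<Rightarrow> real) \<Rightarrow> (nat \<Rightarrow> real)
      \<Rightarrow> ('d::finite \<Rightarrow> nat) \<Rightarrow> ('a \<Rightarrow> real ^ 'd) \<Rightarrow> bool" where
  "chaotic_vector M D L lam k F \<longleftrightarrow>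
     (\<forall>i. (\<lambda>x. F x $ i) \<in> eigenspace M D L (lam (k i))) \<and>
     (\<forall>i j. jointly_chaotic M D L lam (k i) (\<lambda>x. F x $ i) (k j) (\<lambda>x. F x $ j))"


section \<open>Probabilistic notions\<close>

definition cov_matrix :: "'a measure \<Rightarrow> ('a \<Rightarrow> real ^ 'd::finite) \<Rightarrow> real ^ 'd ^ 'd" where
  "cov_matrix M X = (\<chi> i j. \<integral>x. (X x $ i - (\<integral>y. X y $ i \<partial>M)) * (X x $ j - (\<integral>y. X y $ j \<partial>M)) \<partial>M)"

text \<open>A possibly degenerate univariate normal random variable.\<close>

definition gaussian_rv :: "'a measure \<Rightarrow> ('a \<Rightarrow> real) \<Rightarrow> bool" where
  "gaussian_rv M X \<longleftrightarrow>
     X \<in> borel_measurable M \<and>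
     (\<exists>m. (AE x in M. X x = m) \<or> (\<exists>\<sigma>>0. distributed M lborel X (normal_density m \<sigma>)))"

definition centered_gaussian_vector ::
    "'a measure \<Rightarrow> ('a \<Rightarrow> real ^ 'd::finite) \<Rightarrow> real ^ 'd ^ 'd \<Rightarrow> bool" where
  "centered_gaussian_vector M Z C \<longleftrightarrow>
     Z \<in> borel_measurable M \<and>
     (\<forall>t. gaussian_rv M (\<lambda>x. t \<bullet> Z x)) \<and>
     (\<forall>i. (\<integral>x. Z x $ i \<partial>M) = 0) \<and> cov_matrix M Z = C"

text \<open>Convergence in distribution, by bounded continuous test functions. The library notion
  \<^const>\<open>weak_conv_m\<close> covers real random variables only; the lemma below shows that the two
  agree there.\<close>

definition conv_in_distribution ::
    "'a measure \<Rightarrow> (nat \<Rightarrow> 'a \<Rightarrow> 'c::topological_space) \<Rightarrow> 'b measure \<Rightarrow> ('b \<Rightarrow> 'c) \<Rightarrow> bool" where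
  "conv_in_distribution M X N Y \<longleftrightarrow>
     (\<forall>f :: 'c \<Rightarrow> real. continuous_on UNIV f \<and> bounded (range f) \<longrightarrow>
        (\<lambda>n. \<integral>x. f (X n x) \<partial>M) \<longlonglongrightarrow> (\<integral>y. f (Y y) \<partial>N))"

lemma conv_in_distribution_real_iff:
  fixes X :: "nat \<Rightarrow> 'a \<Rightarrow> real" and Y :: "'b \<Rightarrow> real"
  assumes M: "prob_space M" and N: "prob_space N"
    and X [measurable]: "\<And>n. X n \<in> borel_measurable M" and Y [measurable]: "Y \<in> borel_measurable N"
  shows "conv_in_distribution M X N Y \<longleftrightarrow>
    weak_conv_m (\<lambda>n. distr M borel (X n)) (distr N borel Y)"
proof -
  have rX: "real_distribution (distr M borel (X n))" for n
    using prob_space.real_distribution_distr[OF M X] .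
  have rY: "real_distribution (distr N borel Y)"
    using prob_space.real_distribution_distr[OF N Y] .
  have int: "(\<integral>z. f z \<partial>distr M borel (X n)) = (\<integral>x. f (X n x) \<partial>M)"
    "(\<integral>z. f z \<partial>distr N borel Y) = (\<integral>y. f (Y y) \<partial>N)"
    if "continuous_on UNIV f" for f :: "real \<Rightarrow> real" and n
    using borel_measurable_continuous_onI[OF that] by (simp_all add: integral_distr)
  show ?thesis
  proof
    assume *: "conv_in_distribution M X N Y"
    show "weak_conv_m (\<lambda>n. distr M borel (X n)) (distr N borel Y)"
    proof (rule integral_bdd_continuous_conv_imp_weak_conv[OF rX rY])
      fix f :: "real \<Rightarrow> real" and B
      assume f: "\<And>x. isCont f x" "\<And>x. \<bar>f x\<bar> \<le> B"
      then have "continuous_on UNIV f" "bounded (range f)"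
        by (auto simp: continuous_on_eq_continuous_at bounded_iff)
      with * show "(\<lambda>n. integral\<^sup>L (distr M borel (X n)) f) \<longlonglongrightarrow> integral\<^sup>L (distr N borel Y) f"
        by (simp add: conv_in_distribution_def int)
    qed
  next
    assume *: "weak_conv_m (\<lambda>n. distr M borel (X n)) (distr N borel Y)"
    show "conv_in_distribution M X N Y"
      unfolding conv_in_distribution_def
    proof (intro allI impI, elim conjE)
      fix f :: "real \<Rightarrow> real"
      assume f: "continuous_on UNIV f" "bounded (range f)"
      then obtain B where "\<And>x. norm (f x) \<le> B"
        by (auto simp: bounded_iff)
      then show "(\<lambda>n. \<integral>x. f (X n x) \<partial>M) \<longlonglongrightarrow> (\<integral>y. f (Y y) \<partial>N)"
        using weak_conv_imp_integral_bdd_continuous_conv[OF rX rY *, of f B] f(1)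
        by (simp add: int continuous_on_eq_continuous_at)
    qed
  qed
qed

definition uniformly_integrable :: "'a measure \<Rightarrow> (nat \<Rightarrow> 'a \<Rightarrow> real) \<Rightarrow> bool" where
  "uniformly_integrable M X \<longleftrightarrow>
     (\<forall>n. integrable M (X n)) \<and>
     (\<forall>e>0. \<exists>K. \<forall>n. (\<integral>x. \<bar>X n x\<bar> * indicator {x. \<bar>X n x\<bar> > K} x \<partial>M) < e)"

end

theory Submission
  imports Defs
begin

text \<open>The generator is probed through a single consequence of the diffusion property: for
\<open>G\<close> and \<open>G\<^sup>2\<close> in the domain of \<open>L\<close>,
\[ \int \psi'(G)\,LG + \psi''(G)\,\Gamma(G,G)\,d\mu = 0 . \]
Formally this is the integral of \<open>L \<psi>(G)\<close>, which vanishes because \<open>L\<close> is symmetric and \<open>L 1 = 0\<close>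
(\<open>integral_chain_rule\<close>).
It is used for linear combinations \<open>G = \<Sum>\<^sub>i t\<^sub>i F\<^sub>i\<close> of the components of a chaotic vector, with
\<open>\<psi>\<close> a fourth power and with \<open>\<psi>\<close> a cosine. Let \<open>l\<^sub>i\<close> be the eigenvalue belonging to \<open>F\<^sub>i\<close>, so that
\<open>L F\<^sub>i = - l\<^sub>i F\<^sub>i\<close>.

Fourth moments control \<open>\<Gamma>\<close>. The product \<open>P = F\<^sub>i F\<^sub>j\<close> has no spectral component above
\<open>c = l\<^sub>i + l\<^sub>j\<close>, and \<open>\<Gamma>(F\<^sub>i, F\<^sub>j) = (L + c) P / 2\<close>. On its spectral components the operator \<open>(L + c) / 2\<close>
therefore has eigenvalues between \<open>0\<close> and \<open>c / 2\<close>, so that the second moment of \<open>\<Gamma>(F\<^sub>i, F\<^sub>j)\<close>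
is at most \<open>c / 2\<close> times the integral of \<open>P \<Gamma>(F\<^sub>i, F\<^sub>j)\<close> (\<open>integral_\<Gamma>_square_le\<close>). Taking
\<open>\<psi>(x) = x\<^sup>4\<close> for \<open>F\<^sub>i\<close> and \<open>F\<^sub>i \<plusminus> F\<^sub>j\<close> expresses that integral by fourth moments and by the
integrals of \<open>F\<^sub>i\<^sup>2 \<Gamma>(F\<^sub>j, F\<^sub>j)\<close> and \<open>F\<^sub>j\<^sup>2 \<Gamma>(F\<^sub>i, F\<^sub>i)\<close>. If the fourth moments converge to those of the Gaussian
vector, everything cancels in the limit and the variance of \<open>\<Gamma>(F\<^sub>i, F\<^sub>j)\<close> tends to \<open>0\<close>: first for
\<open>i = j\<close>, then in general (\<open>\<Gamma>_tendsto_L1\<close>).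

An almost constant \<open>\<Gamma>\<close> forces the Gaussian law. Move the frequency \<open>t\<close> along the flow
\<open>\<tau>\<^sub>i(s) = exp (l\<^sub>i s) t\<^sub>i\<close> for \<open>s \<le> 0\<close>. The derivative of \<open>G(\<tau>(s))\<close> in \<open>s\<close> is \<open>- L G(\<tau>(s))\<close>, so the
identity for \<open>\<psi>(x) = cos (x + \<theta>)\<close> says that the derivative of the mean of \<open>cos (G + \<theta>)\<close> is minus the mean of
\<open>cos (G + \<theta>) \<Gamma>(G, G)\<close>. With \<open>\<Gamma>(G, G)\<close> replaced by its constant limit, this is a linear differential
equation whose solution is a multiple of \<open>exp (- q(s))\<close>, where \<open>q(s)\<close> is half the quadratic form of
\<open>C\<close> at \<open>\<tau>(s)\<close>. As \<open>s\<close> tends to \<open>-\<infinity>\<close> the frequency tends to \<open>0\<close>, which fixes the multiple to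
be \<open>cos \<theta>\<close>; at \<open>s = 0\<close> this is the Gaussian characteristic function (\<open>characteristic_limit\<close>).

Convergence of all these trigonometric moments, together with bounded second moments, gives
convergence in distribution on \<open>\<real>\<^sup>d\<close> (\<open>conv_in_distribution_characteristic\<close>). The converse
implication is the continuous mapping principle and, for the fourth moments, the passage to the limit under
uniform integrability (\<open>conv_in_distribution_expectation\<close>).\<close>


section \<open>Smooth test functions\<close>

text \<open>The order of differentiability is a parameter so that closure properties can be proved by
induction on it: the derivative of a product is a sum of products of functions of lower order.\<close>

definition times_differentiable :: "nat \<Rightarrow> (real \<Rightarrow> real) \<Rightarrow> bool" where
  "times_differentiable k f \<longleftrightarrow> (\<forall>m<k. \<forall>x. ((deriv ^^ m) f) field_differentiable (at x))"

lemma times_differentiable_0 [simp]: "times_differentiable 0 f"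
  by (simp add: times_differentiable_def)

lemma times_differentiable_Suc:
  "times_differentiable (Suc k) f \<longleftrightarrow>
     (\<forall>x. f field_differentiable (at x)) \<and> times_differentiable k (deriv f)"
  unfolding times_differentiable_def All_less_Suc2 by (simp add: funpow_Suc_right del: funpow.simps(2))

lemma times_differentiable_SucI:
  assumes "\<And>x. (f has_field_derivative f' x) (at x)" "times_differentiable k f'"
  shows "times_differentiable (Suc k) f"
proof -
  have "deriv f = f'"
    using assms(1) by (auto intro!: ext DERIV_imp_deriv)
  then show ?thesis
    using assms by (auto simp: times_differentiable_Suc field_differentiable_def)
qed

lemma times_differentiable_SucE:
  assumes "times_differentiable (Suc k) f"
  obtains f' where "\<And>x. (f has_field_derivative f' x) (at x)" "times_differentiable k f'"
  using that[of "deriv f"] assms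
  by (simp add: times_differentiable_Suc DERIV_deriv_iff_field_differentiable)

lemma times_differentiable_mono:
  "times_differentiable k f \<Longrightarrow> l \<le> k \<Longrightarrow> times_differentiable l f"
  by (auto simp: times_differentiable_def)

lemma times_differentiable_add:
  assumes "times_differentiable k f" "times_differentiable k g"
  shows "times_differentiable k (\<lambda>x. f x + g x)"
  using assms
proof (induction k arbitrary: f g)
  case (Suc k)
  obtain f' where f': "\<And>x. (f has_field_derivative f' x) (at x)" "times_differentiable k f'"
    using Suc.prems(1) by (rule times_differentiable_SucE) blast
  obtain g' where g': "\<And>x. (g has_field_derivative g' x) (at x)" "times_differentiable k g'"
    using Suc.prems(2) by (rule times_differentiable_SucE) blast
  show ?case
    by (rule times_differentiable_SucI[where f' = "\<lambda>x. f' x + g' x"])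
       (auto intro!: derivative_eq_intros f' g' Suc.IH)
qed simp

lemma times_differentiable_const: "times_differentiable k (\<lambda>_. c)"
proof (induction k arbitrary: c)
  case (Suc k)
  then show ?case
    by (intro times_differentiable_SucI[where f' = "\<lambda>_. 0"]) (auto intro!: derivative_eq_intros)
qed simp

lemma times_differentiable_mult:
  assumes "times_differentiable k f" "times_differentiable k g"
  shows "times_differentiable k (\<lambda>x. f x * g x)"
  using assms
proof (induction k arbitrary: f g)
  case (Suc k)
  obtain f' where f': "\<And>x. (f has_field_derivative f' x) (at x)" "times_differentiable k f'"
    using Suc.prems(1) by (rule times_differentiable_SucE) blast
  obtain g' where g': "\<And>x. (g has_field_derivative g' x) (at x)" "times_differentiable k g'"
    using Suc.prems(2) by (rule times_differentiable_SucE) blast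
  have "times_differentiable k f" "times_differentiable k g"
    using Suc.prems times_differentiable_mono by (auto intro: le_SucI)
  then have "times_differentiable k (\<lambda>x. f' x * g x + f x * g' x)"
    by (intro times_differentiable_add Suc.IH f' g')
  then show ?case
    by (rule times_differentiable_SucI[rotated]) (auto intro!: derivative_eq_intros f' g')
qed simp

lemma times_differentiable_affine:
  assumes "times_differentiable k f"
  shows "times_differentiable k (\<lambda>x. f (a * x + b))"
  using assms
proof (induction k arbitrary: f)
  case (Suc k)
  obtain f' where f': "\<And>x. (f has_field_derivative f' x) (at x)" "times_differentiable k f'"
    using Suc.prems by (rule times_differentiable_SucE) blast
  have "((\<lambda>x. f (a * x + b)) has_field_derivative f' (a * x + b) * a) (at x)" for x
  proof -
    have "((\<lambda>x. a * x + b) has_field_derivative a) (at x)"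
      by (auto intro!: derivative_eq_intros)
    from DERIV_chain2[OF f'(1) this] show ?thesis .
  qed
  moreover have "times_differentiable k (\<lambda>x. f' (a * x + b) * a)"
    by (rule times_differentiable_mult[OF Suc.IH[OF f'(2)] times_differentiable_const])
  ultimately show ?case
    by (rule times_differentiable_SucI)
qed simp

lemma times_differentiable_power: "times_differentiable k (\<lambda>x. x ^ n)"
proof (induction n)
  case (Suc n)
  have "times_differentiable k (\<lambda>x. x)"
    by (cases k) (auto intro!: times_differentiable_SucI[where f' = "\<lambda>_. 1"]
        times_differentiable_const derivative_eq_intros)
  from times_differentiable_mult[OF this Suc] show ?case by simp
qed (simp add: times_differentiable_const)

lemma times_differentiable_cos: "times_differentiable k (\<lambda>x. cos (x + \<theta>))"
proof (induction k arbitrary: \<theta>)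
  case (Suc k)
  have "- sin (x + \<theta>) = cos (x + (\<theta> + pi / 2))" for x :: real
    by (simp add: cos_add sin_add algebra_simps)
  then show ?case
    using Suc[of "\<theta> + pi / 2"]
    by (intro times_differentiable_SucI[where f' = "\<lambda>x. - sin (x + \<theta>)"])
       (auto intro!: derivative_eq_intros)
qed simp

text \<open>The classical functions that are flat at \<open>0\<close>. The power of \<open>x\<close> is a parameter because
differentiation then stays within the linear span of the family.\<close>

definition flat_exp :: "nat \<Rightarrow> real \<Rightarrow> real" where
  "flat_exp m x = (if x > 0 then exp (- (1 / x)) / x ^ m else 0)"

lemma flat_exp_at_right_0: "(flat_exp m \<longlongrightarrow> 0) (at_right 0)"
proof -
  have "((\<lambda>x::real. (1 / x) ^ m / exp (1 / x)) \<longlongrightarrow> 0) (at_right 0)"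
    by (rule filterlim_compose[OF tendsto_power_div_exp_0])
       (simp add: filterlim_inverse_at_top_right divide_inverse)
  then show ?thesis
    by (rule Lim_transform_eventually)
       (auto simp: eventually_at_filter flat_exp_def exp_minus field_simps)
qed

lemma flat_exp_has_derivative:
  "(flat_exp m has_field_derivative flat_exp (m + 2) x - real m * flat_exp (m + 1) x) (at x)"
proof (cases x "0::real" rule: linorder_cases)
  case less
  have "((\<lambda>_. 0) has_field_derivative 0) (at x)" by simp
  then have "(flat_exp m has_field_derivative 0) (at x)"
    by (rule has_field_derivative_transform_within_open[where S = "{..<0}"])
       (use less in \<open>auto simp: flat_exp_def\<close>)
  then show ?thesis using less by (simp add: flat_exp_def)
next
  case greater
  have "((\<lambda>x. exp (- (1 / x)) / x ^ m) has_field_derivative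
      flat_exp (m + 2) x - real m * flat_exp (m + 1) x) (at x)"
  proof -
    have "((\<lambda>x. - (1 / x)) has_field_derivative 1 / x\<^sup>2) (at x)"
      using greater by (auto intro!: derivative_eq_intros simp: power2_eq_square)
    then have e: "((\<lambda>x. exp (- (1 / x))) has_field_derivative exp (- (1 / x)) * (1 / x\<^sup>2)) (at x)"
      by (rule DERIV_chain2[OF DERIV_exp])
    have p: "((\<lambda>x. x ^ m) has_field_derivative real m * x ^ (m - Suc 0)) (at x)"
      by (rule DERIV_pow)
    have "(exp (- (1 / x)) * (1 / x\<^sup>2) * x ^ m - exp (- (1 / x)) * (real m * x ^ (m - Suc 0))) / (x ^ m * x ^ m)
        = flat_exp (m + 2) x - real m * flat_exp (m + 1) x"
    proof (cases m)
      case (Suc j)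
      have alg: "(E * (1 / x\<^sup>2) * (x * y) - E * (c * y)) / ((x * y) * (x * y))
          = E / (x * (x * (x * y))) - c * (E / (x * (x * y)))" if "y \<noteq> 0" for E c y :: real
        using greater that by (simp add: diff_divide_distrib power2_eq_square)
      show ?thesis
        using greater alg[of "x ^ j"] by (simp add: Suc flat_exp_def)
    qed (use greater in \<open>simp add: flat_exp_def power2_eq_square\<close>)
    with DERIV_divide[OF e p] greater show ?thesis by simp
  qed
  then show ?thesis
    by (rule has_field_derivative_transform_within_open[where S = "{0<..}"])
       (use greater in \<open>auto simp: flat_exp_def\<close>)
next
  case equal
  \<comment> \<open>the difference quotient of \<open>flat_exp m\<close> at \<open>0\<close> is \<open>flat_exp (m + 1)\<close>\<close>
  have "((\<lambda>y. flat_exp (m + 1) y) \<longlongrightarrow> 0) (at 0)"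
    unfolding filterlim_at_split
    by (intro conjI flat_exp_at_right_0 tendsto_eventually)
       (auto simp: eventually_at_filter flat_exp_def)
  then have "((\<lambda>y. (flat_exp m y - flat_exp m 0) / (y - 0)) \<longlongrightarrow> 0) (at 0)"
    by (rule Lim_transform_eventually) (auto simp: flat_exp_def field_simps)
  then show ?thesis
    unfolding equal has_field_derivative_iff by (simp add: flat_exp_def)
qed

lemma times_differentiable_flat_exp: "times_differentiable k (flat_exp m)"
proof (induction k arbitrary: m)
  case (Suc k)
  have "times_differentiable k (\<lambda>x. flat_exp (m + 2) x + (- real m) * flat_exp (m + 1) x)"
    by (intro times_differentiable_add times_differentiable_mult times_differentiable_const Suc)
  moreover have "(flat_exp m has_field_derivative
      flat_exp (m + 2) x + (- real m) * flat_exp (m + 1) x) (at x)" for x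
    using flat_exp_has_derivative[of m x] by simp
  ultimately show ?case
    by (rule times_differentiable_SucI[rotated])
qed simp

text \<open>The factor \<open>exp 2\<close> normalizes the value at \<open>0\<close> to \<open>1\<close>, so that \<open>bump (x / N)\<close> tends to \<open>1\<close>
as \<open>N\<close> grows. It need not be constant near \<open>0\<close>, because its derivatives at \<open>x / N\<close> carry factors \<open>1 / N\<close>.\<close>

definition bump :: "real \<Rightarrow> real" where
  "bump x = exp 2 * flat_exp 0 (1 + x) * flat_exp 0 (1 - x)"

lemma bump_0: "bump 0 = 1"
  by (simp add: bump_def flat_exp_def flip: exp_add)

lemma bump_eq_0: "\<bar>x\<bar> \<ge> 1 \<Longrightarrow> bump x = 0"
  by (auto simp: bump_def flat_exp_def)

lemma times_differentiable_bump: "times_differentiable k bump"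
proof -
  have "times_differentiable k (\<lambda>x. exp 2 * flat_exp 0 (1 * x + 1) * flat_exp 0 ((-1) * x + 1))"
    by (rule times_differentiable_mult[OF times_differentiable_mult[OF times_differentiable_const
            times_differentiable_affine[OF times_differentiable_flat_exp]]
          times_differentiable_affine[OF times_differentiable_flat_exp]])
  then show ?thesis
    by (simp add: bump_def[abs_def] add.commute)
qed

lemma bump_derivatives:
  obtains b' b'' B where
    "\<And>x. (bump has_field_derivative b' x) (at x)"
    "\<And>x. (b' has_field_derivative b'' x) (at x)"
    "\<And>x. \<bar>bump x\<bar> \<le> B" "\<And>x. \<bar>b' x\<bar> \<le> B" "\<And>x. \<bar>b'' x\<bar> \<le> B"
    "\<And>x. \<bar>x\<bar> > 1 \<Longrightarrow> b' x = 0" "\<And>x. \<bar>x\<bar> > 1 \<Longrightarrow> b'' x = 0" "B \<ge> 0"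
proof -
  have "times_differentiable (Suc (Suc (Suc 0))) bump"
    by (rule times_differentiable_bump)
  then obtain b' where b': "\<And>x. (bump has_field_derivative b' x) (at x)"
      "times_differentiable (Suc (Suc 0)) b'"
    by (rule times_differentiable_SucE) blast
  from b'(2) obtain b'' where b'': "\<And>x. (b' has_field_derivative b'' x) (at x)"
      "times_differentiable (Suc 0) b''"
    by (rule times_differentiable_SucE) blast
  from b''(2) obtain b3 where b3: "\<And>x. (b'' has_field_derivative b3 x) (at x)"
    by (rule times_differentiable_SucE) blast
  \<comment> \<open>a derivative vanishes wherever the function vanishes on an open set\<close>
  have supp: "g' x = 0" if g: "\<And>x::real. \<bar>x\<bar> > 1 \<Longrightarrow> g x = 0"
      "\<And>x. (g has_field_derivative g' x) (at x)" and x: "\<bar>x\<bar> > 1" for g g' :: "real \<Rightarrow> real" and x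
  proof -
    have o: "open {x::real. \<bar>x\<bar> > 1}"
      by (intro open_Collect_less continuous_intros)
    have "((\<lambda>_. 0::real) has_field_derivative 0) (at x)" by simp
    then have "(g has_field_derivative 0) (at x)"
      by (rule has_field_derivative_transform_within_open[OF _ o]) (use g x in auto)
    then show ?thesis
      using g(2)[of x] DERIV_unique by blast
  qed
  have bdd: "\<exists>B\<ge>0. \<forall>x. \<bar>g x\<bar> \<le> B" if g: "\<And>x::real. \<bar>x\<bar> > 1 \<Longrightarrow> g x = 0"
      "\<And>x. (g has_field_derivative g' x) (at x)" for g g' :: "real \<Rightarrow> real"
  proof -
    have "continuous_on {-1..1} g"
      using g(2) by (meson DERIV_isCont continuous_at_imp_continuous_on)
    then have "bounded (g ` {-1..1})"
      by (intro compact_imp_bounded compact_continuous_image) auto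
    then obtain B where "B > 0" and B: "\<And>x. x \<in> {-1..1} \<Longrightarrow> \<bar>g x\<bar> \<le> B"
      by (auto simp: bounded_pos)
    then have "\<bar>g x\<bar> \<le> B" for x
      using g(1)[of x] B[of x] \<open>B > 0\<close>
      by (cases "\<bar>x\<bar> > 1") (simp_all add: abs_le_iff not_less)
    with \<open>B > 0\<close> show ?thesis by (intro exI[of _ B]) auto
  qed
  have s0: "\<And>x. \<bar>x\<bar> > 1 \<Longrightarrow> bump x = 0" by (simp add: bump_eq_0)
  have s1: "\<And>x. \<bar>x\<bar> > 1 \<Longrightarrow> b' x = 0" using supp[OF s0 b'(1)] .
  have s2: "\<And>x. \<bar>x\<bar> > 1 \<Longrightarrow> b'' x = 0" using supp[OF s1 b''(1)] .
  obtain B0 where "B0 \<ge> 0" "\<forall>x. \<bar>bump x\<bar> \<le> B0" using bdd[OF s0 b'(1)] by blast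
  moreover obtain B1 where "B1 \<ge> 0" "\<forall>x. \<bar>b' x\<bar> \<le> B1" using bdd[OF s1 b''(1)] by blast
  moreover obtain B2 where "B2 \<ge> 0" "\<forall>x. \<bar>b'' x\<bar> \<le> B2" using bdd[OF s2 b3] by blast
  ultimately show ?thesis
    by (intro that[of b' b'' "max B0 (max B1 B2)"] b' b'' s1 s2) (auto simp: le_max_iff_disj)
qed

definition truncation :: "(real \<Rightarrow> real) \<Rightarrow> real \<Rightarrow> real \<Rightarrow> real" where
  "truncation \<psi> N x = \<psi> x * bump (x / N)"

lemma smooth_test_function_truncation:
  assumes "\<And>k. times_differentiable k \<psi>" "N > 0"
  shows "smooth_test_function (truncation \<psi> N)"
  unfolding smooth_test_function_def
proof (intro conjI allI)
  fix m x
  have "times_differentiable (Suc m) (\<lambda>x. \<psi> x * bump ((1 / N) * x + 0))"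
    by (rule times_differentiable_mult[OF assms(1) times_differentiable_affine[OF times_differentiable_bump]])
  then show "(deriv ^^ m) (truncation \<psi> N) field_differentiable at x"
    by (simp add: times_differentiable_def truncation_def[abs_def])
next
  have "\<bar>x\<bar> \<le> N" if "truncation \<psi> N x \<noteq> 0" for x
  proof (rule ccontr)
    assume "\<not> \<bar>x\<bar> \<le> N"
    with \<open>N > 0\<close> have "\<bar>x / N\<bar> \<ge> 1" by (simp add: field_simps)
    with that show False by (simp add: truncation_def bump_eq_0)
  qed
  then have "{x. truncation \<psi> N x \<noteq> 0} \<subseteq> cball 0 N"
    by (auto simp: dist_real_def)
  then show "compact (closure {x. truncation \<psi> N x \<noteq> 0})"
    by (meson bounded_cball bounded_subset compact_closure)
qed

text \<open>The growth allowed for \<open>\<psi>\<close> is that of a fourth power. What dominated convergence needs is that the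
truncations inherit the bounds on both derivatives with a constant independent of \<open>n\<close>. They do: a derivative
that falls on the cut-off instead of \<open>\<psi>\<close> leaves one power of \<open>\<bar>x\<bar>\<close> too many, but it also produces a factor
\<open>1 / (n + 1)\<close>, on a set where \<open>\<bar>x\<bar> \<le> n + 1\<close>.\<close>

lemma truncation_approximation:
  assumes \<psi>: "\<And>k. times_differentiable k \<psi>"
    and \<psi>': "\<And>x. (\<psi> has_field_derivative \<psi>' x) (at x)"
    and \<psi>'': "\<And>x. (\<psi>' has_field_derivative \<psi>'' x) (at x)"
    and growth: "\<And>x. \<bar>\<psi> x\<bar> \<le> K * (1 + \<bar>x\<bar> ^ 4)" "\<And>x. \<bar>\<psi>' x\<bar> \<le> K * (1 + \<bar>x\<bar> ^ 3)"
      "\<And>x. \<bar>\<psi>'' x\<bar> \<le> K * (1 + \<bar>x\<bar> ^ 2)"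
  obtains \<phi> C where "\<And>n::nat. smooth_test_function (\<phi> n)"
    "\<And>x. (\<lambda>n. deriv (\<phi> n) x) \<longlonglongrightarrow> \<psi>' x" "\<And>x. (\<lambda>n. deriv (deriv (\<phi> n)) x) \<longlonglongrightarrow> \<psi>'' x"
    "\<And>n x. \<bar>deriv (\<phi> n) x\<bar> \<le> C * (1 + \<bar>x\<bar> ^ 3)"
    "\<And>n x. \<bar>deriv (deriv (\<phi> n)) x\<bar> \<le> C * (1 + \<bar>x\<bar> ^ 2)"
proof -
  obtain b' b'' B where
    b: "\<And>x. (bump has_field_derivative b' x) (at x)"
      "\<And>x. (b' has_field_derivative b'' x) (at x)"
    and B: "\<And>x. \<bar>bump x\<bar> \<le> B" "\<And>x. \<bar>b' x\<bar> \<le> B" "\<And>x. \<bar>b'' x\<bar> \<le> B"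
    and s: "\<And>x. \<bar>x\<bar> > 1 \<Longrightarrow> b' x = 0" "\<And>x. \<bar>x\<bar> > 1 \<Longrightarrow> b'' x = 0" and "B \<ge> 0"
    using bump_derivatives by blast
  have "K \<ge> 0" using growth(1)[of 0] by simp
  define \<phi> where "\<phi> n = truncation \<psi> (real (Suc n))" for n
  define r where "r n = 1 / real (Suc n)" for n
  have r: "0 < r n" "r n \<le> 1" for n by (auto simp: r_def)
  have r0: "r \<longlonglongrightarrow> 0" unfolding r_def by (rule LIMSEQ_Suc[OF lim_1_over_n])
  have \<phi>_eq: "\<phi> n = (\<lambda>x. \<psi> x * bump (r n * x))" for n
    by (simp add: \<phi>_def truncation_def[abs_def] r_def)
  have lin: "((\<lambda>x. r n * x) has_field_derivative r n) (at x)" for n x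
    by (auto intro!: derivative_eq_intros)
  have br: "((\<lambda>x. bump (r n * x)) has_field_derivative b' (r n * x) * r n) (at x)"
    "((\<lambda>x. b' (r n * x)) has_field_derivative b'' (r n * x) * r n) (at x)" for n x
    using DERIV_chain2[OF b(1) lin] DERIV_chain2[OF b(2) lin] by blast+
  have d1: "deriv (\<phi> n) = (\<lambda>x. \<psi>' x * bump (r n * x) + b' (r n * x) * r n * \<psi> x)" for n
    unfolding \<phi>_eq by (intro ext DERIV_imp_deriv DERIV_mult \<psi>' br)
  have "deriv (deriv (\<phi> n)) = (\<lambda>x. (\<psi>'' x * bump (r n * x) + b' (r n * x) * r n * \<psi>' x)
      + (b'' (r n * x) * r n * r n * \<psi> x + \<psi>' x * (b' (r n * x) * r n)))" for n
    unfolding d1 by (intro ext DERIV_imp_deriv DERIV_add DERIV_mult DERIV_cmult_right \<psi>' \<psi>'' br)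
  then have d2: "deriv (deriv (\<phi> n)) = (\<lambda>x. \<psi>'' x * bump (r n * x)
      + 2 * (\<psi>' x * (b' (r n * x) * r n)) + \<psi> x * (b'' (r n * x) * (r n)\<^sup>2))" for n
    by (simp add: fun_eq_iff power2_eq_square algebra_simps)
  have tb: "(\<lambda>n. bump (r n * x)) \<longlonglongrightarrow> 1" "(\<lambda>n. b' (r n * x) * r n) \<longlonglongrightarrow> 0"
    "(\<lambda>n. b'' (r n * x) * (r n)\<^sup>2) \<longlonglongrightarrow> 0" for x
  proof -
    have "(\<lambda>n. r n * x) \<longlonglongrightarrow> 0" using tendsto_mult_right[OF r0, of x] by simp
    then show "(\<lambda>n. bump (r n * x)) \<longlonglongrightarrow> 1"
      using isCont_tendsto_compose[OF DERIV_isCont[OF b(1)[of 0]]] by (simp add: bump_0)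
    show "(\<lambda>n. b' (r n * x) * r n) \<longlonglongrightarrow> 0"
      by (rule Lim_null_comparison[OF _ tendsto_mult_right_zero[OF r0, of B]])
         (use B(2) r(1) in \<open>auto simp: abs_mult less_imp_le intro!: mult_right_mono\<close>)
    have "(\<lambda>n. B * (r n)\<^sup>2) \<longlonglongrightarrow> 0"
      using tendsto_mult[OF tendsto_const tendsto_power[OF r0, of 2]] by simp
    then show "(\<lambda>n. b'' (r n * x) * (r n)\<^sup>2) \<longlonglongrightarrow> 0"
      by (rule Lim_null_comparison[rotated])
         (use B(3) in \<open>auto simp: abs_mult intro!: mult_right_mono always_eventually\<close>)
  qed
  \<comment> \<open>on the support of the cut-off one has \<open>|x| \<le> 1 / r\<close>, so a factor \<open>r\<close> pays for one power of \<open>|x|\<close>\<close>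
  have pay: "\<bar>b' (r n * x) * r n\<bar> * \<bar>x\<bar> \<le> B" "\<bar>b' (r n * x) * r n\<bar> \<le> B"
    "\<bar>b'' (r n * x) * (r n)\<^sup>2\<bar> * \<bar>x\<bar>^2 \<le> B" "\<bar>b'' (r n * x) * (r n)\<^sup>2\<bar> \<le> B" for n x
  proof -
    have 1: "\<bar>b' (r n * x) * r n\<bar> * \<bar>x\<bar> = \<bar>b' (r n * x)\<bar> * \<bar>r n * x\<bar>"
      by (simp add: abs_mult mult_ac)
    have 2: "\<bar>b'' (r n * x) * (r n)\<^sup>2\<bar> * \<bar>x\<bar>^2 = \<bar>b'' (r n * x)\<bar> * \<bar>r n * x\<bar>^2"
      by (simp add: abs_mult power_mult_distrib mult_ac)
    show "\<bar>b' (r n * x) * r n\<bar> * \<bar>x\<bar> \<le> B"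
      unfolding 1 using s(1)[of "r n * x"] B(2)[of "r n * x"] \<open>B \<ge> 0\<close>
      by (cases "\<bar>r n * x\<bar> > 1") (auto intro: order_trans[OF mult_left_le])
    show "\<bar>b'' (r n * x) * (r n)\<^sup>2\<bar> * \<bar>x\<bar>^2 \<le> B"
    proof (cases "\<bar>r n * x\<bar> > 1")
      case False
      then have "\<bar>r n * x\<bar>^2 \<le> 1" by (intro power_le_one) auto
      then show ?thesis
        unfolding 2 using B(3)[of "r n * x"] by (auto intro: order_trans[OF mult_left_le])
    qed (use s(2)[of "r n * x"] \<open>B \<ge> 0\<close> in simp)
    show "\<bar>b' (r n * x) * r n\<bar> \<le> B"
      using B(2)[of "r n * x"] r[of n] by (auto simp: abs_mult intro: order_trans[OF mult_left_le])
    have "(r n)\<^sup>2 \<le> 1" using r[of n] by (intro power_le_one) auto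
    then show "\<bar>b'' (r n * x) * (r n)\<^sup>2\<bar> \<le> B"
      using B(3)[of "r n * x"] by (auto simp: abs_mult intro: order_trans[OF mult_left_le])
  qed
  have m1: "(1 + y ^ 4) * c \<le> 2 * B * (1 + y ^ 3)" if "y \<ge> 0" "0 \<le> c" "c * y \<le> B" "c \<le> B" for y c :: real
  proof -
    have "(1 + y ^ 4) * c = c + y^3 * (c * y)" by (simp add: algebra_simps power_numeral_reduce)
    also have "\<dots> \<le> B + y^3 * B" using that by (intro add_mono mult_left_mono) auto
    also have "\<dots> \<le> 2 * B * (1 + y ^ 3)" using that \<open>B \<ge> 0\<close> by (simp add: algebra_simps)
    finally show ?thesis .
  qed
  have m2: "(1 + y ^ 3) * c \<le> 2 * B * (1 + y\<^sup>2)" if "y \<ge> 0" "0 \<le> c" "c * y \<le> B" "c \<le> B" for y c :: real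
  proof -
    have "(1 + y ^ 3) * c = c + y^2 * (c * y)" by (simp add: algebra_simps power_numeral_reduce)
    also have "\<dots> \<le> B + y^2 * B" using that by (intro add_mono mult_left_mono) auto
    also have "\<dots> \<le> 2 * B * (1 + y ^ 2)" using that \<open>B \<ge> 0\<close> by (simp add: algebra_simps)
    finally show ?thesis .
  qed
  have m3: "(1 + y ^ 4) * c \<le> 2 * B * (1 + y\<^sup>2)" if "y \<ge> 0" "0 \<le> c" "c * y\<^sup>2 \<le> B" "c \<le> B" for y c :: real
  proof -
    have "(1 + y ^ 4) * c = c + y^2 * (c * y^2)" by (simp add: algebra_simps power_numeral_reduce)
    also have "\<dots> \<le> B + y^2 * B" using that by (intro add_mono mult_left_mono) auto
    also have "\<dots> \<le> 2 * B * (1 + y ^ 2)" using that \<open>B \<ge> 0\<close> by (simp add: algebra_simps)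
    finally show ?thesis .
  qed
  show ?thesis
  proof (rule that[of \<phi> "7 * K * B"])
    show "smooth_test_function (\<phi> n)" for n
      unfolding \<phi>_def by (rule smooth_test_function_truncation[OF \<psi>]) simp
    show "(\<lambda>n. deriv (\<phi> n) x) \<longlonglongrightarrow> \<psi>' x" for x
      using tendsto_add[OF tendsto_mult[OF tendsto_const tb(1)] tendsto_mult[OF tb(2) tendsto_const],
          of "\<psi>' x" x x "\<psi> x"]
      by (simp add: d1)
    show "(\<lambda>n. deriv (deriv (\<phi> n)) x) \<longlonglongrightarrow> \<psi>'' x" for x
      using tendsto_add[OF tendsto_add[OF tendsto_mult[OF tendsto_const tb(1)]
            tendsto_mult[OF tendsto_const tendsto_mult[OF tendsto_const tb(2)]]]
          tendsto_mult[OF tendsto_const tb(3)], of "\<psi>'' x" x 2 "\<psi>' x" x "\<psi> x" x]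
      by (simp add: d2)
    fix n x
    have KB: "0 \<le> K * B" using \<open>K \<ge> 0\<close> \<open>B \<ge> 0\<close> by simp
    have p: "0 \<le> K * B * \<bar>x\<bar> ^ 3" "0 \<le> K * B * \<bar>x\<bar> ^ 2" using KB by simp_all
    have g: "\<bar>\<psi>' x * bump (r n * x)\<bar> \<le> K * (1 + \<bar>x\<bar>^3) * B"
      "\<bar>\<psi>'' x * bump (r n * x)\<bar> \<le> K * (1 + \<bar>x\<bar>^2) * B"
      unfolding abs_mult using growth B \<open>K \<ge> 0\<close> by (auto intro!: mult_mono)
    have h1: "\<bar>\<psi> x * (b' (r n * x) * r n)\<bar> \<le> K * (2 * B * (1 + \<bar>x\<bar>^3))"
      unfolding abs_mult[of "\<psi> x"]
      by (rule order_trans[OF mult_right_mono[OF growth(1)]])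
         (use m1[of "\<bar>x\<bar>" "\<bar>b' (r n * x) * r n\<bar>"] pay[of n x] \<open>K \<ge> 0\<close> in
           \<open>auto simp: mult.assoc intro!: mult_left_mono\<close>)
    have h2: "\<bar>\<psi>' x * (b' (r n * x) * r n)\<bar> \<le> K * (2 * B * (1 + \<bar>x\<bar>^2))"
      unfolding abs_mult[of "\<psi>' x"]
      by (rule order_trans[OF mult_right_mono[OF growth(2)]])
         (use m2[of "\<bar>x\<bar>" "\<bar>b' (r n * x) * r n\<bar>"] pay[of n x] \<open>K \<ge> 0\<close> in
           \<open>auto simp: mult.assoc intro!: mult_left_mono\<close>)
    have h3: "\<bar>\<psi> x * (b'' (r n * x) * (r n)\<^sup>2)\<bar> \<le> K * (2 * B * (1 + \<bar>x\<bar>^2))"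
      unfolding abs_mult[of "\<psi> x"]
      by (rule order_trans[OF mult_right_mono[OF growth(1)]])
         (use m3[of "\<bar>x\<bar>" "\<bar>b'' (r n * x) * (r n)\<^sup>2\<bar>"] pay[of n x] \<open>K \<ge> 0\<close> in
           \<open>auto simp: mult.assoc intro!: mult_left_mono\<close>)
    show "\<bar>deriv (\<phi> n) x\<bar> \<le> 7 * K * B * (1 + \<bar>x\<bar> ^ 3)"
    proof -
      have "\<bar>deriv (\<phi> n) x\<bar> \<le> K * (1 + \<bar>x\<bar>^3) * B + K * (2 * B * (1 + \<bar>x\<bar>^3))"
        unfolding d1 mult.commute[of "b' (r n * x) * r n"] using g(1) h1 by linarith
      also have "\<dots> \<le> 7 * K * B * (1 + \<bar>x\<bar> ^ 3)" using KB p by (simp add: algebra_simps)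
      finally show ?thesis .
    qed
    show "\<bar>deriv (deriv (\<phi> n)) x\<bar> \<le> 7 * K * B * (1 + \<bar>x\<bar> ^ 2)"
    proof -
      have "\<bar>deriv (deriv (\<phi> n)) x\<bar> \<le> K * (1 + \<bar>x\<bar>^2) * B + 2 * (K * (2 * B * (1 + \<bar>x\<bar>^2)))
          + K * (2 * B * (1 + \<bar>x\<bar>^2))"
        unfolding d2 using g(2) h2 h3 by linarith
      also have "\<dots> \<le> 7 * K * B * (1 + \<bar>x\<bar> ^ 2)" using KB p by (simp add: algebra_simps)
      finally show ?thesis .
    qed
  qed
qed

section \<open>Square integrable functions\<close>

lemma L2_measurable: "f \<in> L2 M \<Longrightarrow> f \<in> borel_measurable M"
  by (simp add: L2_def)

lemma L2_square_integrable: "f \<in> L2 M \<Longrightarrow> integrable M (\<lambda>x. (f x)\<^sup>2)"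
  by (simp add: L2_def)

lemma L2_mult_integrable:
  assumes "f \<in> L2 M" "g \<in> L2 M"
  shows "integrable M (\<lambda>x. f x * g x)"
proof (rule Bochner_Integration.integrable_bound)
  show "integrable M (\<lambda>x. (f x)\<^sup>2 + (g x)\<^sup>2)"
    using assms by (simp add: L2_square_integrable)
  show "(\<lambda>x. f x * g x) \<in> borel_measurable M"
    using assms by (intro borel_measurable_times L2_measurable)
  have "\<bar>a * b\<bar> \<le> a\<^sup>2 + b\<^sup>2" for a b :: real
    using sum_squares_bound[of "\<bar>a\<bar>" "\<bar>b\<bar>"] abs_ge_zero[of "a * b"]
    unfolding abs_mult power2_abs by linarith
  then show "AE x in M. norm (f x * g x) \<le> norm ((f x)\<^sup>2 + (g x)\<^sup>2)"
    by simp
qed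

lemma L2_scale: "f \<in> L2 M \<Longrightarrow> (\<lambda>x. c * f x) \<in> L2 M"
  by (auto simp: L2_def power_mult_distrib)

lemma L2_add: "f \<in> L2 M \<Longrightarrow> g \<in> L2 M \<Longrightarrow> (\<lambda>x. f x + g x) \<in> L2 M"
  using L2_mult_integrable[of f M g] by (auto simp: L2_def power2_sum mult.assoc)

lemma L2_sum: "(\<And>i. i \<in> I \<Longrightarrow> f i \<in> L2 M) \<Longrightarrow> (\<lambda>x. \<Sum>i\<in>I. f i x) \<in> L2 M"
proof (induction I rule: infinite_finite_induct)
  case (insert i I)
  then show ?case using L2_add[of "f i" M "\<lambda>x. \<Sum>i\<in>I. f i x"] by simp
qed (simp_all add: L2_def)

lemma L2_cong_AE:
  assumes "f \<in> L2 M" "AE x in M. f x = g x" "g \<in> borel_measurable M"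
  shows "g \<in> L2 M"
proof -
  have [measurable]: "f \<in> borel_measurable M" using assms by (simp add: L2_measurable)
  have "integrable M (\<lambda>x. (g x)\<^sup>2)"
    using assms by (subst integrable_cong_AE[where g = "\<lambda>x. (f x)\<^sup>2"]) (auto simp: L2_def)
  with assms show ?thesis by (simp add: L2_def)
qed

lemma L2_norm_eq_0_iff:
  assumes "f \<in> L2 M"
  shows "L2_norm M f = 0 \<longleftrightarrow> (AE x in M. f x = 0)"
proof -
  have "L2_norm M f = 0 \<longleftrightarrow> (\<integral>x. (f x)\<^sup>2 \<partial>M) = 0"
    by (simp add: L2_norm_def L2_inner_def power2_eq_square)
  also have "\<dots> \<longleftrightarrow> (AE x in M. (f x)\<^sup>2 = 0)"
    by (rule integral_nonneg_eq_0_iff_AE[OF L2_square_integrable[OF assms]]) simp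
  finally show ?thesis by simp
qed

lemma L2_norm_cong_AE:
  assumes "AE x in M. f x = g x" "f \<in> borel_measurable M" "g \<in> borel_measurable M"
  shows "L2_norm M f = L2_norm M g"
proof -
  have "(\<integral>x. f x * f x \<partial>M) = (\<integral>x. g x * g x \<partial>M)"
    using assms by (intro integral_cong_AE borel_measurable_times) (auto elim: eventually_mono)
  then show ?thesis by (simp add: L2_norm_def L2_inner_def)
qed

lemma L2_Cauchy_Schwarz:
  assumes f: "f \<in> L2 M" and g: "g \<in> L2 M"
  shows "(\<integral>x. f x * g x \<partial>M)\<^sup>2 \<le> (\<integral>x. (f x)\<^sup>2 \<partial>M) * (\<integral>x. (g x)\<^sup>2 \<partial>M)"
proof -
  let ?a = "\<integral>x. (f x)\<^sup>2 \<partial>M" and ?b = "\<integral>x. f x * g x \<partial>M" and ?c = "\<integral>x. (g x)\<^sup>2 \<partial>M"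
  have quad: "0 \<le> ?a - 2 * s * ?b + s\<^sup>2 * ?c" for s
  proof -
    have "0 \<le> (\<integral>x. (f x - s * g x)\<^sup>2 \<partial>M)" by simp
    also have "\<dots> = (\<integral>x. (f x)\<^sup>2 - 2 * s * (f x * g x) + s\<^sup>2 * (g x)\<^sup>2 \<partial>M)"
      by (simp add: power2_diff power_mult_distrib algebra_simps)
    also have "\<dots> = ?a - 2 * s * ?b + s\<^sup>2 * ?c"
      using L2_square_integrable[OF f] L2_square_integrable[OF g] L2_mult_integrable[OF f g] by simp
    finally show ?thesis .
  qed
  show ?thesis
  proof (cases "?c = 0")
    case True
    then have "AE x in M. g x = 0"
      using L2_norm_eq_0_iff[OF g] by (simp add: L2_norm_def L2_inner_def power2_eq_square)
    then have "?b = 0" by (intro integral_eq_zero_AE) (auto elim: eventually_mono)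
    with True show ?thesis by simp
  next
    case False
    then have "?c > 0" by (simp add: less_le)
    then have "0 \<le> ?c * (?a - 2 * (?b / ?c) * ?b + (?b / ?c)\<^sup>2 * ?c)"
      using quad[of "?b / ?c"] by (intro mult_nonneg_nonneg) auto
    also have "\<dots> = ?a * ?c - ?b\<^sup>2"
      using \<open>?c > 0\<close> by (simp add: field_simps power2_eq_square)
    finally show ?thesis by simp
  qed
qed

lemma (in prob_space) L2_integrable: "f \<in> L2 M \<Longrightarrow> integrable M f"
  using L2_mult_integrable[of f M "\<lambda>_. 1"] by (simp add: L2_def)

section \<open>Symmetric diffusion generators with discrete spectrum\<close>

lemma carre_du_champ_commute: "carre_du_champ L F G x = carre_du_champ L G F x"
  by (simp add: carre_du_champ_def mult.commute)

locale diffusion_generator =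
  fixes M :: "'a measure" and D :: "('a \<Rightarrow> real) set"
    and L :: "('a \<Rightarrow> real) \<Rightarrow> 'a \<Rightarrow> real" and lam :: "nat \<Rightarrow> real"
  assumes generator: "symmetric_markov_generator M D L"
    and spectrum: "has_discrete_spectrum M D L lam"
    and diffusive: "diffusive M D L"

sublocale diffusion_generator \<subseteq> prob_space M
  using generator by (simp add: symmetric_markov_generator_def)

context diffusion_generator
begin

lemma operator: "L2_operator M D L"
  using generator by (simp add: symmetric_markov_generator_def)

lemma domain_L2: "f \<in> D \<Longrightarrow> f \<in> L2 M"
  using operator by (auto simp: L2_operator_def)

lemma L_L2: "f \<in> D \<Longrightarrow> L f \<in> L2 M"
  using operator by (auto simp: L2_operator_def)

lemma domain_measurable [measurable_dest]: "f \<in> D \<Longrightarrow> f \<in> borel_measurable M"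
  by (simp add: domain_L2 L2_measurable)

lemma L_measurable [measurable_dest]: "f \<in> D \<Longrightarrow> L f \<in> borel_measurable M"
  by (simp add: L_L2 L2_measurable)

lemma domain_cong_AE:
  assumes "f \<in> D" "AE x in M. f x = g x" "g \<in> borel_measurable M"
  shows "g \<in> D" "AE x in M. L g x = L f x"
proof -
  have "g \<in> D \<and> (AE x in M. L f x = L g x)"
    using operator assms unfolding L2_operator_def by blast
  then show "g \<in> D" "AE x in M. L g x = L f x" by (simp_all add: eq_commute)
qed

lemma L_sum:
  assumes "\<And>i. i \<in> I \<Longrightarrow> f i \<in> D"
  shows "(\<lambda>x. \<Sum>i\<in>I. c i * f i x) \<in> D \<and>
    (AE x in M. L (\<lambda>x. \<Sum>i\<in>I. c i * f i x) x = (\<Sum>i\<in>I. c i * L (f i) x))"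
proof -
  have zero: "(\<lambda>_. 0) \<in> D" using operator by (simp add: L2_operator_def)
  have scale: "(\<lambda>x. c * f x) \<in> D" "AE x in M. L (\<lambda>x. c * f x) x = c * L f x" if "f \<in> D" for f c
    using operator that by (auto simp: L2_operator_def)
  have add: "(\<lambda>x. f x + g x) \<in> D" "AE x in M. L (\<lambda>x. f x + g x) x = L f x + L g x"
    if "f \<in> D" "g \<in> D" for f g
    using operator that by (auto simp: L2_operator_def)
  have L0: "AE x in M. L (\<lambda>_. 0) x = 0"
    using scale(2)[OF zero, of 0] by simp
  show ?thesis
    using assms
  proof (induction I rule: infinite_finite_induct)
    case (insert i I)
    have 1: "(\<lambda>x. c i * f i x) \<in> D" "AE x in M. L (\<lambda>x. c i * f i x) x = c i * L (f i) x"
      using scale insert.prems by auto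
    have 2: "(\<lambda>x. \<Sum>i\<in>I. c i * f i x) \<in> D"
      "AE x in M. L (\<lambda>x. \<Sum>i\<in>I. c i * f i x) x = (\<Sum>i\<in>I. c i * L (f i) x)"
      using insert by auto
    show ?case
    proof
      show "(\<lambda>x. \<Sum>i\<in>insert i I. c i * f i x) \<in> D"
        using add(1)[OF 1(1) 2(1)] insert.hyps by simp
      show "AE x in M. L (\<lambda>x. \<Sum>i\<in>insert i I. c i * f i x) x = (\<Sum>i\<in>insert i I. c i * L (f i) x)"
        using add(2)[OF 1(1) 2(1)] 1(2) 2(2) by eventually_elim (use insert.hyps in simp)
    qed
  qed (use zero L0 in auto)
qed

lemma symmetric:
  assumes "f \<in> D" "g \<in> D"
  shows "(\<integral>x. L f x * g x \<partial>M) = (\<integral>x. f x * L g x \<partial>M)"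
proof -
  have "(g, L g) \<in> adjoint_graph M D L"
    using generator assms L_L2 by (simp add: symmetric_markov_generator_def self_adjoint_def)
  then show ?thesis
    using assms by (simp add: adjoint_graph_def L2_inner_def)
qed

lemma integral_L:
  assumes "f \<in> D"
  shows "(\<integral>x. L f x \<partial>M) = 0"
proof -
  have 1: "(\<lambda>_. 1) \<in> D" "AE x in M. L (\<lambda>_. 1) x = 0"
    using generator by (simp_all add: symmetric_markov_generator_def)
  have "(\<integral>x. L f x \<partial>M) = (\<integral>x. f x * L (\<lambda>_. 1) x \<partial>M)"
    using symmetric[OF assms 1(1)] by simp
  also have "\<dots> = 0"
    using 1(2) by (intro integral_eq_zero_AE) auto
  finally show ?thesis .
qed

lemma eigenspace_domain: "f \<in> eigenspace M D L a \<Longrightarrow> f \<in> D"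
  by (simp add: eigenspace_def)

lemma L_eigen:
  assumes "f \<in> eigenspace M D L a"
  shows "AE x in M. L f x = - (a * f x)"
proof -
  have "AE x in M. L f x + a * f x = 0" using assms by (simp add: eigenspace_def)
  then show ?thesis by eventually_elim simp
qed

text \<open>There is something to show only if \<open>lam\<close> is bounded by \<open>c\<close>. Then \<open>lam\<close> increases strictly to a
limit \<open>s\<close>, and \<open>-s\<close> is not one of the \<open>- lam k\<close>, hence belongs to the resolvent set. So \<open>L + s\<close> is bounded below, while it acts as
\<open>s - lam r\<close> on the eigenspace of \<open>- lam r\<close>: for large \<open>r\<close> this eigenspace is trivial.\<close>

lemma eigenspaces_vanish_eventually:
  "\<exists>N. \<forall>r\<ge>N. lam r \<le> c \<longrightarrow> (\<forall>f\<in>eigenspace M D L (lam r). AE x in M. f x = 0)"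
proof (cases "\<exists>N. lam N > c")
  case True
  have "mono lam" using spectrum by (simp add: has_discrete_spectrum_def strict_mono_mono)
  with True show ?thesis by (meson leD monoD order.trans)
next
  case False
  have mono: "strict_mono lam" and spec: "op_spectrum M D L = range (\<lambda>k. - lam k)"
    using spectrum by (auto simp: has_discrete_spectrum_def)
  have "incseq lam" using mono by (simp add: strict_mono_mono)
  then obtain s where s: "lam \<longlonglongrightarrow> s" "\<And>r. lam r \<le> s"
    using incseq_convergent[of lam c] False by (auto simp: not_less)
  have less: "lam r < s" for r
    using s(2)[of "Suc r"] mono by (meson lessI less_le_trans strict_monoD)
  have "- s \<notin> op_spectrum M D L"
    unfolding spec using less by force
  then obtain c0 where "c0 > 0" and
    c0: "\<And>f. f \<in> D \<Longrightarrow> c0 * L2_norm M f \<le> L2_norm M (\<lambda>x. L f x - - s * f x)"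
    by (auto simp: op_spectrum_def resolvent_set_def)
  obtain N where N: "\<And>r. r \<ge> N \<Longrightarrow> s - lam r < c0"
  proof -
    have "(\<lambda>r. s - lam r) \<longlonglongrightarrow> s - s" by (intro tendsto_intros s)
    then have "\<forall>\<^sub>F r in sequentially. s - lam r < c0"
      using \<open>c0 > 0\<close> by (intro order_tendstoD) auto
    then show ?thesis using that by (auto simp: eventually_sequentially)
  qed
  have "AE x in M. f x = 0" if r: "r \<ge> N" and f: "f \<in> eigenspace M D L (lam r)" for r f
  proof -
    have fD: "f \<in> D" using f by (rule eigenspace_domain)
    have nonneg: "0 \<le> L2_norm M f" by (simp add: L2_norm_def L2_inner_def)
    have "c0 * L2_norm M f \<le> L2_norm M (\<lambda>x. L f x - - s * f x)" by (rule c0[OF fD])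
    also have "\<dots> = L2_norm M (\<lambda>x. (s - lam r) * f x)"
      by (rule L2_norm_cong_AE)
         (use L_eigen[OF f] fD in \<open>auto simp: algebra_simps elim!: eventually_mono\<close>)
    also have "\<dots> = (s - lam r) * L2_norm M f"
      using less[of r]
      by (simp add: L2_norm_def L2_inner_def real_sqrt_mult power_mult_distrib flip: power2_eq_square)
    finally have "(c0 - (s - lam r)) * L2_norm M f \<le> 0" by (simp add: algebra_simps)
    then have "L2_norm M f = 0"
      using N[OF r] nonneg by (simp add: mult_le_0_iff)
    then show ?thesis using L2_norm_eq_0_iff[OF domain_L2[OF fD]] by simp
  qed
  then show ?thesis by blast
qed

text \<open>Finiteness of the sum allows \<open>L\<close> to be applied term by term.\<close>

lemma eigen_sum_finite:
  assumes "f \<in> eigen_sum M D L lam {r. lam r \<le> c}"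
  obtains I u where "finite I" "I \<subseteq> {r. lam r \<le> c}"
    "\<And>r. r \<in> I \<Longrightarrow> u r \<in> eigenspace M D L (lam r)" "AE x in M. f x = (\<Sum>r\<in>I. u r x)"
proof -
  let ?J = "{r. lam r \<le> c}"
  obtain u where u: "\<And>r. r \<in> ?J \<Longrightarrow> u r \<in> eigenspace M D L (lam r)"
    and lim: "(\<lambda>n. L2_norm M (\<lambda>x. f x - (\<Sum>r\<in>?J \<inter> {..<n}. u r x))) \<longlonglongrightarrow> 0" and f: "f \<in> L2 M"
    using assms by (auto simp: eigen_sum_def)
  obtain N where N: "\<And>r g. r \<ge> N \<Longrightarrow> r \<in> ?J \<Longrightarrow> g \<in> eigenspace M D L (lam r) \<Longrightarrow> AE x in M. g x = 0"
    using eigenspaces_vanish_eventually[of c] by blast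
  have uL2: "u r \<in> L2 M" if "r \<in> ?J" for r
    using u[OF that] by (intro domain_L2 eigenspace_domain)
  have diffL2: "(\<lambda>x. f x - (\<Sum>r\<in>?J \<inter> {..<n}. u r x)) \<in> L2 M" for n
    using L2_add[OF f L2_scale[OF L2_sum[of "?J \<inter> {..<n}" u M], of "-1"]] uL2 by simp
  have "AE x in M. (\<Sum>r\<in>?J \<inter> {..<n}. u r x) = (\<Sum>r\<in>?J \<inter> {..<N}. u r x)" if "n \<ge> N" for n
  proof -
    have "AE x in M. \<forall>r\<in>?J \<inter> {N..<n}. u r x = 0"
      using N u by (intro AE_finite_allI) auto
    then show ?thesis
    proof eventually_elim
      case (elim x)
      have split: "?J \<inter> {..<n} = (?J \<inter> {..<N}) \<union> (?J \<inter> {N..<n})" using that by auto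
      have "(\<Sum>r\<in>?J \<inter> {..<n}. u r x)
          = (\<Sum>r\<in>?J \<inter> {..<N}. u r x) + (\<Sum>r\<in>?J \<inter> {N..<n}. u r x)"
        unfolding split by (rule sum.union_disjoint) auto
      with elim show ?case by simp
    qed
  qed
  then have norm_const: "L2_norm M (\<lambda>x. f x - (\<Sum>r\<in>?J \<inter> {..<n}. u r x))
      = L2_norm M (\<lambda>x. f x - (\<Sum>r\<in>?J \<inter> {..<N}. u r x))" if "n \<ge> N" for n
    using that L2_measurable[OF diffL2] by (intro L2_norm_cong_AE) (auto elim!: eventually_mono)
  then have "(\<lambda>n. L2_norm M (\<lambda>x. f x - (\<Sum>r\<in>?J \<inter> {..<n}. u r x)))
      \<longlonglongrightarrow> L2_norm M (\<lambda>x. f x - (\<Sum>r\<in>?J \<inter> {..<N}. u r x))"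
    by (rule tendsto_eventually[OF eventually_sequentiallyI])
  with lim have "L2_norm M (\<lambda>x. f x - (\<Sum>r\<in>?J \<inter> {..<N}. u r x)) = 0"
    using LIMSEQ_unique by blast
  then have "AE x in M. f x = (\<Sum>r\<in>?J \<inter> {..<N}. u r x)"
    using L2_norm_eq_0_iff[OF diffL2] by auto
  with u show ?thesis by (intro that[of "?J \<inter> {..<N}" u]) auto
qed

text \<open>For \<open>f = \<Sum>\<^sub>r u\<^sub>r\<close> with orthogonal eigenfunctions \<open>u\<^sub>r\<close> the integral is
\<open>- \<Sum>\<^sub>r lam r (c - lam r) \<parallel>u\<^sub>r\<parallel>\<^sup>2\<close>, and \<open>0 \<le> lam r \<le> c\<close>. This inequality is the quantitative use of the
spectral bound in the definition of a chaotic vector.\<close>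

lemma eigen_sum_domain:
  assumes "f \<in> eigen_sum M D L lam {r. lam r \<le> c}"
  shows "f \<in> D" and "(\<integral>x. L f x * (L f x + c * f x) \<partial>M) \<le> 0"
proof -
  obtain I u where I: "finite I" "I \<subseteq> {r. lam r \<le> c}"
    and u: "\<And>r. r \<in> I \<Longrightarrow> u r \<in> eigenspace M D L (lam r)"
    and f: "AE x in M. f x = (\<Sum>r\<in>I. u r x)"
    using eigen_sum_finite[OF assms] by blast
  have uD: "r \<in> I \<Longrightarrow> u r \<in> D" for r using u eigenspace_domain by blast
  define g where "g x = (\<Sum>r\<in>I. 1 * u r x)" for x
  have g: "g \<in> D" "AE x in M. L g x = (\<Sum>r\<in>I. 1 * L (u r) x)"
    unfolding g_def using L_sum[of I u "\<lambda>_. 1"] uD by auto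
  have fm: "f \<in> borel_measurable M" using assms by (simp add: eigen_sum_def L2_def)
  have gf: "AE x in M. g x = f x" using f by (simp add: g_def eq_commute)
  show "f \<in> D" using domain_cong_AE(1)[OF g(1) gf fm] .
  have Lf: "AE x in M. L f x = (\<Sum>r\<in>I. - lam r * u r x)"
  proof -
    have "AE x in M. \<forall>r\<in>I. L (u r) x = - (lam r * u r x)"
      using I(1) u L_eigen by (intro AE_finite_allI) auto
    with g(2) domain_cong_AE(2)[OF g(1) gf fm] show ?thesis by eventually_elim simp
  qed
  have orth: "(\<integral>x. u r x * u s x \<partial>M) = 0" if "r \<in> I" "s \<in> I" "r \<noteq> s" for r s
    using spectrum u[OF that(1)] u[OF that(2)] that(3) by (auto simp: has_discrete_spectrum_def L2_inner_def)
  have int: "integrable M (\<lambda>x. u r x * u s x)" if "r \<in> I" "s \<in> I" for r s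
    using that by (intro L2_mult_integrable domain_L2 uD)
  have pos: "0 \<le> lam r" for r
  proof -
    have "lam 0 = 0" "mono lam"
      using spectrum by (auto simp: has_discrete_spectrum_def strict_mono_mono)
    then show ?thesis by (metis le0 monoD)
  qed
  have [measurable]: "f \<in> borel_measurable M" "L f \<in> borel_measurable M"
    "\<And>r. r \<in> I \<Longrightarrow> u r \<in> borel_measurable M"
    using \<open>f \<in> D\<close> uD by (auto intro: domain_measurable L_measurable)
  have "(\<integral>x. L f x * (L f x + c * f x) \<partial>M)
      = (\<integral>x. (\<Sum>r\<in>I. \<Sum>s\<in>I. - lam r * (c - lam s) * (u r x * u s x)) \<partial>M)"
  proof (rule integral_cong_AE)
    show "AE x in M. L f x * (L f x + c * f x)
        = (\<Sum>r\<in>I. \<Sum>s\<in>I. - lam r * (c - lam s) * (u r x * u s x))"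
      using Lf f
    proof eventually_elim
      case (elim x)
      have "L f x + c * f x = (\<Sum>s\<in>I. (c - lam s) * u s x)"
        unfolding elim by (simp add: sum_distrib_left sum.distrib[symmetric] algebra_simps sum_negf)
      then show ?case
        unfolding elim(1) by (simp only: sum_product) (simp add: mult_ac)
    qed
  qed measurable
  also have "\<dots> = (\<Sum>r\<in>I. \<Sum>s\<in>I. - lam r * (c - lam s) * (\<integral>x. u r x * u s x \<partial>M))"
    using int by (simp add: Bochner_Integration.integral_sum)
  also have "\<dots> = (\<Sum>r\<in>I. - lam r * (c - lam r) * (\<integral>x. u r x * u r x \<partial>M))"
  proof (rule sum.cong[OF refl])
    fix r assume r: "r \<in> I"
    have "(\<Sum>s\<in>I. - lam r * (c - lam s) * (\<integral>x. u r x * u s x \<partial>M))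
        = (\<Sum>s\<in>{r}. - lam r * (c - lam s) * (\<integral>x. u r x * u s x \<partial>M))"
      using I(1) r orth by (intro sum.mono_neutral_right) auto
    then show "(\<Sum>s\<in>I. - lam r * (c - lam s) * (\<integral>x. u r x * u s x \<partial>M))
        = - lam r * (c - lam r) * (\<integral>x. u r x * u r x \<partial>M)" by simp
  qed
  also have "\<dots> \<le> 0"
    using I(2) pos by (intro sum_nonpos mult_nonpos_nonneg) auto
  finally show "(\<integral>x. L f x * (L f x + c * f x) \<partial>M) \<le> 0" .
qed

text \<open>For a test function \<open>\<phi>\<close> the integral of \<open>L (\<phi> (G))\<close> is zero. The diffusion property speaks about compactly supported
\<open>\<phi>\<close>; fourth powers and cosines are reached by truncation and dominated convergence. The condition on \<open>\<bar>G\<bar>\<^sup>3 \<bar>L G\<bar>\<close>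
makes the dominating function integrable.\<close>

lemma integral_chain_rule:
  assumes G: "G \<in> D" "(\<lambda>x. G x * G x) \<in> D" "integrable M (\<lambda>x. \<bar>G x\<bar> ^ 3 * \<bar>L G x\<bar>)"
    and \<psi>: "\<And>k. times_differentiable k \<psi>"
      "\<And>x. (\<psi> has_field_derivative \<psi>' x) (at x)" "\<And>x. (\<psi>' has_field_derivative \<psi>'' x) (at x)"
      "\<And>x. \<bar>\<psi> x\<bar> \<le> K * (1 + \<bar>x\<bar> ^ 4)" "\<And>x. \<bar>\<psi>' x\<bar> \<le> K * (1 + \<bar>x\<bar> ^ 3)"
      "\<And>x. \<bar>\<psi>'' x\<bar> \<le> K * (1 + \<bar>x\<bar> ^ 2)"
  shows "(\<integral>x. \<psi>' (G x) * L G x + \<psi>'' (G x) * carre_du_champ L G G x \<partial>M) = 0"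
proof -
  let ?\<Gamma> = "carre_du_champ L G G"
  obtain \<phi> C where \<phi>: "\<And>n::nat. smooth_test_function (\<phi> n)"
    "\<And>x. (\<lambda>n. deriv (\<phi> n) x) \<longlonglongrightarrow> \<psi>' x" "\<And>x. (\<lambda>n. deriv (deriv (\<phi> n)) x) \<longlonglongrightarrow> \<psi>'' x"
    "\<And>n x. \<bar>deriv (\<phi> n) x\<bar> \<le> C * (1 + \<bar>x\<bar> ^ 3)"
    "\<And>n x. \<bar>deriv (deriv (\<phi> n)) x\<bar> \<le> C * (1 + \<bar>x\<bar> ^ 2)"
    using truncation_approximation[OF \<psi>] by blast
  have "C \<ge> 0" using \<phi>(4)[of 0 0] by simp
  have [measurable]: "G \<in> borel_measurable M" "L G \<in> borel_measurable M"
    "L (\<lambda>x. G x * G x) \<in> borel_measurable M"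
    using G by (auto intro: domain_measurable L_measurable)
  have \<Gamma>_eq: "?\<Gamma> x = L (\<lambda>x. G x * G x) x / 2 - G x * L G x" for x
    by (simp add: carre_du_champ_def field_simps)
  then have "?\<Gamma> = (\<lambda>x. L (\<lambda>x. G x * G x) x / 2 - G x * L G x)" by (rule ext)
  then have [measurable]: "?\<Gamma> \<in> borel_measurable M" by simp
  have [measurable]: "deriv (\<phi> n) \<in> borel_measurable borel"
    "deriv (deriv (\<phi> n)) \<in> borel_measurable borel" for n
  proof -
    have "((deriv ^^ m) (\<phi> n)) field_differentiable at x" for m x
      using \<phi>(1) by (auto simp: smooth_test_function_def)
    then have "continuous_on UNIV ((deriv ^^ m) (\<phi> n))" for m
      by (intro continuous_at_imp_continuous_on ballI field_differentiable_imp_continuous_at)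
    from this[of 1] this[of 2]
    show "deriv (\<phi> n) \<in> borel_measurable borel" "deriv (deriv (\<phi> n)) \<in> borel_measurable borel"
      by (auto intro: borel_measurable_continuous_onI simp: numeral_2_eq_2)
  qed
  have [measurable]: "\<psi>' \<in> borel_measurable borel"
    by (rule borel_measurable_LIMSEQ_real[OF \<phi>(2)]) measurable
  have [measurable]: "\<psi>'' \<in> borel_measurable borel"
    by (rule borel_measurable_LIMSEQ_real[OF \<phi>(3)]) measurable
  define w where "w x = C * (1 + \<bar>G x\<bar> ^ 3) * \<bar>L G x\<bar> + C * (1 + \<bar>G x\<bar>\<^sup>2) * \<bar>?\<Gamma> x\<bar>" for x
  have int: "integrable M (\<lambda>x. G x * L G x)" "integrable M (L G)"
    "integrable M (L (\<lambda>x. G x * G x))" "integrable M (\<lambda>x. G x * G x * L (\<lambda>x. G x * G x) x)"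
    using L2_mult_integrable[OF domain_L2[OF G(1)] L_L2[OF G(1)]]
      L2_mult_integrable[OF domain_L2[OF G(2)] L_L2[OF G(2)]]
      L2_integrable[OF L_L2[OF G(1)]] L2_integrable[OF L_L2[OF G(2)]] by auto
  have "integrable M w"
  proof (rule Bochner_Integration.integrable_bound)
    show "integrable M (\<lambda>x. C * (\<bar>L G x\<bar> + \<bar>G x\<bar> ^ 3 * \<bar>L G x\<bar> + (\<bar>L (\<lambda>x. G x * G x) x\<bar>
        + \<bar>G x * L G x\<bar> + \<bar>G x * G x * L (\<lambda>x. G x * G x) x\<bar> + \<bar>G x\<bar> ^ 3 * \<bar>L G x\<bar>)))"
      by (intro integrable_mult_right Bochner_Integration.integrable_add integrable_abs int G(3))
    show "w \<in> borel_measurable M" unfolding w_def by measurable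
    have alg: "(1 + h\<^sup>2) * (A + h * B) = A + h * B + h * h * A + h ^ 3 * B" for h A B :: real
      by (simp add: algebra_simps power2_eq_square power3_eq_cube)
    have le: "(1 + \<bar>G x\<bar>\<^sup>2) * \<bar>?\<Gamma> x\<bar> \<le> \<bar>L (\<lambda>x. G x * G x) x\<bar>
        + \<bar>G x * L G x\<bar> + \<bar>G x * G x * L (\<lambda>x. G x * G x) x\<bar> + \<bar>G x\<bar> ^ 3 * \<bar>L G x\<bar>" for x
    proof -
      have "\<bar>?\<Gamma> x\<bar> \<le> \<bar>L (\<lambda>x. G x * G x) x\<bar> + \<bar>G x * L G x\<bar>"
        unfolding \<Gamma>_eq by linarith
      then have "(1 + \<bar>G x\<bar>\<^sup>2) * \<bar>?\<Gamma> x\<bar> \<le> (1 + \<bar>G x\<bar>\<^sup>2) * (\<bar>L (\<lambda>x. G x * G x) x\<bar> + \<bar>G x * L G x\<bar>)"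
        by (intro mult_left_mono) auto
      also have "\<dots> = \<bar>L (\<lambda>x. G x * G x) x\<bar>
        + \<bar>G x * L G x\<bar> + \<bar>G x * G x * L (\<lambda>x. G x * G x) x\<bar> + \<bar>G x\<bar> ^ 3 * \<bar>L G x\<bar>"
        unfolding abs_mult by (rule alg)
      finally show ?thesis .
    qed
    have "\<bar>w x\<bar> \<le> C * (\<bar>L G x\<bar> + \<bar>G x\<bar> ^ 3 * \<bar>L G x\<bar> + (\<bar>L (\<lambda>x. G x * G x) x\<bar>
        + \<bar>G x * L G x\<bar> + \<bar>G x * G x * L (\<lambda>x. G x * G x) x\<bar> + \<bar>G x\<bar> ^ 3 * \<bar>L G x\<bar>))" for x
    proof -
      have "\<bar>w x\<bar> = C * (\<bar>L G x\<bar> + \<bar>G x\<bar> ^ 3 * \<bar>L G x\<bar> + (1 + \<bar>G x\<bar>\<^sup>2) * \<bar>?\<Gamma> x\<bar>)"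
        using \<open>C \<ge> 0\<close> unfolding w_def by (subst abs_of_nonneg) (auto simp: algebra_simps)
      also have "\<dots> \<le> C * (\<bar>L G x\<bar> + \<bar>G x\<bar> ^ 3 * \<bar>L G x\<bar> + (\<bar>L (\<lambda>x. G x * G x) x\<bar>
        + \<bar>G x * L G x\<bar> + \<bar>G x * G x * L (\<lambda>x. G x * G x) x\<bar> + \<bar>G x\<bar> ^ 3 * \<bar>L G x\<bar>))"
        using \<open>C \<ge> 0\<close> le[of x] by (intro mult_left_mono add_left_mono) auto
      finally show ?thesis .
    qed
    then show "AE x in M. norm (w x) \<le> norm (C * (\<bar>L G x\<bar> + \<bar>G x\<bar> ^ 3 * \<bar>L G x\<bar> + (\<bar>L (\<lambda>x. G x * G x) x\<bar>
        + \<bar>G x * L G x\<bar> + \<bar>G x * G x * L (\<lambda>x. G x * G x) x\<bar> + \<bar>G x\<bar> ^ 3 * \<bar>L G x\<bar>)))"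
      unfolding real_norm_def by (intro AE_I2 order_trans[OF _ abs_ge_self])
  qed
  have "(\<lambda>n. \<integral>x. deriv (\<phi> n) (G x) * L G x + deriv (deriv (\<phi> n)) (G x) * ?\<Gamma> x \<partial>M)
      \<longlonglongrightarrow> (\<integral>x. \<psi>' (G x) * L G x + \<psi>'' (G x) * ?\<Gamma> x \<partial>M)"
  proof (rule integral_dominated_convergence[where w = w])
    show "integrable M w" by fact
    show "AE x in M. (\<lambda>n. deriv (\<phi> n) (G x) * L G x + deriv (deriv (\<phi> n)) (G x) * ?\<Gamma> x)
        \<longlonglongrightarrow> \<psi>' (G x) * L G x + \<psi>'' (G x) * ?\<Gamma> x"
      by (intro AE_I2 tendsto_add[OF tendsto_mult[OF \<phi>(2) tendsto_const]
            tendsto_mult[OF \<phi>(3) tendsto_const]])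
    show "AE x in M. norm (deriv (\<phi> n) (G x) * L G x + deriv (deriv (\<phi> n)) (G x) * ?\<Gamma> x) \<le> w x" for n
    proof (rule AE_I2)
      fix x
      have "norm (deriv (\<phi> n) (G x) * L G x) \<le> C * (1 + \<bar>G x\<bar> ^ 3) * \<bar>L G x\<bar>"
        unfolding real_norm_def abs_mult by (rule mult_right_mono[OF \<phi>(4)]) simp
      moreover have "norm (deriv (deriv (\<phi> n)) (G x) * ?\<Gamma> x) \<le> C * (1 + \<bar>G x\<bar>\<^sup>2) * \<bar>?\<Gamma> x\<bar>"
        unfolding real_norm_def abs_mult by (rule mult_right_mono[OF \<phi>(5)]) simp
      ultimately show "norm (deriv (\<phi> n) (G x) * L G x + deriv (deriv (\<phi> n)) (G x) * ?\<Gamma> x) \<le> w x"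
        unfolding w_def by (intro order_trans[OF norm_triangle_ineq] add_mono)
    qed
  qed measurable
  moreover have "(\<integral>x. deriv (\<phi> n) (G x) * L G x + deriv (deriv (\<phi> n)) (G x) * ?\<Gamma> x \<partial>M) = 0" for n
  proof -
    have d: "(\<lambda>x. \<phi> n (G x)) \<in> D" "AE x in M. L (\<lambda>x. \<phi> n (G x)) x
        = deriv (\<phi> n) (G x) * L G x + deriv (deriv (\<phi> n)) (G x) * ?\<Gamma> x"
      using diffusive \<phi>(1) G by (auto simp: diffusive_def)
    have [measurable]: "L (\<lambda>x. \<phi> n (G x)) \<in> borel_measurable M" by (rule L_measurable[OF d(1)])
    have "(\<integral>x. L (\<lambda>x. \<phi> n (G x)) x \<partial>M)
        = (\<integral>x. deriv (\<phi> n) (G x) * L G x + deriv (deriv (\<phi> n)) (G x) * ?\<Gamma> x \<partial>M)"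
      using d(2) by (intro integral_cong_AE) auto
    with integral_L[OF d(1)] show ?thesis by simp
  qed
  ultimately show ?thesis by (simp add: LIMSEQ_const_iff)
qed

end

section \<open>Chaotic families of eigenfunctions\<close>

locale chaotic_family = diffusion_generator M D L lam
  for M :: "'a measure" and D :: "('a \<Rightarrow> real) set"
    and L :: "('a \<Rightarrow> real) \<Rightarrow> 'a \<Rightarrow> real" and lam :: "nat \<Rightarrow> real" +
  fixes f :: "'i::finite \<Rightarrow> 'a \<Rightarrow> real" and l :: "'i \<Rightarrow> real"
  assumes eigen: "f i \<in> eigenspace M D L (l i)"
    and eigenvalue_pos: "l i > 0"
    and products: "(\<lambda>x. f i x * f j x) \<in> eigen_sum M D L lam {r. lam r \<le> l i + l j}"
begin

abbreviation \<Gamma> :: "'i \<Rightarrow> 'i \<Rightarrow> 'a \<Rightarrow> real" where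
  "\<Gamma> i j \<equiv> carre_du_champ L (f i) (f j)"

lemma f_domain: "f i \<in> D"
  using eigen eigenspace_domain by blast

lemma product_domain: "(\<lambda>x. f i x * f j x) \<in> D"
  using eigen_sum_domain(1)[OF products] .

lemma f_L2: "f i \<in> L2 M"
  by (rule domain_L2[OF f_domain])

lemma product_L2: "(\<lambda>x. f i x * f j x) \<in> L2 M"
  by (rule domain_L2[OF product_domain])

lemma f_measurable [measurable]: "f i \<in> borel_measurable M"
  by (rule L2_measurable[OF f_L2])

lemma L_f: "AE x in M. L (f i) x = - (l i * f i x)"
  by (rule L_eigen[OF eigen])

lemma integral_f: "(\<integral>x. f i x \<partial>M) = 0"
proof -
  have [measurable]: "L (f i) \<in> borel_measurable M" by (rule L_measurable[OF f_domain])
  have "0 = (\<integral>x. L (f i) x \<partial>M)" by (simp add: integral_L[OF f_domain])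
  also have "\<dots> = (\<integral>x. - (l i * f i x) \<partial>M)"
    using L_f by (intro integral_cong_AE) auto
  finally show ?thesis using eigenvalue_pos[of i] by simp
qed

lemma \<Gamma>_AE:
  "AE x in M. \<Gamma> i j x = (L (\<lambda>x. f i x * f j x) x + (l i + l j) * (f i x * f j x)) / 2"
  using L_f[of i] L_f[of j]
  by eventually_elim (simp add: carre_du_champ_def algebra_simps)

lemma \<Gamma>_measurable [measurable]: "\<Gamma> i j \<in> borel_measurable M"
proof -
  have [measurable]: "L (f i) \<in> borel_measurable M" "L (\<lambda>x. f i x * f j x) \<in> borel_measurable M" for i j
    by (rule L_measurable f_domain product_domain)+
  have "\<Gamma> i j = (\<lambda>x. (L (\<lambda>y. f i y * f j y) x - f i x * L (f j) x - f j x * L (f i) x) / 2)"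
    by (rule ext) (rule carre_du_champ_def)
  then show ?thesis by simp
qed

lemma \<Gamma>_L2: "\<Gamma> i j \<in> L2 M"
proof (rule L2_cong_AE)
  show "(\<lambda>x. 1 / 2 * (L (\<lambda>x. f i x * f j x) x + (l i + l j) * (f i x * f j x))) \<in> L2 M"
    by (intro L2_scale L2_add L_L2 product_domain product_L2)
  show "AE x in M. 1 / 2 * (L (\<lambda>x. f i x * f j x) x + (l i + l j) * (f i x * f j x)) = \<Gamma> i j x"
    using \<Gamma>_AE[of i j] by eventually_elim simp
qed measurable

lemma integral_\<Gamma>: "(\<integral>x. \<Gamma> i j x \<partial>M) = (l i + l j) / 2 * (\<integral>x. f i x * f j x \<partial>M)"
proof -
  let ?P = "\<lambda>x. f i x * f j x"
  have [measurable]: "L ?P \<in> borel_measurable M" by (rule L_measurable[OF product_domain])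
  have "(\<integral>x. \<Gamma> i j x \<partial>M) = (\<integral>x. (L ?P x + (l i + l j) * ?P x) / 2 \<partial>M)"
    by (intro integral_cong_AE \<Gamma>_AE) measurable
  also have "\<dots> = ((\<integral>x. L ?P x \<partial>M) + (l i + l j) * (\<integral>x. ?P x \<partial>M)) / 2"
    using L2_integrable[OF L_L2[OF product_domain]] L2_integrable[OF product_L2] by simp
  finally show ?thesis by (simp add: integral_L[OF product_domain])
qed

text \<open>With \<open>P = f i * f j\<close> and \<open>c = l i + l j\<close> one has \<open>\<Gamma> i j = (L P + c P) / 2\<close>, hence
\<open>4 (\<Gamma> i j)\<^sup>2 - 2 c P \<Gamma> i j = L P (L P + c P)\<close>. The integral of the right-hand side is not
positive because \<open>P\<close> has no spectral component above \<open>c\<close>.\<close>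

lemma integral_\<Gamma>_square_le:
  "(\<integral>x. (\<Gamma> i j x)\<^sup>2 \<partial>M) \<le> (l i + l j) / 2 * (\<integral>x. f i x * f j x * \<Gamma> i j x \<partial>M)"
proof -
  let ?P = "\<lambda>x. f i x * f j x" and ?c = "l i + l j"
  have [measurable]: "L ?P \<in> borel_measurable M" by (rule L_measurable[OF product_domain])
  have "4 * (\<integral>x. (\<Gamma> i j x)\<^sup>2 \<partial>M) - 2 * ?c * (\<integral>x. ?P x * \<Gamma> i j x \<partial>M)
      = (\<integral>x. 4 * (\<Gamma> i j x)\<^sup>2 - 2 * ?c * (?P x * \<Gamma> i j x) \<partial>M)"
    using L2_square_integrable[OF \<Gamma>_L2] L2_mult_integrable[OF product_L2 \<Gamma>_L2] by simp
  also have "\<dots> = (\<integral>x. L ?P x * (L ?P x + ?c * ?P x) \<partial>M)"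
  proof (rule integral_cong_AE)
    have alg: "4 * ((a + c * p) / 2)\<^sup>2 - 2 * c * (p * ((a + c * p) / 2)) = a * (a + c * p)" for a c p :: real
      by (simp add: power2_eq_square field_simps)
    show "AE x in M. 4 * (\<Gamma> i j x)\<^sup>2 - 2 * ?c * (?P x * \<Gamma> i j x) = L ?P x * (L ?P x + ?c * ?P x)"
      using \<Gamma>_AE[of i j] by eventually_elim (simp only: alg)
  qed measurable
  also have "\<dots> \<le> 0" by (rule eigen_sum_domain(2)[OF products])
  finally show ?thesis by (simp add: field_simps)
qed

text \<open>The mean of \<open>\<Gamma> i j\<close> is a multiple of the covariance, so the bound on the second moment of \<open>\<Gamma> i j\<close>
becomes a bound on its variance by mixed moments.\<close>

lemma variance_\<Gamma>_le:
  "(\<integral>x. (\<Gamma> i j x - (\<integral>y. \<Gamma> i j y \<partial>M))\<^sup>2 \<partial>M) \<le>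
    (l i + l j) / 2 * ((\<integral>x. f i x * f j x * \<Gamma> i j x \<partial>M) - (l i + l j) / 2 * (\<integral>x. f i x * f j x \<partial>M)\<^sup>2)"
proof -
  have "(\<integral>x. (\<Gamma> i j x - (\<integral>y. \<Gamma> i j y \<partial>M))\<^sup>2 \<partial>M) = (\<integral>x. (\<Gamma> i j x)\<^sup>2 \<partial>M) - (\<integral>y. \<Gamma> i j y \<partial>M)\<^sup>2"
    by (rule variance_eq) (simp_all add: L2_integrable \<Gamma>_L2 L2_square_integrable)
  also have "\<dots> \<le> (l i + l j) / 2 * (\<integral>x. f i x * f j x * \<Gamma> i j x \<partial>M)
      - ((l i + l j) / 2)\<^sup>2 * (\<integral>x. f i x * f j x \<partial>M)\<^sup>2"
    using integral_\<Gamma>_square_le[of i j] by (simp only: integral_\<Gamma> power_mult_distrib)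
  also have "\<dots> = (l i + l j) / 2 * ((\<integral>x. f i x * f j x * \<Gamma> i j x \<partial>M)
      - (l i + l j) / 2 * (\<integral>x. f i x * f j x \<partial>M)\<^sup>2)"
    by (simp only: right_diff_distrib power2_eq_square[of "(l i + l j) / 2"] mult.assoc)
  finally show ?thesis .
qed

text \<open>Almost everywhere \<open>A t\<close> is \<open>- L (G t)\<close> and \<open>V t\<close> is the carre du champ of \<open>G t\<close> with itself, see
\<open>L_G\<close> and \<open>carre_du_champ_G\<close>. Explicit sums are used in order to have their dependence on \<open>t\<close> at hand.\<close>

definition G :: "('i \<Rightarrow> real) \<Rightarrow> 'a \<Rightarrow> real" where
  "G t x = (\<Sum>i\<in>UNIV. t i * f i x)"

definition A :: "('i \<Rightarrow> real) \<Rightarrow> 'a \<Rightarrow> real" where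
  "A t x = (\<Sum>i\<in>UNIV. l i * t i * f i x)"

definition V :: "('i \<Rightarrow> real) \<Rightarrow> 'a \<Rightarrow> real" where
  "V t x = (\<Sum>i\<in>UNIV. \<Sum>j\<in>UNIV. t i * t j * \<Gamma> i j x)"

lemma G_measurable [measurable]: "G t \<in> borel_measurable M"
  unfolding G_def by measurable

lemma A_L2: "A t \<in> L2 M"
  unfolding A_def[abs_def] by (intro L2_sum L2_scale f_L2)

lemma A_measurable [measurable]: "A t \<in> borel_measurable M"
  by (rule L2_measurable[OF A_L2])

lemma V_L2: "V t \<in> L2 M"
  unfolding V_def[abs_def] by (intro L2_sum L2_scale \<Gamma>_L2)

lemma V_measurable [measurable]: "V t \<in> borel_measurable M"
  by (rule L2_measurable[OF V_L2])

lemma G_domain: "G t \<in> D"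
  using L_sum[of UNIV f t] f_domain by (simp add: G_def[abs_def])

lemma L_G: "AE x in M. L (G t) x = - A t x"
proof -
  have "AE x in M. L (G t) x = (\<Sum>i\<in>UNIV. t i * L (f i) x)"
    using L_sum[of UNIV f t] f_domain by (simp add: G_def[abs_def])
  moreover have "AE x in M. \<forall>i\<in>UNIV. L (f i) x = - (l i * f i x)"
    by (intro AE_finite_allI L_f) simp
  ultimately show ?thesis
    by eventually_elim (simp add: A_def sum_negf mult_ac)
qed

lemma G_square: "G t x * G t x = (\<Sum>p\<in>UNIV. t (fst p) * t (snd p) * (f (fst p) x * f (snd p) x))"
  unfolding G_def sum_product sum.cartesian_product UNIV_Times_UNIV
  by (intro sum.cong) (auto simp: mult_ac)

lemma G_square_domain: "(\<lambda>x. G t x * G t x) \<in> D"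
  unfolding G_square using product_domain
  by (intro conjunct1[OF L_sum[of UNIV "\<lambda>p x. f (fst p) x * f (snd p) x" "\<lambda>p. t (fst p) * t (snd p)"]]) auto

lemma carre_du_champ_G: "AE x in M. carre_du_champ L (G t) (G t) x = V t x"
proof -
  let ?L2 = "\<lambda>i j. L (\<lambda>x. f i x * f j x)"
  have "AE x in M. L (\<lambda>x. G t x * G t x) x = (\<Sum>p\<in>UNIV. t (fst p) * t (snd p) * ?L2 (fst p) (snd p) x)"
    unfolding G_square using product_domain
    by (intro conjunct2[OF L_sum[of UNIV "\<lambda>p x. f (fst p) x * f (snd p) x" "\<lambda>p. t (fst p) * t (snd p)"]]) auto
  then have LG2: "AE x in M. L (\<lambda>x. G t x * G t x) x = (\<Sum>i\<in>UNIV. \<Sum>j\<in>UNIV. t i * t j * ?L2 i j x)"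
    by (simp add: sum.cartesian_product case_prod_unfold)
  have "AE x in M. \<forall>i\<in>UNIV. \<forall>j\<in>UNIV. \<Gamma> i j x = (?L2 i j x + (l i + l j) * (f i x * f j x)) / 2"
    by (intro AE_finite_allI \<Gamma>_AE) auto
  with LG2 L_G[of t] show ?thesis
  proof eventually_elim
    case (elim x)
    have GA: "G t x * A t x = (\<Sum>i\<in>UNIV. \<Sum>j\<in>UNIV. t i * t j * l j * (f i x * f j x))"
      unfolding G_def A_def sum_product by (simp add: mult_ac)
    have AG: "G t x * A t x = (\<Sum>i\<in>UNIV. \<Sum>j\<in>UNIV. t i * t j * l i * (f i x * f j x))"
      unfolding mult.commute[of "G t x"] unfolding G_def A_def sum_product by (simp add: mult_ac)
    have "carre_du_champ L (G t) (G t) x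
        = (L (\<lambda>x. G t x * G t x) x + (G t x * A t x + G t x * A t x)) / 2"
      using elim(2) by (simp add: carre_du_champ_def)
    also have "\<dots> = (\<Sum>i\<in>UNIV. \<Sum>j\<in>UNIV. t i * t j * ((?L2 i j x + (l i + l j) * (f i x * f j x)) / 2))"
      unfolding elim(1) by (subst (1) GA, subst AG)
        (simp add: sum.distrib[symmetric] sum_divide_distrib algebra_simps add_divide_distrib)
    also have "\<dots> = V t x"
    proof -
      have \<Gamma>_x: "\<Gamma> i j x = (?L2 i j x + (l i + l j) * (f i x * f j x)) / 2" for i j
        using elim(3) by blast
      show ?thesis unfolding V_def \<Gamma>_x by (rule refl)
    qed
    finally show ?case .
  qed
qed

lemma L_G_measurable [measurable]: "L (G t) \<in> borel_measurable M"
  by (rule L_measurable[OF G_domain])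

lemma carre_du_champ_G_measurable [measurable]: "carre_du_champ L (G t) (G t) \<in> borel_measurable M"
proof -
  have [measurable]: "L (\<lambda>x. G t x * G t x) \<in> borel_measurable M"
    by (rule L_measurable[OF G_square_domain])
  have "carre_du_champ L (G t) (G t)
      = (\<lambda>x. (L (\<lambda>y. G t y * G t y) x - G t x * L (G t) x - G t x * L (G t) x) / 2)"
    by (rule ext) (rule carre_du_champ_def)
  then show ?thesis by simp
qed

lemma G_square_L2: "(\<lambda>x. G t x * G t x) \<in> L2 M"
  by (rule domain_L2[OF G_square_domain])

lemma G_A_L2: "(\<lambda>x. G t x * A t x) \<in> L2 M"
proof -
  have "(\<lambda>x. G t x * A t x) = (\<lambda>x. \<Sum>i\<in>UNIV. \<Sum>j\<in>UNIV. t i * t j * l j * (f i x * f j x))"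
    unfolding G_def A_def sum_product by (simp add: mult_ac)
  also have "\<dots> \<in> L2 M" by (intro L2_sum L2_scale product_L2)
  finally show ?thesis .
qed

lemma G_cube_A_integrable: "integrable M (\<lambda>x. (G t x) ^ 3 * A t x)"
  using L2_mult_integrable[OF G_square_L2 G_A_L2, of t t]
  by (simp add: power3_eq_cube mult_ac)

lemma G_square_V_integrable: "integrable M (\<lambda>x. (G t x)\<^sup>2 * V t x)"
  using L2_mult_integrable[OF G_square_L2 V_L2, of t t] by (simp add: power2_eq_square)

lemma G_cube_L_G_integrable: "integrable M (\<lambda>x. \<bar>G t x\<bar> ^ 3 * \<bar>L (G t) x\<bar>)"
proof -
  have "AE x in M. \<bar>(G t x) ^ 3 * A t x\<bar> = \<bar>G t x\<bar> ^ 3 * \<bar>L (G t) x\<bar>"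
    using L_G[of t] by eventually_elim (simp add: abs_mult power_abs)
  then show ?thesis
    by (rule integrable_cong_AE_imp[OF integrable_abs[OF G_cube_A_integrable[of t]], rotated]) measurable
qed

lemmas chain_rule_G =
  integral_chain_rule[OF G_domain G_square_domain G_cube_L_G_integrable]

text \<open>The chain rule for a fourth power, with the factor \<open>4\<close> cancelled.\<close>

lemma quartic_identity: "(\<integral>x. (G t x) ^ 3 * A t x \<partial>M) = 3 * (\<integral>x. (G t x)\<^sup>2 * V t x \<partial>M)"
proof -
  have "0 = (\<integral>x. 4 * (G t x) ^ 3 * L (G t) x + 12 * (G t x)\<^sup>2 * carre_du_champ L (G t) (G t) x \<partial>M)"
  proof (rule sym, rule chain_rule_G[where \<psi> = "\<lambda>x. x ^ 4" and K = 12])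
    show "((\<lambda>x. x ^ 4) has_real_derivative 4 * x ^ 3) (at x)" for x :: real
      by (auto intro!: derivative_eq_intros)
    show "((\<lambda>x. 4 * x ^ 3) has_real_derivative 12 * x\<^sup>2) (at x)" for x :: real
      by (auto intro!: derivative_eq_intros)
  qed (auto simp: times_differentiable_power abs_mult power_abs)
  also have "\<dots> = (\<integral>x. 12 * ((G t x)\<^sup>2 * V t x) - 4 * ((G t x) ^ 3 * A t x) \<partial>M)"
  proof (rule integral_cong_AE)
    show "AE x in M. 4 * (G t x) ^ 3 * L (G t) x + 12 * (G t x)\<^sup>2 * carre_du_champ L (G t) (G t) x
        = 12 * ((G t x)\<^sup>2 * V t x) - 4 * ((G t x) ^ 3 * A t x)"
      using L_G[of t] carre_du_champ_G[of t] by eventually_elim simp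
  qed measurable
  also have "\<dots> = 12 * (\<integral>x. (G t x)\<^sup>2 * V t x \<partial>M) - 4 * (\<integral>x. (G t x) ^ 3 * A t x \<partial>M)"
    using G_cube_A_integrable[of t] G_square_V_integrable[of t] by simp
  finally show ?thesis by simp
qed

text \<open>The chain rule for a cosine. The phase \<open>\<theta>\<close> treats the real and the imaginary part of the
characteristic function at the same time.\<close>

lemma trigonometric_identity:
  "(\<integral>x. sin (G t x + \<theta>) * A t x \<partial>M) = (\<integral>x. cos (G t x + \<theta>) * V t x \<partial>M)"
  (is "?l = ?r")
proof -
  have bounded: "\<bar>h\<bar> \<le> 1 * (1 + \<bar>x\<bar> ^ k)" if "\<bar>h\<bar> \<le> 1" for h x :: real and k
    by (rule order_trans[OF that]) simp
  have int: "integrable M (\<lambda>x. sin (G t x + \<theta>) * A t x)"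
    by (rule Bochner_Integration.integrable_bound[OF L2_integrable[OF A_L2[of t]]])
       (simp_all add: abs_mult mult_left_le_one_le)
  have int': "integrable M (\<lambda>x. cos (G t x + \<theta>) * V t x)"
    by (rule Bochner_Integration.integrable_bound[OF L2_integrable[OF V_L2[of t]]])
       (simp_all add: abs_mult mult_left_le_one_le)
  have "0 = (\<integral>x. - sin (G t x + \<theta>) * L (G t) x + - cos (G t x + \<theta>) * carre_du_champ L (G t) (G t) x \<partial>M)"
  proof (rule sym, rule chain_rule_G[where \<psi> = "\<lambda>x. cos (x + \<theta>)" and K = 1])
    show "((\<lambda>x. cos (x + \<theta>)) has_real_derivative - sin (x + \<theta>)) (at x)" for x :: real
      by (auto intro!: derivative_eq_intros)
    show "((\<lambda>x. - sin (x + \<theta>)) has_real_derivative - cos (x + \<theta>)) (at x)" for x :: real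
      by (auto intro!: derivative_eq_intros)
  qed (rule times_differentiable_cos bounded; simp)+
  also have "\<dots> = (\<integral>x. sin (G t x + \<theta>) * A t x - cos (G t x + \<theta>) * V t x \<partial>M)"
  proof (rule integral_cong_AE)
    show "AE x in M. - sin (G t x + \<theta>) * L (G t) x + - cos (G t x + \<theta>) * carre_du_champ L (G t) (G t) x
        = sin (G t x + \<theta>) * A t x - cos (G t x + \<theta>) * V t x"
      using L_G[of t] carre_du_champ_G[of t] by eventually_elim simp
  qed measurable
  also have "\<dots> = ?l - ?r" using int int' by simp
  finally show ?thesis by simp
qed

lemma pair_combination:
  defines "t \<equiv> \<lambda>i j a k. (if k = i then 1 else 0) + (if k = j then a else (0::real))"
  shows "G (t i j a) x = f i x + a * f j x" "A (t i j a) x = l i * f i x + a * (l j * f j x)"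
    "V (t i j a) x = \<Gamma> i i x + 2 * a * \<Gamma> i j x + a\<^sup>2 * \<Gamma> j j x"
proof -
  have sum_t: "(\<Sum>k\<in>UNIV. t i j a k * y k) = y i + a * y j" for y :: "'i \<Rightarrow> real"
  proof -
    have "t i j a k * y k = (if k = i then y k else 0) + (if k = j then a * y k else 0)" for k
      by (simp add: t_def distrib_right)
    then show ?thesis by (simp add: sum.distrib)
  qed
  show "G (t i j a) x = f i x + a * f j x" unfolding G_def sum_t ..
  have "A (t i j a) x = (\<Sum>k\<in>UNIV. t i j a k * (l k * f k x))"
    unfolding A_def by (simp add: mult_ac)
  then show "A (t i j a) x = l i * f i x + a * (l j * f j x)" unfolding sum_t .
  have "V (t i j a) x = (\<Sum>k\<in>UNIV. t i j a k * (\<Sum>m\<in>UNIV. t i j a m * \<Gamma> k m x))"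
    unfolding V_def by (simp add: sum_distrib_left mult.assoc)
  then show "V (t i j a) x = \<Gamma> i i x + 2 * a * \<Gamma> i j x + a\<^sup>2 * \<Gamma> j j x"
    unfolding sum_t by (simp add: carre_du_champ_commute[of L "f j" "f i"] power2_eq_square algebra_simps)
qed

lemma fourth_power_identity:
  "3 * (\<integral>x. (f i x)\<^sup>2 * \<Gamma> i i x \<partial>M) = l i * (\<integral>x. (f i x) ^ 4 \<partial>M)"
proof -
  have "f i x ^ 3 * (l i * f i x) = l i * f i x ^ 4" for x
    by (simp add: power_numeral_reduce)
  with quartic_identity[of "\<lambda>k. (if k = i then 1 else 0) + (if k = i then 0 else 0)"] show ?thesis
    unfolding pair_combination by simp
qed

lemma product_square_integrable: "integrable M (\<lambda>x. (f i x)\<^sup>2 * (f j x)\<^sup>2)"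
  using L2_square_integrable[OF product_L2[of i j]] by (simp add: power_mult_distrib)

lemma square_\<Gamma>_integrable: "integrable M (\<lambda>x. (f k x)\<^sup>2 * \<Gamma> i j x)"
  using L2_mult_integrable[OF product_L2 \<Gamma>_L2, of k k i j] by (simp add: power2_eq_square)

text \<open>Polarization of the quartic identity: in the identity for \<open>f i + a * f j\<close>, this is the coefficient of
\<open>a\<^sup>2\<close>. The coefficients of \<open>1\<close> and \<open>a\<^sup>4\<close> are the fourth power identities of \<open>f i\<close> and \<open>f j\<close>.\<close>

lemma product_\<Gamma>_identity:
  "4 * (\<integral>x. f i x * f j x * \<Gamma> i j x \<partial>M) = (l i + l j) * (\<integral>x. (f i x)\<^sup>2 * (f j x)\<^sup>2 \<partial>M)
    - (\<integral>x. (f i x)\<^sup>2 * \<Gamma> j j x \<partial>M) - (\<integral>x. (f j x)\<^sup>2 * \<Gamma> i i x \<partial>M)"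
proof -
  define t where "t a k = (if k = i then 1 else 0) + (if k = j then a else (0::real))" for a k
  note G = pair_combination(1,2)[where i = i and j = j, folded t_def]
    and V = pair_combination(3)[where i = i and j = j, folded t_def]
  have int: "integrable M (\<lambda>x. (f k x) ^ 4)" for k
    using product_square_integrable[of k k] by (simp flip: power_add)
  have int\<Gamma>: "integrable M (\<lambda>x. f i x * f j x * \<Gamma> i j x)"
    by (rule L2_mult_integrable[OF product_L2 \<Gamma>_L2])
  \<comment> \<open>adding the identities for \<open>a = 1\<close> and \<open>a = -1\<close> removes the odd powers of \<open>a\<close>\<close>
  have "(\<integral>x. (G (t 1) x) ^ 3 * A (t 1) x + (G (t (-1)) x) ^ 3 * A (t (-1)) x \<partial>M)
      = 3 * (\<integral>x. (G (t 1) x)\<^sup>2 * V (t 1) x + (G (t (-1)) x)\<^sup>2 * V (t (-1)) x \<partial>M)"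
    using quartic_identity[of "t 1"] quartic_identity[of "t (-1)"]
      G_cube_A_integrable[of "t 1"] G_cube_A_integrable[of "t (-1)"]
      G_square_V_integrable[of "t 1"] G_square_V_integrable[of "t (-1)"] by simp
  moreover have "(G (t 1) x) ^ 3 * A (t 1) x + (G (t (-1)) x) ^ 3 * A (t (-1)) x
      = 2 * (l i * (f i x) ^ 4 + 3 * (l i + l j) * ((f i x)\<^sup>2 * (f j x)\<^sup>2) + l j * (f j x) ^ 4)" for x
    unfolding G by (simp add: power_numeral_reduce algebra_simps)
  moreover have "(G (t 1) x)\<^sup>2 * V (t 1) x + (G (t (-1)) x)\<^sup>2 * V (t (-1)) x
      = 2 * ((f i x)\<^sup>2 * \<Gamma> i i x + (f j x)\<^sup>2 * \<Gamma> j j x + (f i x)\<^sup>2 * \<Gamma> j j x + (f j x)\<^sup>2 * \<Gamma> i i x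
        + 4 * (f i x * f j x * \<Gamma> i j x))" for x
    unfolding G V by (simp add: power2_eq_square algebra_simps)
  ultimately have "l i * (\<integral>x. (f i x) ^ 4 \<partial>M) + 3 * (l i + l j) * (\<integral>x. (f i x)\<^sup>2 * (f j x)\<^sup>2 \<partial>M)
        + l j * (\<integral>x. (f j x) ^ 4 \<partial>M)
      = 3 * ((\<integral>x. (f i x)\<^sup>2 * \<Gamma> i i x \<partial>M) + (\<integral>x. (f j x)\<^sup>2 * \<Gamma> j j x \<partial>M)
        + (\<integral>x. (f i x)\<^sup>2 * \<Gamma> j j x \<partial>M) + (\<integral>x. (f j x)\<^sup>2 * \<Gamma> i i x \<partial>M)
        + 4 * (\<integral>x. f i x * f j x * \<Gamma> i j x \<partial>M))"
    using int int\<Gamma> product_square_integrable square_\<Gamma>_integrable by simp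
  with fourth_power_identity[of i] fourth_power_identity[of j] show ?thesis
    by (simp add: algebra_simps)
qed

end

section \<open>Sequences with asymptotically Gaussian fourth moments\<close>

lemma has_real_derivative_integral:
  fixes F F' :: "real \<Rightarrow> 'a \<Rightarrow> real"
  assumes S: "convex S" "s \<in> S"
    and deriv: "\<And>u x. u \<in> S \<Longrightarrow> ((\<lambda>u. F u x) has_real_derivative F' u x) (at u within S)"
    and bound: "\<And>u x. u \<in> S \<Longrightarrow> \<bar>F' u x\<bar> \<le> w x" and w: "integrable M w"
    and F: "\<And>u. integrable M (F u)" and F': "F' s \<in> borel_measurable M"
  shows "((\<lambda>u. \<integral>x. F u x \<partial>M) has_real_derivative (\<integral>x. F' s x \<partial>M)) (at s within S)"
  unfolding has_field_derivative_iff tendsto_at_iff_sequentially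
proof (intro allI impI)
  fix X :: "nat \<Rightarrow> real"
  assume X: "\<forall>i. X i \<in> S - {s}" and lim: "X \<longlonglongrightarrow> s"
  have "(\<lambda>n. \<integral>x. (F (X n) x - F s x) / (X n - s) \<partial>M) \<longlonglongrightarrow> (\<integral>x. F' s x \<partial>M)"
  proof (rule integral_dominated_convergence[OF F' _ w])
    show "(\<lambda>x. (F (X n) x - F s x) / (X n - s)) \<in> borel_measurable M" for n
      using F by (intro borel_measurable_divide borel_measurable_diff borel_measurable_integrable) auto
    show "AE x in M. (\<lambda>n. (F (X n) x - F s x) / (X n - s)) \<longlonglongrightarrow> F' s x"
      using deriv[OF S(2)] X lim
      by (intro AE_I2) (auto simp: has_field_derivative_iff tendsto_at_iff_sequentially o_def)
    show "AE x in M. norm ((F (X n) x - F s x) / (X n - s)) \<le> w x" for n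
    proof (rule AE_I2)
      fix x
      have Xn: "X n \<in> S" "X n \<noteq> s" using X by auto
      have "norm (F (X n) x - F s x) \<le> w x * norm (X n - s)"
        using field_differentiable_bound[OF S(1), of "\<lambda>u. F u x" "\<lambda>u. F' u x" "w x" "X n" s]
          deriv bound Xn S(2) by auto
      then show "norm ((F (X n) x - F s x) / (X n - s)) \<le> w x"
        using Xn by (simp add: norm_divide divide_le_eq)
    qed
  qed
  then show "((\<lambda>u. ((\<integral>x. F u x \<partial>M) - (\<integral>x. F s x \<partial>M)) / (u - s)) \<circ> X) \<longlonglongrightarrow> (\<integral>x. F' s x \<partial>M)"
    using F by (simp add: o_def)
qed

lemma abs_cos_diff_le: "\<bar>cos a - cos b\<bar> \<le> \<bar>a - b\<bar>" for a b :: real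
  using field_differentiable_bound[of UNIV cos "\<lambda>x. - sin x" 1 a b]
  by (auto intro!: derivative_eq_intros)

text \<open>The limit prescribed for the fourth moments is their value for a centered Gaussian vector
with covariance \<open>C\<close>.\<close>

locale chaotic_sequence = diffusion_generator M D L lam
  for M :: "'a measure" and D :: "('a \<Rightarrow> real) set"
    and L :: "('a \<Rightarrow> real) \<Rightarrow> 'a \<Rightarrow> real" and lam :: "nat \<Rightarrow> real" +
  fixes f :: "nat \<Rightarrow> 'i::finite \<Rightarrow> 'a \<Rightarrow> real" and l :: "'i \<Rightarrow> real" and C :: "'i \<Rightarrow> 'i \<Rightarrow> real"
  assumes chaotic: "\<And>n. chaotic_family M D L lam (f n) l"
    and covariance: "(\<lambda>n. \<integral>x. f n i x * f n j x \<partial>M) \<longlonglongrightarrow> C i j"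
    and fourth_moment: "(\<lambda>n. \<integral>x. (f n i x)\<^sup>2 * (f n j x)\<^sup>2 \<partial>M) \<longlonglongrightarrow> C i i * C j j + 2 * (C i j)\<^sup>2"
begin

sublocale fam: chaotic_family M D L lam "f n" l for n
  by (rule chaotic)

abbreviation var_\<Gamma> :: "nat \<Rightarrow> 'i \<Rightarrow> 'i \<Rightarrow> real" where
  "var_\<Gamma> n i j \<equiv> \<integral>x. (fam.\<Gamma> n i j x - (\<integral>y. fam.\<Gamma> n i j y \<partial>M))\<^sup>2 \<partial>M"

lemma mean_\<Gamma>: "(\<lambda>n. \<integral>x. fam.\<Gamma> n i j x \<partial>M) \<longlonglongrightarrow> (l i + l j) / 2 * C i j"
  unfolding fam.integral_\<Gamma> by (intro tendsto_intros covariance)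

lemma \<Gamma>_centered_L2: "(\<lambda>x. fam.\<Gamma> n i j x - (\<integral>y. fam.\<Gamma> n i j y \<partial>M)) \<in> L2 M"
  using L2_add[OF fam.\<Gamma>_L2, of "\<lambda>_. - (\<integral>y. fam.\<Gamma> n i j y \<partial>M)"] by (simp add: L2_def)

text \<open>For \<open>i = j\<close> the variance bound equals \<open>(l i)\<^sup>2 / 3\<close> times the fourth cumulant, the difference between the fourth moment
and three times the squared second moment. Its limit is \<open>3 (C i i)\<^sup>2 - 3 (C i i)\<^sup>2 = 0\<close>.\<close>

lemma var_\<Gamma>_diagonal: "(\<lambda>n. var_\<Gamma> n i i) \<longlonglongrightarrow> 0"
proof (rule tendsto_sandwich[OF _ _ tendsto_const])
  have eq: "(\<integral>x. f n i x * f n i x * fam.\<Gamma> n i i x \<partial>M) = l i / 3 * (\<integral>x. (f n i x)\<^sup>2 * (f n i x)\<^sup>2 \<partial>M)" for n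
  proof -
    have "(f n i x)\<^sup>2 * (f n i x)\<^sup>2 = f n i x ^ 4" for x by (simp flip: power_add)
    then show ?thesis
      using fam.fourth_power_identity[of n i] by (simp add: power2_eq_square)
  qed
  show "\<forall>\<^sub>F n in sequentially. var_\<Gamma> n i i \<le>
      (l i + l i) / 2 * (l i / 3 * (\<integral>x. (f n i x)\<^sup>2 * (f n i x)\<^sup>2 \<partial>M)
        - (l i + l i) / 2 * (\<integral>x. f n i x * f n i x \<partial>M)\<^sup>2)"
    using fam.variance_\<Gamma>_le[of _ i i] unfolding eq by simp
  have "(l i + l i) / 2 * (l i / 3 * (C i i * C i i + 2 * (C i i)\<^sup>2) - (l i + l i) / 2 * (C i i)\<^sup>2) = 0"
    by (simp add: power2_eq_square)
  then show "(\<lambda>n. (l i + l i) / 2 * (l i / 3 * (\<integral>x. (f n i x)\<^sup>2 * (f n i x)\<^sup>2 \<partial>M)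
        - (l i + l i) / 2 * (\<integral>x. f n i x * f n i x \<partial>M)\<^sup>2)) \<longlonglongrightarrow> 0"
    using tendsto_mult[OF tendsto_const[of "(l i + l i) / 2"]
        tendsto_diff[OF tendsto_mult[OF tendsto_const[of "l i / 3"] fourth_moment[of i i]]
          tendsto_mult[OF tendsto_const[of "(l i + l i) / 2"] tendsto_power[OF covariance[of i i], of 2]]]]
    by metis
qed simp

text \<open>Since \<open>(f n j)\<^sup>2\<close> stays bounded in \<open>L\<^sup>2\<close> while \<open>\<Gamma> i i\<close> minus its mean tends to \<open>0\<close> there, the
mean of the product is asymptotically the product of the means.\<close>

lemma square_\<Gamma>_limit:
  "(\<lambda>n. \<integral>x. (f n j x)\<^sup>2 * fam.\<Gamma> n i i x \<partial>M) \<longlonglongrightarrow> l i * (C i i * C j j)"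
proof -
  let ?m = "\<lambda>n. \<integral>y. fam.\<Gamma> n i i y \<partial>M"
  let ?d = "\<lambda>n. \<integral>x. (f n j x * f n j x) * (fam.\<Gamma> n i i x - ?m n) \<partial>M"
  have "(\<lambda>n. (\<integral>x. (f n j x)\<^sup>2 * (f n j x)\<^sup>2 \<partial>M) * var_\<Gamma> n i i) \<longlonglongrightarrow> 0"
    using tendsto_mult[OF fourth_moment[of j j] var_\<Gamma>_diagonal[of i]] by simp
  then have "(\<lambda>n. (?d n)\<^sup>2) \<longlonglongrightarrow> 0"
  proof (rule tendsto_sandwich[OF _ _ tendsto_const, rotated 2])
    have "(?d n)\<^sup>2 \<le> (\<integral>x. (f n j x)\<^sup>2 * (f n j x)\<^sup>2 \<partial>M) * var_\<Gamma> n i i" for n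
      using L2_Cauchy_Schwarz[OF fam.product_L2[of n j j] \<Gamma>_centered_L2[of n i i]]
      by (simp add: power_mult_distrib)
    then show "\<forall>\<^sub>F n in sequentially. (?d n)\<^sup>2 \<le> (\<integral>x. (f n j x)\<^sup>2 * (f n j x)\<^sup>2 \<partial>M) * var_\<Gamma> n i i"
      by simp
  qed simp
  from tendsto_real_sqrt[OF this] have "?d \<longlonglongrightarrow> 0"
    by (simp add: tendsto_rabs_zero_iff)
  then have "(\<lambda>n. ?d n + ?m n * (\<integral>x. f n j x * f n j x \<partial>M)) \<longlonglongrightarrow> 0 + ((l i + l i) / 2 * C i i) * C j j"
    by (intro tendsto_add tendsto_mult mean_\<Gamma> covariance)
  moreover have "?d n + ?m n * (\<integral>x. f n j x * f n j x \<partial>M) = (\<integral>x. (f n j x)\<^sup>2 * fam.\<Gamma> n i i x \<partial>M)" for n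
    using fam.square_\<Gamma>_integrable[of n j i i] L2_integrable[OF fam.product_L2[of n j j]]
    by (simp add: right_diff_distrib power2_eq_square mult.commute[of _ "?m n"])
  ultimately show ?thesis by (simp add: mult.assoc)
qed

text \<open>The identity for the mean of \<open>f i * f j * \<Gamma> i j\<close> leaves only fourth moments and mixed integrals that were
treated with the diagonal case. The terms \<open>C i i * C j j\<close> cancel, and the mean tends to
\<open>(l i + l j) / 2 * (C i j)\<^sup>2\<close>, which is exactly what the variance bound subtracts.\<close>

lemma var_\<Gamma>_tendsto_0: "(\<lambda>n. var_\<Gamma> n i j) \<longlonglongrightarrow> 0"
proof (rule tendsto_sandwich[OF _ _ tendsto_const])
  let ?c = "(l i + l j) / 2"
  let ?u = "\<lambda>n. ((l i + l j) * (\<integral>x. (f n i x)\<^sup>2 * (f n j x)\<^sup>2 \<partial>M)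
      - (\<integral>x. (f n i x)\<^sup>2 * fam.\<Gamma> n j j x \<partial>M) - (\<integral>x. (f n j x)\<^sup>2 * fam.\<Gamma> n i i x \<partial>M)) / 4"
  have eq: "(\<integral>x. f n i x * f n j x * fam.\<Gamma> n i j x \<partial>M) = ?u n" for n
    using fam.product_\<Gamma>_identity[of n i j] by simp
  show "\<forall>\<^sub>F n in sequentially. var_\<Gamma> n i j \<le> ?c * (?u n - ?c * (\<integral>x. f n i x * f n j x \<partial>M)\<^sup>2)"
    using fam.variance_\<Gamma>_le[of _ i j] unfolding eq by simp
  have "?u \<longlonglongrightarrow> ((l i + l j) * (C i i * C j j + 2 * (C i j)\<^sup>2) - l j * (C j j * C i i) - l i * (C i i * C j j)) / 4"
    by (intro tendsto_intros fourth_moment square_\<Gamma>_limit) simp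
  also have "((l i + l j) * (C i i * C j j + 2 * (C i j)\<^sup>2) - l j * (C j j * C i i) - l i * (C i i * C j j)) / 4
      = ?c * (C i j)\<^sup>2" by (simp add: algebra_simps)
  finally have "(\<lambda>n. ?c * (?u n - ?c * (\<integral>x. f n i x * f n j x \<partial>M)\<^sup>2))
      \<longlonglongrightarrow> ?c * (?c * (C i j)\<^sup>2 - ?c * (C i j)\<^sup>2)"
    by (intro tendsto_mult tendsto_diff tendsto_const tendsto_power covariance)
  then show "(\<lambda>n. ?c * (?u n - ?c * (\<integral>x. f n i x * f n j x \<partial>M)\<^sup>2)) \<longlonglongrightarrow> 0" by simp
qed simp

lemma \<Gamma>_tendsto_L1:
  "(\<lambda>n. \<integral>x. \<bar>fam.\<Gamma> n i j x - (l i + l j) / 2 * C i j\<bar> \<partial>M) \<longlonglongrightarrow> 0"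
proof (rule tendsto_sandwich[OF _ _ tendsto_const])
  let ?m = "\<lambda>n. \<integral>y. fam.\<Gamma> n i j y \<partial>M" and ?A = "(l i + l j) / 2 * C i j"
  have "(\<integral>x. \<bar>fam.\<Gamma> n i j x - ?A\<bar> \<partial>M) \<le> sqrt (var_\<Gamma> n i j) + \<bar>?m n - ?A\<bar>" for n
  proof -
    have intc: "integrable M (\<lambda>x. \<bar>fam.\<Gamma> n i j x - ?m n\<bar>)"
      using L2_integrable[OF \<Gamma>_centered_L2] by simp
    have "(\<integral>x. \<bar>fam.\<Gamma> n i j x - ?A\<bar> \<partial>M) \<le> (\<integral>x. \<bar>fam.\<Gamma> n i j x - ?m n\<bar> + \<bar>?m n - ?A\<bar> \<partial>M)"
      using intc L2_integrable[OF fam.\<Gamma>_L2[of n i j]] by (intro integral_mono) auto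
    also have "\<dots> = (\<integral>x. \<bar>fam.\<Gamma> n i j x - ?m n\<bar> \<partial>M) + \<bar>?m n - ?A\<bar>"
      using intc by (simp add: prob_space)
    also have "(\<integral>x. \<bar>fam.\<Gamma> n i j x - ?m n\<bar> \<partial>M) \<le> sqrt (var_\<Gamma> n i j)"
    proof (rule real_le_rsqrt)
      have "(\<lambda>x. \<bar>fam.\<Gamma> n i j x - ?m n\<bar>) \<in> L2 M" "(\<lambda>_. 1) \<in> L2 M"
        using \<Gamma>_centered_L2[of n i j] by (auto simp: L2_def)
      from L2_Cauchy_Schwarz[OF this] show "(\<integral>x. \<bar>fam.\<Gamma> n i j x - ?m n\<bar> \<partial>M)\<^sup>2 \<le> var_\<Gamma> n i j"
        by (simp add: prob_space)
    qed
    finally show ?thesis by simp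
  qed
  then show "\<forall>\<^sub>F n in sequentially. (\<integral>x. \<bar>fam.\<Gamma> n i j x - ?A\<bar> \<partial>M) \<le> sqrt (var_\<Gamma> n i j) + \<bar>?m n - ?A\<bar>"
    by simp
  have "(\<lambda>n. sqrt (var_\<Gamma> n i j) + \<bar>?m n - ?A\<bar>) \<longlonglongrightarrow> sqrt 0 + \<bar>?A - ?A\<bar>"
    by (intro tendsto_intros var_\<Gamma>_tendsto_0 mean_\<Gamma>)
  then show "(\<lambda>n. sqrt (var_\<Gamma> n i j) + \<bar>?m n - ?A\<bar>) \<longlonglongrightarrow> 0" by simp
qed simp

lemma abs_f_bounded: "\<exists>K. \<forall>n. (\<integral>x. \<bar>f n i x\<bar> \<partial>M) \<le> K"
proof -
  have "Bseq (\<lambda>n. \<integral>x. f n i x * f n i x \<partial>M)"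
    by (rule convergent_imp_Bseq) (use covariance in \<open>auto simp: convergent_def\<close>)
  then obtain K where K: "\<And>n. norm (\<integral>x. f n i x * f n i x \<partial>M) \<le> K"
    by (auto simp: Bseq_def)
  have "(\<integral>x. \<bar>f n i x\<bar> \<partial>M) \<le> 1 + K" for n
  proof -
    have le: "\<bar>y\<bar> \<le> 1 + y * y" for y :: real
      using sum_squares_bound[of 1 "\<bar>y\<bar>"] by (simp add: power2_eq_square)
    have "(\<integral>x. \<bar>f n i x\<bar> \<partial>M) \<le> (\<integral>x. 1 + f n i x * f n i x \<partial>M)"
      using L2_integrable[OF fam.f_L2[of n i]] L2_integrable[OF fam.product_L2[of n i i]] le
      by (intro integral_mono) auto
    also have "\<dots> = 1 + (\<integral>x. f n i x * f n i x \<partial>M)"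
      using L2_integrable[OF fam.product_L2[of n i i]] by (simp add: prob_space)
    also have "\<dots> \<le> 1 + K" using K[of n] by simp
    finally show ?thesis .
  qed
  then show ?thesis by blast
qed

text \<open>The proof follows \<open>\<Phi> n s\<close>, the mean of \<open>cos (G + \<theta>)\<close> at the frequency \<open>\<tau> s\<close>, from \<open>s = -\<infinity>\<close> to
\<open>s = 0\<close>. After multiplication by the integrating factor \<open>exp (q s)\<close> its derivative is a mean of
\<open>q' s - V (\<tau> s)\<close> against a bounded function, and this tends to \<open>0\<close> with \<open>n\<close>, uniformly in \<open>s \<le> 0\<close>. Hence for large \<open>n\<close> the values at
\<open>s = 0\<close> and at \<open>s = - T\<close> are close for every fixed \<open>T\<close>, and the value at \<open>- T\<close> is close to \<open>cos \<theta>\<close> uniformly in \<open>n\<close> if \<open>T\<close> is large.\<close>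

lemma characteristic_limit:
  fixes t :: "'i \<Rightarrow> real" and \<theta> :: real
  shows "(\<lambda>n. \<integral>x. cos ((\<Sum>i\<in>UNIV. t i * f n i x) + \<theta>) \<partial>M)
    \<longlonglongrightarrow> cos \<theta> * exp (- (\<Sum>i\<in>UNIV. \<Sum>j\<in>UNIV. t i * t j * C i j) / 2)"
proof -
  define \<tau> where "\<tau> s i = exp (l i * s) * t i" for s i
  define a where "a i j = (l i + l j) / 2 * C i j" for i j
  define q where "q s = (\<Sum>i\<in>UNIV. \<Sum>j\<in>UNIV. \<tau> s i * \<tau> s j * C i j) / 2" for s
  define q' where "q' s = (\<Sum>i\<in>UNIV. \<Sum>j\<in>UNIV. \<tau> s i * \<tau> s j * a i j)" for s
  define \<Phi> where "\<Phi> n s = (\<integral>x. cos (fam.G n (\<tau> s) x + \<theta>) \<partial>M)" for n s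
  define \<delta> where "\<delta> n = (\<Sum>i\<in>UNIV. \<Sum>j\<in>UNIV. \<bar>t i * t j\<bar> * (\<integral>x. \<bar>fam.\<Gamma> n i j x - a i j\<bar> \<partial>M))" for n
  define B where "B = exp ((\<Sum>i\<in>UNIV. \<Sum>j\<in>UNIV. \<bar>t i * t j\<bar> * \<bar>C i j\<bar>) / 2)"
  obtain K where K: "\<And>n i. (\<integral>x. \<bar>f n i x\<bar> \<partial>M) \<le> K i"
    using abs_f_bounded by metis
  define \<epsilon> where "\<epsilon> s = \<bar>exp (q s) - 1\<bar> + (\<Sum>i\<in>UNIV. \<bar>\<tau> s i\<bar> * K i)" for s
  have \<tau>_le: "\<bar>\<tau> s i\<bar> \<le> \<bar>t i\<bar>" if "s \<le> 0" for s i
  proof -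
    have "exp (l i * s) \<le> 1" using that fam.eigenvalue_pos[of i] by (simp add: mult_nonneg_nonpos)
    then show ?thesis by (simp add: \<tau>_def abs_mult mult_left_le_one_le)
  qed
  have \<tau>\<tau>_le: "\<bar>\<tau> s i * \<tau> s j\<bar> \<le> \<bar>t i * t j\<bar>" if "s \<le> 0" for s i j
    unfolding abs_mult using \<tau>_le[OF that] by (intro mult_mono) auto
  have \<tau>_deriv: "((\<lambda>s. \<tau> s i) has_real_derivative l i * \<tau> s i) (at s within S)" for s i S
    unfolding \<tau>_def by (auto intro!: derivative_eq_intros)
  \<comment> \<open>\<open>q'\<close> is the derivative of \<open>q\<close> and the limit of \<open>V (\<tau> s)\<close>: the flow \<open>\<tau>\<close> is chosen to make these agree\<close>
  have q_deriv: "(q has_real_derivative q' s) (at s within S)" for s S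
  proof -
    have "(q has_real_derivative (\<Sum>i\<in>UNIV. \<Sum>j\<in>UNIV. (l i * \<tau> s i * \<tau> s j + l j * \<tau> s j * \<tau> s i) * C i j) / 2)
        (at s within S)"
      unfolding q_def[abs_def]
      by (intro DERIV_cdivide DERIV_sum DERIV_cmult_right DERIV_mult \<tau>_deriv)
    also have "(\<Sum>i\<in>UNIV. \<Sum>j\<in>UNIV. (l i * \<tau> s i * \<tau> s j + l j * \<tau> s j * \<tau> s i) * C i j) / 2 = q' s"
      unfolding q'_def a_def sum_divide_distrib by (intro sum.cong) (auto simp: field_simps)
    finally show ?thesis .
  qed
  have q_le: "exp (q s) \<le> B" if "s \<le> 0" for s
  proof -
    have "(\<Sum>i\<in>UNIV. \<Sum>j\<in>UNIV. \<tau> s i * \<tau> s j * C i j) \<le> (\<Sum>i\<in>UNIV. \<Sum>j\<in>UNIV. \<bar>t i * t j\<bar> * \<bar>C i j\<bar>)"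
    proof (intro sum_mono)
      fix i j
      have "\<tau> s i * \<tau> s j * C i j \<le> \<bar>\<tau> s i * \<tau> s j\<bar> * \<bar>C i j\<bar>"
        by (metis abs_ge_self abs_mult)
      also have "\<dots> \<le> \<bar>t i * t j\<bar> * \<bar>C i j\<bar>"
        using \<tau>\<tau>_le[OF that] by (intro mult_right_mono) auto
      finally show "\<tau> s i * \<tau> s j * C i j \<le> \<bar>t i * t j\<bar> * \<bar>C i j\<bar>" .
    qed
    then show ?thesis by (simp add: q_def B_def)
  qed
  have \<Phi>_deriv: "(\<Phi> n has_real_derivative - (\<integral>x. cos (fam.G n (\<tau> s) x + \<theta>) * fam.V n (\<tau> s) x \<partial>M)) (at s within {..0})"
    if "s \<le> 0" for n s
  proof -
    have "((\<lambda>s. \<integral>x. cos (fam.G n (\<tau> s) x + \<theta>) \<partial>M) has_real_derivative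
        (\<integral>x. - sin (fam.G n (\<tau> s) x + \<theta>) * fam.A n (\<tau> s) x \<partial>M)) (at s within {..0})"
    proof (rule has_real_derivative_integral[where w = "\<lambda>x. \<Sum>i\<in>UNIV. l i * \<bar>t i\<bar> * \<bar>f n i x\<bar>"])
      show "((\<lambda>u. cos (fam.G n (\<tau> u) x + \<theta>)) has_real_derivative
          - sin (fam.G n (\<tau> u) x + \<theta>) * fam.A n (\<tau> u) x) (at u within {..0})" for u x
      proof -
        have "((\<lambda>u. fam.G n (\<tau> u) x) has_real_derivative (\<Sum>i\<in>UNIV. l i * \<tau> u i * f n i x)) (at u within {..0})"
          unfolding fam.G_def by (intro DERIV_sum DERIV_cmult_right \<tau>_deriv)
        then show ?thesis
          unfolding fam.A_def by (auto intro!: derivative_eq_intros)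
      qed
      show "\<bar>- sin (fam.G n (\<tau> u) x + \<theta>) * fam.A n (\<tau> u) x\<bar> \<le> (\<Sum>i\<in>UNIV. l i * \<bar>t i\<bar> * \<bar>f n i x\<bar>)"
        if "u \<in> {..0}" for u x
      proof -
        have "\<bar>- sin (fam.G n (\<tau> u) x + \<theta>) * fam.A n (\<tau> u) x\<bar> \<le> \<bar>fam.A n (\<tau> u) x\<bar>"
          by (simp add: abs_mult mult_left_le_one_le)
        also have "\<dots> \<le> (\<Sum>i\<in>UNIV. \<bar>l i * \<tau> u i * f n i x\<bar>)"
          unfolding fam.A_def by (rule sum_abs)
        also have "\<dots> \<le> (\<Sum>i\<in>UNIV. l i * \<bar>t i\<bar> * \<bar>f n i x\<bar>)"
          unfolding abs_mult using \<tau>_le[of u] that fam.eigenvalue_pos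
          by (intro sum_mono mult_right_mono mult_mono) (auto simp: less_imp_le)
        finally show ?thesis .
      qed
      show "integrable M (\<lambda>x. \<Sum>i\<in>UNIV. l i * \<bar>t i\<bar> * \<bar>f n i x\<bar>)"
        using L2_integrable[OF fam.f_L2] by simp
      show "integrable M (\<lambda>x. cos (fam.G n (\<tau> u) x + \<theta>))" for u
        by (rule integrable_const_bound[where B = 1]) auto
    qed (use that in auto)
    also have "(\<integral>x. - sin (fam.G n (\<tau> s) x + \<theta>) * fam.A n (\<tau> s) x \<partial>M)
        = - (\<integral>x. cos (fam.G n (\<tau> s) x + \<theta>) * fam.V n (\<tau> s) x \<partial>M)"
      using fam.trigonometric_identity[of n "\<tau> s" \<theta>] by simp
    finally show ?thesis by (simp add: \<Phi>_def[abs_def])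
  qed
  have V_close: "(\<integral>x. \<bar>q' s - fam.V n (\<tau> s) x\<bar> \<partial>M) \<le> \<delta> n" if "s \<le> 0" for n s
  proof -
    have int: "integrable M (\<lambda>x. \<bar>fam.\<Gamma> n i j x - a i j\<bar>)" for i j
      using L2_integrable[OF fam.\<Gamma>_L2] by simp
    have "(\<integral>x. \<bar>q' s - fam.V n (\<tau> s) x\<bar> \<partial>M)
        \<le> (\<integral>x. (\<Sum>i\<in>UNIV. \<Sum>j\<in>UNIV. \<bar>t i * t j\<bar> * \<bar>fam.\<Gamma> n i j x - a i j\<bar>) \<partial>M)"
    proof (rule integral_mono)
      show "integrable M (\<lambda>x. \<bar>q' s - fam.V n (\<tau> s) x\<bar>)"
        using L2_integrable[OF fam.V_L2] by simp
      show "integrable M (\<lambda>x. \<Sum>i\<in>UNIV. \<Sum>j\<in>UNIV. \<bar>t i * t j\<bar> * \<bar>fam.\<Gamma> n i j x - a i j\<bar>)"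
        using int by (intro Bochner_Integration.integrable_sum integrable_mult_right)
      fix x
      have "\<bar>q' s - fam.V n (\<tau> s) x\<bar> = \<bar>\<Sum>i\<in>UNIV. \<Sum>j\<in>UNIV. \<tau> s i * \<tau> s j * (fam.\<Gamma> n i j x - a i j)\<bar>"
        unfolding q'_def fam.V_def by (simp add: right_diff_distrib sum_subtractf abs_minus_commute)
      also have "\<dots> \<le> (\<Sum>i\<in>UNIV. \<Sum>j\<in>UNIV. \<bar>\<tau> s i * \<tau> s j * (fam.\<Gamma> n i j x - a i j)\<bar>)"
        by (intro order_trans[OF sum_abs] sum_mono) simp
      also have "\<dots> \<le> (\<Sum>i\<in>UNIV. \<Sum>j\<in>UNIV. \<bar>t i * t j\<bar> * \<bar>fam.\<Gamma> n i j x - a i j\<bar>)"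
        unfolding abs_mult[of "\<tau> s i * \<tau> s j" for i j]
        using \<tau>\<tau>_le[OF that] by (intro sum_mono mult_right_mono) auto
      finally show "\<bar>q' s - fam.V n (\<tau> s) x\<bar> \<le> (\<Sum>i\<in>UNIV. \<Sum>j\<in>UNIV. \<bar>t i * t j\<bar> * \<bar>fam.\<Gamma> n i j x - a i j\<bar>)" .
    qed
    also have "\<dots> = \<delta> n"
      unfolding \<delta>_def using int by (simp add: Bochner_Integration.integral_sum)
    finally show ?thesis .
  qed
  define w where "w n s = exp (q s) * \<Phi> n s" for n s
  define w' where "w' n s = exp (q s) * (\<integral>x. cos (fam.G n (\<tau> s) x + \<theta>) * (q' s - fam.V n (\<tau> s) x) \<partial>M)" for n s
  have cos_V_integrable: "integrable M (\<lambda>x. cos (fam.G n (\<tau> s) x + \<theta>) * fam.V n (\<tau> s) x)" for n s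
    by (rule Bochner_Integration.integrable_bound[OF L2_integrable[OF fam.V_L2[of n "\<tau> s"]]])
       (simp_all add: abs_mult mult_left_le_one_le)
  have cos_integrable: "integrable M (\<lambda>x. cos (fam.G n (\<tau> s) x + \<theta>))" for n s
    by (rule integrable_const_bound[where B = 1]) auto
  have w_deriv: "(w n has_real_derivative w' n s) (at s within {..0})" if "s \<le> 0" for n s
  proof -
    have "(w n has_real_derivative exp (q s) * q' s * \<Phi> n s
        + - (\<integral>x. cos (fam.G n (\<tau> s) x + \<theta>) * fam.V n (\<tau> s) x \<partial>M) * exp (q s)) (at s within {..0})"
      unfolding w_def[abs_def]
      by (intro DERIV_mult DERIV_chain2[OF DERIV_exp q_deriv] \<Phi>_deriv that)
    also have "exp (q s) * q' s * \<Phi> n s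
        + - (\<integral>x. cos (fam.G n (\<tau> s) x + \<theta>) * fam.V n (\<tau> s) x \<partial>M) * exp (q s) = w' n s"
      unfolding w'_def \<Phi>_def using cos_V_integrable[of n s] cos_integrable[of n s]
      by (simp add: right_diff_distrib algebra_simps)
    finally show ?thesis .
  qed
  have w'_le: "\<bar>w' n s\<bar> \<le> B * \<delta> n" if "s \<le> 0" for n s
  proof -
    have int: "integrable M (\<lambda>x. \<bar>q' s - fam.V n (\<tau> s) x\<bar>)"
      using L2_integrable[OF fam.V_L2] by simp
    have "\<bar>\<integral>x. cos (fam.G n (\<tau> s) x + \<theta>) * (q' s - fam.V n (\<tau> s) x) \<partial>M\<bar>
        \<le> (\<integral>x. \<bar>q' s - fam.V n (\<tau> s) x\<bar> \<partial>M)"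
      using int by (intro order_trans[OF integral_abs_bound] integral_mono')
        (auto simp: abs_mult mult_left_le_one_le)
    also have "\<dots> \<le> \<delta> n" by (rule V_close[OF that])
    finally show ?thesis
      unfolding w'_def abs_mult using q_le[OF that]
      by (intro mult_mono) (auto intro: order_trans[OF exp_ge_zero])
  qed
  \<comment> \<open>the error made on \<open>[-T, 0]\<close> by replacing \<open>V\<close> by its limit; it vanishes as \<open>n\<close> grows, for each \<open>T\<close>\<close>
  have w_diff: "\<bar>w n 0 - w n (- real T)\<bar> \<le> B * \<delta> n * real T" for n T
    using field_differentiable_bound[of "{..0}" "w n" "w' n" "B * \<delta> n" 0 "- real T"]
      w_deriv[of _ n] w'_le[of _ n] by auto
  \<comment> \<open>the error made by starting at \<open>s\<close> instead of \<open>-\<infinity>\<close>; its bound does not depend on \<open>n\<close>\<close>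
  have w_start: "\<bar>w n s - cos \<theta>\<bar> \<le> \<epsilon> s" for n s
  proof -
    have G_integrable: "integrable M (fam.G n (\<tau> s))"
      by (rule L2_integrable[OF domain_L2[OF fam.G_domain]])
    have f_integrable: "integrable M (f n i)" for i by (rule L2_integrable[OF fam.f_L2])
    have "\<bar>\<Phi> n s - cos \<theta>\<bar> = \<bar>\<integral>x. cos (fam.G n (\<tau> s) x + \<theta>) - cos \<theta> \<partial>M\<bar>"
      using cos_integrable[of n s] by (simp add: \<Phi>_def prob_space)
    also have "\<dots> \<le> (\<integral>x. \<bar>cos (fam.G n (\<tau> s) x + \<theta>) - cos \<theta>\<bar> \<partial>M)"
      by (rule integral_abs_bound)
    also have "\<dots> \<le> (\<integral>x. (\<Sum>i\<in>UNIV. \<bar>\<tau> s i\<bar> * \<bar>f n i x\<bar>) \<partial>M)"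
    proof (rule integral_mono)
      show "integrable M (\<lambda>x. \<bar>cos (fam.G n (\<tau> s) x + \<theta>) - cos \<theta>\<bar>)"
        using cos_integrable[of n s] by simp
      show "integrable M (\<lambda>x. \<Sum>i\<in>UNIV. \<bar>\<tau> s i\<bar> * \<bar>f n i x\<bar>)"
        using f_integrable by simp
      fix x
      have "\<bar>cos (fam.G n (\<tau> s) x + \<theta>) - cos \<theta>\<bar> \<le> \<bar>fam.G n (\<tau> s) x\<bar>"
        using abs_cos_diff_le[of "fam.G n (\<tau> s) x + \<theta>" \<theta>] by simp
      also have "\<dots> \<le> (\<Sum>i\<in>UNIV. \<bar>\<tau> s i\<bar> * \<bar>f n i x\<bar>)"
        unfolding fam.G_def abs_mult[symmetric] by (rule sum_abs)
      finally show "\<bar>cos (fam.G n (\<tau> s) x + \<theta>) - cos \<theta>\<bar> \<le> (\<Sum>i\<in>UNIV. \<bar>\<tau> s i\<bar> * \<bar>f n i x\<bar>)" .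
    qed
    also have "\<dots> = (\<Sum>i\<in>UNIV. \<bar>\<tau> s i\<bar> * (\<integral>x. \<bar>f n i x\<bar> \<partial>M))"
      using f_integrable by (simp add: Bochner_Integration.integral_sum)
    also have "\<dots> \<le> (\<Sum>i\<in>UNIV. \<bar>\<tau> s i\<bar> * K i)"
      using K by (intro sum_mono mult_left_mono) auto
    finally have \<Phi>_near: "\<bar>\<Phi> n s - cos \<theta>\<bar> \<le> (\<Sum>i\<in>UNIV. \<bar>\<tau> s i\<bar> * K i)" .
    have "\<bar>\<Phi> n s\<bar> \<le> (\<integral>x. 1 \<partial>M)"
      unfolding \<Phi>_def by (intro order_trans[OF integral_abs_bound] integral_mono') auto
    then have \<Phi>_le: "\<bar>\<Phi> n s\<bar> \<le> 1" by (simp add: prob_space)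
    have "w n s - cos \<theta> = (exp (q s) - 1) * \<Phi> n s + (\<Phi> n s - cos \<theta>)"
      by (simp add: w_def algebra_simps)
    then have "\<bar>w n s - cos \<theta>\<bar> \<le> \<bar>exp (q s) - 1\<bar> * \<bar>\<Phi> n s\<bar> + \<bar>\<Phi> n s - cos \<theta>\<bar>"
      by (metis abs_mult abs_triangle_ineq)
    also have "\<dots> \<le> \<bar>exp (q s) - 1\<bar> + (\<Sum>i\<in>UNIV. \<bar>\<tau> s i\<bar> * K i)"
      using \<Phi>_near \<Phi>_le by (intro add_mono mult_left_le) auto
    finally show ?thesis by (simp add: \<epsilon>_def)
  qed
  have \<delta>_lim: "\<delta> \<longlonglongrightarrow> 0"
  proof -
    have "\<delta> \<longlonglongrightarrow> (\<Sum>i\<in>UNIV. \<Sum>j\<in>UNIV. \<bar>t i * t j\<bar> * 0)"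
      unfolding \<delta>_def[abs_def] a_def by (intro tendsto_sum tendsto_mult tendsto_const \<Gamma>_tendsto_L1)
    then show ?thesis by simp
  qed
  have \<epsilon>_lim: "(\<lambda>T. \<epsilon> (- real T)) \<longlonglongrightarrow> 0"
  proof -
    have \<tau>_lim: "(\<lambda>T. \<tau> (- real T) i) \<longlonglongrightarrow> 0" for i
    proof -
      have "(\<lambda>T. exp (- l i) ^ T) \<longlonglongrightarrow> 0"
        using fam.eigenvalue_pos[of i] by (intro LIMSEQ_realpow_zero) auto
      then have "(\<lambda>T. exp (- l i) ^ T * t i) \<longlonglongrightarrow> 0" by (rule tendsto_mult_left_zero)
      moreover have "exp (- l i) ^ T * t i = \<tau> (- real T) i" for T
        by (simp add: \<tau>_def exp_of_nat_mult[symmetric] mult.commute)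
      ultimately show ?thesis by simp
    qed
    have "(\<lambda>T. q (- real T)) \<longlonglongrightarrow> (\<Sum>i\<in>(UNIV::'i set). \<Sum>j\<in>(UNIV::'i set). 0 * 0 * C i j) / 2"
      unfolding q_def by (intro tendsto_intros \<tau>_lim) simp
    then have "(\<lambda>T. q (- real T)) \<longlonglongrightarrow> 0" by simp
    then have "(\<lambda>T. \<epsilon> (- real T)) \<longlonglongrightarrow> \<bar>exp 0 - 1\<bar> + (\<Sum>i\<in>UNIV. \<bar>0\<bar> * K i)"
      unfolding \<epsilon>_def by (intro tendsto_intros \<tau>_lim)
    then show ?thesis by simp
  qed
  have "(\<lambda>n. w n 0) \<longlonglongrightarrow> cos \<theta>"
  proof (rule tendstoI)
    fix e :: real assume "e > 0"
    then have "\<forall>\<^sub>F T in sequentially. \<epsilon> (- real T) < e / 2"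
      by (intro order_tendstoD[OF \<epsilon>_lim]) simp
    then obtain T where T: "\<epsilon> (- real T) < e / 2"
      by (auto simp: eventually_sequentially)
    have "(\<lambda>n. B * \<delta> n * real T) \<longlonglongrightarrow> B * 0 * real T"
      by (intro tendsto_intros \<delta>_lim)
    then have "\<forall>\<^sub>F n in sequentially. B * \<delta> n * real T < e / 2"
      using \<open>e > 0\<close> by (intro order_tendstoD) auto
    then show "\<forall>\<^sub>F n in sequentially. dist (w n 0) (cos \<theta>) < e"
    proof eventually_elim
      case (elim n)
      have "dist (w n 0) (cos \<theta>) \<le> \<bar>w n 0 - w n (- real T)\<bar> + \<bar>w n (- real T) - cos \<theta>\<bar>"
        unfolding dist_real_def by linarith
      also have "\<dots> < e" using w_diff[of n T] w_start[of n "- real T"] T elim by linarith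
      finally show ?case .
    qed
  qed
  then have "(\<lambda>n. w n 0 * exp (- q 0)) \<longlonglongrightarrow> cos \<theta> * exp (- q 0)"
    by (intro tendsto_mult tendsto_const)
  moreover have "\<tau> 0 = t" by (simp add: \<tau>_def fun_eq_iff)
  ultimately show ?thesis
    by (simp add: w_def \<Phi>_def fam.G_def q_def exp_minus field_simps)
qed

end

section \<open>Convergence in distribution by trigonometric moments\<close>

text \<open>Cosines with a phase include the sines and the constants, and products of two of them are again
sums of two of them. This avoids complex exponentials.\<close>

inductive trig_poly :: "('v::real_inner \<Rightarrow> real) \<Rightarrow> bool" where
  cos: "trig_poly (\<lambda>x. c * cos (t \<bullet> x + \<theta>))"
| add: "trig_poly f \<Longrightarrow> trig_poly g \<Longrightarrow> trig_poly (\<lambda>x. f x + g x)"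

lemma trig_poly_const: "trig_poly (\<lambda>_. c)"
  using trig_poly.cos[of c 0 0] by simp

lemma trig_poly_mult_cos:
  assumes "trig_poly f"
  shows "trig_poly (\<lambda>x. f x * (c * cos (t \<bullet> x + \<theta>)))"
  using assms
proof induction
  case (cos d u \<eta>)
  have "d * cos (u \<bullet> x + \<eta>) * (c * cos (t \<bullet> x + \<theta>))
      = (d * c / 2) * cos ((u - t) \<bullet> x + (\<eta> - \<theta>)) + (d * c / 2) * cos ((u + t) \<bullet> x + (\<eta> + \<theta>))" for x
  proof -
    have "cos (u \<bullet> x + \<eta>) * cos (t \<bullet> x + \<theta>)
        = (cos ((u \<bullet> x + \<eta>) - (t \<bullet> x + \<theta>)) + cos ((u \<bullet> x + \<eta>) + (t \<bullet> x + \<theta>))) / 2"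
      by (rule cos_times_cos)
    also have "(u \<bullet> x + \<eta>) - (t \<bullet> x + \<theta>) = (u - t) \<bullet> x + (\<eta> - \<theta>)"
      by (simp add: inner_diff_left)
    also have "(u \<bullet> x + \<eta>) + (t \<bullet> x + \<theta>) = (u + t) \<bullet> x + (\<eta> + \<theta>)"
      by (simp add: inner_add_left)
    finally have *: "cos (u \<bullet> x + \<eta>) * cos (t \<bullet> x + \<theta>)
        = (cos ((u - t) \<bullet> x + (\<eta> - \<theta>)) + cos ((u + t) \<bullet> x + (\<eta> + \<theta>))) / 2" .
    have "d * cos (u \<bullet> x + \<eta>) * (c * cos (t \<bullet> x + \<theta>))
        = d * c * (cos (u \<bullet> x + \<eta>) * cos (t \<bullet> x + \<theta>))" by (simp only: mult_ac)
    then show ?thesis unfolding * by (simp add: distrib_left add_divide_distrib)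
  qed
  then show ?case by (simp only:) (intro trig_poly.intros)
next
  case (add f g)
  show ?case unfolding distrib_right by (rule trig_poly.add[OF add.IH])
qed

lemma trig_poly_mult:
  assumes "trig_poly f" "trig_poly g"
  shows "trig_poly (\<lambda>x. f x * g x)"
  using assms(2)
proof induction
  case (cos c t \<theta>)
  show ?case by (rule trig_poly_mult_cos[OF assms(1)])
next
  case (add g h)
  show ?case unfolding distrib_left by (rule trig_poly.add[OF add.IH])
qed

lemma trig_poly_sum:
  assumes "\<And>i. i \<in> I \<Longrightarrow> trig_poly (f i)"
  shows "trig_poly (\<lambda>x. \<Sum>i\<in>I. f i x)"
  using assms by (induction I rule: infinite_finite_induct) (auto intro: trig_poly_const trig_poly.add)

lemma trig_poly_sin_component: "trig_poly (\<lambda>x::real^'d. sin (x $ i / R))"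
proof -
  have "sin (x $ i / R) = 1 * cos (axis i (- (1 / R)) \<bullet> x + pi / 2)" for x :: "real^'d"
    by (simp add: inner_axis' cos_diff)
  then show ?thesis by (simp only:) (rule trig_poly.cos)
qed

lemma trig_poly_polynomial_sin:
  assumes "real_polynomial_function p"
  shows "trig_poly (\<lambda>x::real^'d. p (\<chi> i. sin (x $ i / R)))"
  using assms
proof induction
  case (linear h)
  interpret bounded_linear h by fact
  have expand: "h y = (\<Sum>i\<in>UNIV. h (axis i 1) * y $ i)" for y :: "real^'d"
  proof -
    have "h y = h (\<Sum>i\<in>UNIV. y $ i *\<^sub>R axis i 1)"
      by (simp add: basis_expansion flip: scalar_mult_eq_scaleR)
    also have "\<dots> = (\<Sum>i\<in>UNIV. h (axis i 1) * y $ i)" by (simp add: sum scale mult.commute)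
    finally show ?thesis .
  qed
  have eq: "(\<lambda>x. h (\<chi> i. sin (x $ i / R))) = (\<lambda>x. \<Sum>i\<in>UNIV. h (axis i 1) * sin (x $ i / R))"
    by (rule ext) (subst expand, simp)
  show ?case
    unfolding eq by (rule trig_poly_sum[OF trig_poly_mult[OF trig_poly_const trig_poly_sin_component]])
qed (auto intro: trig_poly_const trig_poly.add trig_poly_mult)

lemma trig_poly_continuous_bounded:
  assumes "trig_poly f"
  shows "continuous_on UNIV f \<and> (\<exists>B. \<forall>x. \<bar>f x\<bar> \<le> B)"
  using assms
proof induction
  case (cos c t \<theta>)
  have "\<bar>c * cos (t \<bullet> x + \<theta>)\<bar> \<le> \<bar>c\<bar>" for x by (simp add: abs_mult mult_left_le)
  then show ?case by (auto intro!: continuous_intros)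
next
  case (add f g)
  then obtain A B where "\<And>x. \<bar>f x\<bar> \<le> A" "\<And>x. \<bar>g x\<bar> \<le> B" by auto
  then have "\<bar>f x + g x\<bar> \<le> A + B" for x by (meson abs_triangle_ineq add_mono order_trans)
  with add show ?case by (auto intro!: continuous_intros)
qed

lemma (in prob_space) trig_poly_integrable:
  fixes X :: "'a \<Rightarrow> 'v::euclidean_space"
  assumes "trig_poly f" "X \<in> borel_measurable M"
  shows "integrable M (\<lambda>x. f (X x))"
proof -
  obtain B where B: "\<And>x. \<bar>f x\<bar> \<le> B" and f: "continuous_on UNIV f"
    using trig_poly_continuous_bounded[OF assms(1)] by auto
  show ?thesis
    by (rule integrable_const_bound[where B = B, OF _ borel_measurable_continuous_on[OF f assms(2)]])
       (simp add: B)
qed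

lemma trig_poly_limit:
  fixes X :: "nat \<Rightarrow> 'a \<Rightarrow> 'v::euclidean_space" and Y :: "'b \<Rightarrow> 'v"
  assumes M: "prob_space M" and N: "prob_space N"
    and X: "\<And>n. X n \<in> borel_measurable M" and Y: "Y \<in> borel_measurable N"
    and lim: "\<And>t \<theta>. (\<lambda>n. \<integral>x. cos (t \<bullet> X n x + \<theta>) \<partial>M) \<longlonglongrightarrow> (\<integral>y. cos (t \<bullet> Y y + \<theta>) \<partial>N)"
    and "trig_poly f"
  shows "(\<lambda>n. \<integral>x. f (X n x) \<partial>M) \<longlonglongrightarrow> (\<integral>y. f (Y y) \<partial>N)"
  using \<open>trig_poly f\<close>
proof induction
  case (cos c t \<theta>)
  show ?case using tendsto_mult[OF tendsto_const lim] by simp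
next
  case (add f g)
  have "integrable M (\<lambda>x. f (X n x))" "integrable M (\<lambda>x. g (X n x))"
    "integrable N (\<lambda>y. f (Y y))" "integrable N (\<lambda>y. g (Y y))" for n
    by (rule prob_space.trig_poly_integrable[OF M _ X] prob_space.trig_poly_integrable[OF N _ Y],
        rule add.hyps)+
  then show ?case using tendsto_add[OF add.IH] by simp
qed

text \<open>Approximation by polynomials is uniform on compact sets only, whereas the error has to be controlled on the whole space.
So \<open>f\<close> is first replaced by its value at the point with coordinates \<open>R * arcsin (sin (x $ i / R))\<close>.
This is a continuous function of the sines, which range over a compact cube, and hence it is uniformly close to
a polynomial in sines. It agrees with \<open>f\<close> where all coordinates are bounded by \<open>R\<close>, and elsewhere the quadratic term dominates
the error, which is at most \<open>2 * B\<close>.\<close>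

lemma truncated_approximation:
  fixes f :: "real^'d \<Rightarrow> real"
  assumes f: "continuous_on UNIV f" "\<And>x. \<bar>f x\<bar> \<le> B" and R: "R > 0" and e: "e > 0"
  obtains p where "trig_poly p" "\<And>x. \<bar>f x - p x\<bar> \<le> e + 2 * B * (\<Sum>i\<in>UNIV. (x $ i)\<^sup>2) / R\<^sup>2"
proof -
  define h where "h y = f (\<chi> i. R * arcsin (y $ i))" for y
  let ?S = "{y::real^'d. \<forall>i. y $ i \<in> {-1..1}}"
  have S_eq: "?S = cbox (\<chi> i. -1) (\<chi> i. 1)" by (auto simp: mem_box_cart)
  have "continuous_on ?S (\<lambda>y. \<chi> i. R * arcsin (y $ i))"
    by (intro continuous_on_vec_lambda continuous_intros) auto
  then have "continuous_on ?S h"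
    unfolding h_def by (rule continuous_on_compose2[OF f(1)]) auto
  moreover have "compact ?S" unfolding S_eq by (rule compact_cbox)
  ultimately obtain p where p: "real_polynomial_function p" "\<And>y. y \<in> ?S \<Longrightarrow> \<bar>h y - p y\<bar> < e"
    using Stone_Weierstrass_real_polynomial_function[of ?S h e] e by blast
  define s where "s x = (\<chi> i. sin (x $ i / R))" for x :: "real^'d"
  have near: "\<bar>h (s x) - p (s x)\<bar> \<le> e" for x
    using p(2)[of "s x"] by (auto simp: s_def less_imp_le)
  have "B \<ge> 0" using f(2)[of 0] by linarith
  have far: "\<bar>f x - h (s x)\<bar> \<le> 2 * B * (\<Sum>i\<in>UNIV. (x $ i)\<^sup>2) / R\<^sup>2" for x
  proof (cases "\<forall>i. \<bar>x $ i\<bar> \<le> R")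
    case True
    have "R * arcsin (sin (x $ i / R)) = x $ i" for i
    proof -
      have "\<bar>x $ i / R\<bar> \<le> 1" using True R by simp
      then have "\<bar>x $ i / R\<bar> \<le> pi / 2" using pi_ge_two by linarith
      then have "- (pi / 2) \<le> x $ i / R" "x $ i / R \<le> pi / 2" by linarith+
      then have "arcsin (sin (x $ i / R)) = x $ i / R" by (rule arcsin_sin)
      then show ?thesis using R by simp
    qed
    then have "h (s x) = f x" by (simp add: h_def s_def)
    then show ?thesis using \<open>B \<ge> 0\<close> by (simp add: sum_nonneg)
  next
    case False
    then obtain j where j: "R < \<bar>x $ j\<bar>" by (auto simp: not_le)
    have "R\<^sup>2 \<le> (x $ j)\<^sup>2" using j R by (intro abs_le_square_iff[THEN iffD1]) auto
    also have "\<dots> \<le> (\<Sum>i\<in>UNIV. (x $ i)\<^sup>2)" by (intro member_le_sum) auto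
    finally have "1 \<le> (\<Sum>i\<in>UNIV. (x $ i)\<^sup>2) / R\<^sup>2" using R by simp
    then have "2 * B * 1 \<le> 2 * B * ((\<Sum>i\<in>UNIV. (x $ i)\<^sup>2) / R\<^sup>2)"
      using \<open>B \<ge> 0\<close> by (intro mult_left_mono) auto
    moreover have "\<bar>f x - h (s x)\<bar> \<le> 2 * B"
      using f(2)[of x] f(2)[of "\<chi> i. R * arcsin (s x $ i)"] unfolding h_def by linarith
    ultimately show ?thesis by simp
  qed
  show ?thesis
  proof (rule that[of "\<lambda>x. p (s x)"])
    show "trig_poly (\<lambda>x. p (s x))" unfolding s_def by (rule trig_poly_polynomial_sin[OF p(1)])
    show "\<bar>f x - p (s x)\<bar> \<le> e + 2 * B * (\<Sum>i\<in>UNIV. (x $ i)\<^sup>2) / R\<^sup>2" for x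
      using near[of x] far[of x] by linarith
  qed
qed

lemma vec_nth_measurable [measurable]:
  "X \<in> borel_measurable M \<Longrightarrow> (\<lambda>x. X x $ i) \<in> borel_measurable M" for X :: "'a \<Rightarrow> real^'d"
  by (rule borel_measurable_continuous_on[where f = "\<lambda>v. v $ i", OF continuous_on_component[OF continuous_on_id]])

text \<open>The continuity theorem for characteristic functions in several variables, with bounded second moments in the role of
tightness.\<close>

lemma conv_in_distribution_characteristic:
  fixes X :: "nat \<Rightarrow> 'a \<Rightarrow> real^'d" and Y :: "'b \<Rightarrow> real^'d"
  assumes M: "prob_space M" and N: "prob_space N"
    and X: "\<And>n. X n \<in> borel_measurable M" and Y: "Y \<in> borel_measurable N"
    and lim: "\<And>t \<theta>. (\<lambda>n. \<integral>x. cos (t \<bullet> X n x + \<theta>) \<partial>M) \<longlonglongrightarrow> (\<integral>y. cos (t \<bullet> Y y + \<theta>) \<partial>N)"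
    and X2: "\<And>n i. integrable M (\<lambda>x. (X n x $ i)\<^sup>2)" "\<And>n i. (\<integral>x. (X n x $ i)\<^sup>2 \<partial>M) \<le> K i"
    and Y2: "\<And>i. integrable N (\<lambda>y. (Y y $ i)\<^sup>2)" "\<And>i. (\<integral>y. (Y y $ i)\<^sup>2 \<partial>N) \<le> K i"
  shows "conv_in_distribution M X N Y"
  unfolding conv_in_distribution_def
proof (intro allI impI, elim conjE)
  fix f :: "real^'d \<Rightarrow> real"
  assume f: "continuous_on UNIV f" "bounded (range f)"
  then obtain B where B: "\<And>x. \<bar>f x\<bar> \<le> B" "B > 0"
    by (auto simp: bounded_pos)
  let ?K = "\<Sum>i\<in>UNIV. K i"
  have close: "\<bar>(\<integral>x. f (U x) \<partial>Q) - (\<integral>x. p (U x) \<partial>Q)\<bar> \<le> e + 2 * B * ?K / R\<^sup>2"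
    if Q: "prob_space Q" and U: "U \<in> borel_measurable Q" and p: "trig_poly p"
      and U2: "\<And>i. integrable Q (\<lambda>x. (U x $ i)\<^sup>2)" "\<And>i. (\<integral>x. (U x $ i)\<^sup>2 \<partial>Q) \<le> K i"
      and le: "\<And>x. \<bar>f x - p x\<bar> \<le> e + 2 * B * (\<Sum>i\<in>UNIV. (x $ i)\<^sup>2) / R\<^sup>2"
    for Q :: "'c measure" and U p e R
  proof -
    interpret Q: prob_space Q by fact
    have intf: "integrable Q (\<lambda>x. f (U x))"
      by (rule Q.integrable_const_bound[where B = B, OF _ borel_measurable_continuous_on[OF f(1) U]])
         (simp add: B)
    have intp: "integrable Q (\<lambda>x. p (U x))" by (rule Q.trig_poly_integrable[OF p U])
    have "\<bar>(\<integral>x. f (U x) \<partial>Q) - (\<integral>x. p (U x) \<partial>Q)\<bar> = \<bar>\<integral>x. f (U x) - p (U x) \<partial>Q\<bar>"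
      using intf intp by simp
    also have "\<dots> \<le> (\<integral>x. \<bar>f (U x) - p (U x)\<bar> \<partial>Q)" by (rule integral_abs_bound)
    also have "\<dots> \<le> (\<integral>x. e + 2 * B * (\<Sum>i\<in>UNIV. (U x $ i)\<^sup>2) / R\<^sup>2 \<partial>Q)"
      using intf intp U2(1) le by (intro integral_mono) auto
    also have "\<dots> = e + 2 * B * (\<Sum>i\<in>UNIV. (\<integral>x. (U x $ i)\<^sup>2 \<partial>Q)) / R\<^sup>2"
      using U2(1) by (simp add: Bochner_Integration.integral_sum Q.prob_space)
    also have "\<dots> \<le> e + 2 * B * ?K / R\<^sup>2"
      using U2(2) B(2) by (intro add_left_mono divide_right_mono mult_left_mono sum_mono) auto
    finally show ?thesis .
  qed
  show "(\<lambda>n. \<integral>x. f (X n x) \<partial>M) \<longlonglongrightarrow> (\<integral>y. f (Y y) \<partial>N)"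
  proof (rule tendstoI)
    fix e :: real assume "e > 0"
    obtain R :: real where "R > 0" and R: "2 * B * ?K / R\<^sup>2 < e / 6"
    proof -
      have "((\<lambda>m. 2 * B * ?K * (1 / real (Suc m))\<^sup>2) \<longlonglongrightarrow> 2 * B * ?K * 0\<^sup>2)"
        by (intro tendsto_intros LIMSEQ_Suc[OF lim_1_over_n])
      then have "\<forall>\<^sub>F m in sequentially. 2 * B * ?K * (1 / real (Suc m))\<^sup>2 < e / 6"
        using \<open>e > 0\<close> by (intro order_tendstoD) auto
      then obtain m where "2 * B * ?K * (1 / real (Suc m))\<^sup>2 < e / 6"
        by (auto simp: eventually_sequentially)
      then show ?thesis by (intro that[of "real (Suc m)"]) (auto simp: power_divide)
    qed
    obtain p where p: "trig_poly p"
      "\<And>x. \<bar>f x - p x\<bar> \<le> e / 6 + 2 * B * (\<Sum>i\<in>UNIV. (x $ i)\<^sup>2) / R\<^sup>2"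
      using truncated_approximation[OF f(1) B(1) \<open>R > 0\<close>, of "e / 6"] \<open>e > 0\<close> by auto
    have "\<forall>\<^sub>F n in sequentially. dist (\<integral>x. p (X n x) \<partial>M) (\<integral>y. p (Y y) \<partial>N) < e / 3"
      using \<open>e > 0\<close> by (intro tendstoD[OF trig_poly_limit[OF M N X Y lim p(1)]]) simp
    then show "\<forall>\<^sub>F n in sequentially. dist (\<integral>x. f (X n x) \<partial>M) (\<integral>y. f (Y y) \<partial>N) < e"
    proof eventually_elim
      case (elim n)
      with close[OF M X p(1) X2 p(2), of n] close[OF N Y p(1) Y2 p(2)] R show ?case
        unfolding dist_real_def by linarith
    qed
  qed
qed

section \<open>Gaussian vectors\<close>

text \<open>One affine image of the standard normal distribution covers both the nondegenerate case and, with
\<open>\<sigma> = 0\<close>, the constants.\<close>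

lemma gaussian_law:
  assumes N: "prob_space N" and X: "gaussian_rv N X"
  obtains m \<sigma> where "distr N borel X = distr std_normal_distribution borel (\<lambda>y. m + \<sigma> * y)"
proof -
  interpret N: prob_space N by fact
  interpret S: prob_space std_normal_distribution by (rule prob_space_normal_density) simp
  have [measurable]: "X \<in> borel_measurable N" using X by (simp add: gaussian_rv_def)
  from X obtain m where "(AE x in N. X x = m) \<or> (\<exists>\<sigma>>0. distributed N lborel X (normal_density m \<sigma>))"
    by (auto simp: gaussian_rv_def)
  then show ?thesis
  proof
    assume "AE x in N. X x = m"
    then have "distr N borel X = distr N borel (\<lambda>_. m)" by (intro distr_cong_AE) auto
    also have "\<dots> = return borel m" by (simp add: N.distr_const)
    also have "\<dots> = distr std_normal_distribution borel (\<lambda>y. m + 0 * y)" by (simp add: S.distr_const)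
    finally show ?thesis by (rule that)
  next
    assume "\<exists>\<sigma>>0. distributed N lborel X (normal_density m \<sigma>)"
    then obtain \<sigma> where \<sigma>: "\<sigma> > 0" "distributed N lborel X (normal_density m \<sigma>)" by auto
    then have "distributed N lborel (\<lambda>x. (X x - m) / \<sigma>) std_normal_density"
      by (simp only: N.normal_standard_normal_convert[OF \<sigma>(1), symmetric])
    then have law: "std_normal_distribution = distr N lborel (\<lambda>x. (X x - m) / \<sigma>)"
      by (rule distributed_distr_eq_density[symmetric])
    have "distr std_normal_distribution borel (\<lambda>y. m + \<sigma> * y)
        = distr N borel ((\<lambda>y. m + \<sigma> * y) \<circ> (\<lambda>x. (X x - m) / \<sigma>))"
      unfolding law by (rule distr_distr) auto
    also have "(\<lambda>y. m + \<sigma> * y) \<circ> (\<lambda>x. (X x - m) / \<sigma>) = X"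
      using \<sigma>(1) by (simp add: fun_eq_iff)
    finally show ?thesis by (intro that[of m \<sigma>]) simp
  qed
qed

lemma std_normal_integrals:
  "integrable std_normal_distribution (\<lambda>x. x ^ k)"
  "(\<integral>x. x \<partial>std_normal_distribution) = 0"
  "(\<integral>x. x\<^sup>2 \<partial>std_normal_distribution) = 1"
  "(\<integral>x. x ^ 4 \<partial>std_normal_distribution) = 3"
  "(\<integral>x. cos (\<sigma> * x + \<theta>) \<partial>std_normal_distribution) = cos \<theta> * exp (- \<sigma>\<^sup>2 / 2)"
proof -
  interpret S: prob_space std_normal_distribution by (rule prob_space_normal_density) simp
  show "integrable std_normal_distribution (\<lambda>x. x ^ k)"
    by (rule integrable_std_normal_distribution_moment)
  show "(\<integral>x. x \<partial>std_normal_distribution) = 0"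
    using integral_std_normal_distribution_moment_odd[of 1] by simp
  show "(\<integral>x. x\<^sup>2 \<partial>std_normal_distribution) = 1" "(\<integral>x. x ^ 4 \<partial>std_normal_distribution) = 3"
    using std_normal_distribution_even_moments(1)[of 1] std_normal_distribution_even_moments(1)[of 2]
    by (simp_all add: fact_numeral)
  have int: "integrable std_normal_distribution (\<lambda>x. iexp (\<sigma> * x))"
    by (rule S.integrable_iexp) simp_all
  have char: "(CLINT x|std_normal_distribution. iexp (\<sigma> * x)) = complex_of_real (exp (- \<sigma>\<^sup>2 / 2))"
    using fun_cong[OF char_std_normal_distribution, of \<sigma>] by (simp add: char_def)
  have "(\<integral>x. cos (\<sigma> * x) \<partial>std_normal_distribution) = Re (CLINT x|std_normal_distribution. iexp (\<sigma> * x))"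
    using integral_Re[OF int] by (simp add: Re_exp)
  then have c: "(\<integral>x. cos (\<sigma> * x) \<partial>std_normal_distribution) = exp (- \<sigma>\<^sup>2 / 2)"
    by (simp only: char Re_complex_of_real)
  have "(\<integral>x. sin (\<sigma> * x) \<partial>std_normal_distribution) = Im (CLINT x|std_normal_distribution. iexp (\<sigma> * x))"
    using integral_Im[OF int] by (simp add: Im_exp)
  then have s: "(\<integral>x. sin (\<sigma> * x) \<partial>std_normal_distribution) = 0"
    by (simp only: char Im_complex_of_real)
  have "integrable std_normal_distribution (\<lambda>x. cos (\<sigma> * x))"
    "integrable std_normal_distribution (\<lambda>x. sin (\<sigma> * x))"
    by (rule S.integrable_const_bound[where B = 1]; simp)+
  then show "(\<integral>x. cos (\<sigma> * x + \<theta>) \<partial>std_normal_distribution) = cos \<theta> * exp (- \<sigma>\<^sup>2 / 2)"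
    by (simp add: cos_add c s)
qed

lemma gaussian_rv_power_integrable:
  assumes N: "prob_space N" and X: "gaussian_rv N X"
  shows "integrable N (\<lambda>x. X x ^ k)"
proof -
  obtain m \<sigma> where law: "distr N borel X = distr std_normal_distribution borel (\<lambda>y. m + \<sigma> * y)"
    using gaussian_law[OF assms] .
  have [measurable]: "X \<in> borel_measurable N" using X by (simp add: gaussian_rv_def)
  have "integrable std_normal_distribution (\<lambda>y. (m + \<sigma> * y) ^ k)"
    unfolding binomial_ring power_mult_distrib
    by (intro Bochner_Integration.integrable_sum integrable_mult_right std_normal_integrals(1))
  then have "integrable (distr std_normal_distribution borel (\<lambda>y. m + \<sigma> * y)) (\<lambda>x. x ^ k)"
    by (subst integrable_distr_eq) auto
  then show ?thesis
    unfolding law[symmetric] by (subst (asm) integrable_distr_eq) auto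
qed

lemma centered_gaussian_rv:
  assumes N: "prob_space N" and X: "gaussian_rv N X" and mean: "(\<integral>x. X x \<partial>N) = 0"
  shows "(\<integral>x. X x ^ 4 \<partial>N) = 3 * (\<integral>x. (X x)\<^sup>2 \<partial>N)\<^sup>2"
    and "(\<integral>x. cos (X x + \<theta>) \<partial>N) = cos \<theta> * exp (- (\<integral>x. (X x)\<^sup>2 \<partial>N) / 2)"
proof -
  interpret S: prob_space std_normal_distribution by (rule prob_space_normal_density) simp
  obtain m \<sigma> where law: "distr N borel X = distr std_normal_distribution borel (\<lambda>y. m + \<sigma> * y)"
    using gaussian_law[OF N X] .
  have [measurable]: "X \<in> borel_measurable N" using X by (simp add: gaussian_rv_def)
  have E: "(\<integral>x. g (X x) \<partial>N) = (\<integral>y. g (m + \<sigma> * y) \<partial>std_normal_distribution)"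
    if [measurable]: "g \<in> borel_measurable borel" for g :: "real \<Rightarrow> real"
  proof -
    have "(\<integral>x. g (X x) \<partial>N) = (\<integral>x. g x \<partial>distr N borel X)" by (simp add: integral_distr)
    also have "\<dots> = (\<integral>y. g (m + \<sigma> * y) \<partial>std_normal_distribution)"
      unfolding law by (simp add: integral_distr)
    finally show ?thesis .
  qed
  have "integrable std_normal_distribution (\<lambda>x. x)" using std_normal_integrals(1)[of 1] by simp
  moreover have "(\<integral>x. X x \<partial>N) = (\<integral>y. m + \<sigma> * y \<partial>std_normal_distribution)"
    by (rule E[of "\<lambda>x. x"]) simp
  ultimately have "m = 0"
    using mean S.prob_space by (simp add: std_normal_integrals(2))
  then have E0: "(\<integral>x. g (X x) \<partial>N) = (\<integral>y. g (\<sigma> * y) \<partial>std_normal_distribution)"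
    if "g \<in> borel_measurable borel" for g :: "real \<Rightarrow> real"
    using E[OF that] by simp
  have "(\<integral>x. (X x)\<^sup>2 \<partial>N) = (\<integral>y. \<sigma>\<^sup>2 * y\<^sup>2 \<partial>std_normal_distribution)"
    unfolding power_mult_distrib[symmetric] by (rule E0) simp
  then have 2: "(\<integral>x. (X x)\<^sup>2 \<partial>N) = \<sigma>\<^sup>2"
    by (simp only: integral_mult_right_zero std_normal_integrals(3) mult_1_right)
  have "(\<integral>x. X x ^ 4 \<partial>N) = (\<integral>y. \<sigma> ^ 4 * y ^ 4 \<partial>std_normal_distribution)"
    unfolding power_mult_distrib[symmetric] by (rule E0) simp
  then have "(\<integral>x. X x ^ 4 \<partial>N) = \<sigma> ^ 4 * 3"
    by (simp only: integral_mult_right_zero std_normal_integrals(4))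
  then show "(\<integral>x. X x ^ 4 \<partial>N) = 3 * (\<integral>x. (X x)\<^sup>2 \<partial>N)\<^sup>2"
    unfolding 2 by (simp flip: power_mult)
  show "(\<integral>x. cos (X x + \<theta>) \<partial>N) = cos \<theta> * exp (- (\<integral>x. (X x)\<^sup>2 \<partial>N) / 2)"
    unfolding 2 std_normal_integrals(5)[symmetric]
    by (rule E0[of "\<lambda>x. cos (x + \<theta>)"]) simp
qed

text \<open>All moments are read off from the one-dimensional laws of \<open>t \<bullet> Z\<close>: the mixed fourth moments come from the
fourth moments of \<open>Z\<^sub>i + Z\<^sub>j\<close> and \<open>Z\<^sub>i - Z\<^sub>j\<close> by polarization.\<close>

lemma centered_gaussian_vector_moments:
  fixes Z :: "'b \<Rightarrow> real^'d"
  assumes P: "prob_space P" and Z: "centered_gaussian_vector P Z C"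
  shows "integrable P (\<lambda>y. (Z y $ i)\<^sup>2)" "(\<integral>y. (Z y $ i)\<^sup>2 \<partial>P) = C $ i $ i"
    and "integrable P (\<lambda>y. (Z y $ i)\<^sup>2 * (Z y $ j)\<^sup>2)"
    and "(\<integral>y. (Z y $ i)\<^sup>2 * (Z y $ j)\<^sup>2 \<partial>P) = C $ i $ i * C $ j $ j + 2 * (C $ i $ j)\<^sup>2"
    and "(\<integral>y. cos (t \<bullet> Z y + \<theta>) \<partial>P) = cos \<theta> * exp (- (\<Sum>i\<in>UNIV. \<Sum>j\<in>UNIV. t $ i * t $ j * C $ i $ j) / 2)"
proof -
  interpret P: prob_space P by fact
  have gauss: "gaussian_rv P (\<lambda>y. t \<bullet> Z y)" and mean: "(\<integral>y. Z y $ i \<partial>P) = 0"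
    and cov: "cov_matrix P Z = C" for t i
    using Z by (auto simp: centered_gaussian_vector_def)
  have pow: "integrable P (\<lambda>y. (t \<bullet> Z y) ^ k)" for t k
    by (rule gaussian_rv_power_integrable[OF P gauss])
  have ax: "axis i 1 \<bullet> Z y = Z y $ i" for i y by (simp add: inner_axis')
  have Z_int: "integrable P (\<lambda>y. Z y $ i)" for i using pow[of "axis i 1" 1] by (simp add: ax)
  have sum_ax: "(axis i 1 + axis j 1) \<bullet> Z y = Z y $ i + Z y $ j"
    "(axis i 1 - axis j 1) \<bullet> Z y = Z y $ i - Z y $ j" for i j y
    by (simp_all add: inner_add_left inner_diff_left ax)
  have ZZ_int: "integrable P (\<lambda>y. Z y $ i * Z y $ j)" for i j
  proof -
    have "integrable P (\<lambda>y. ((Z y $ i + Z y $ j)\<^sup>2 - (Z y $ i - Z y $ j)\<^sup>2) / 4)"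
      using pow[of "axis i 1 + axis j 1" 2] pow[of "axis i 1 - axis j 1" 2] unfolding sum_ax by simp
    moreover have "((a + b)\<^sup>2 - (a - b)\<^sup>2) / 4 = a * b" for a b :: real
      by (simp add: power2_eq_square algebra_simps)
    ultimately show ?thesis by simp
  qed
  have C: "C $ i $ j = (\<integral>y. Z y $ i * Z y $ j \<partial>P)" for i j
    unfolding cov[symmetric] by (simp add: cov_matrix_def mean)
  have mean_t: "(\<integral>y. t \<bullet> Z y \<partial>P) = 0" for t
    using Z_int by (simp add: inner_vec_def mean Bochner_Integration.integral_sum)
  have var: "(\<integral>y. (t \<bullet> Z y)\<^sup>2 \<partial>P) = (\<Sum>i\<in>UNIV. \<Sum>j\<in>UNIV. t $ i * t $ j * C $ i $ j)" for t
  proof -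
    have "(t \<bullet> Z y)\<^sup>2 = (\<Sum>i\<in>UNIV. \<Sum>j\<in>UNIV. t $ i * t $ j * (Z y $ i * Z y $ j))" for y
      by (simp add: inner_vec_def power2_eq_square sum_product mult_ac)
    then show ?thesis
      using ZZ_int by (simp add: C Bochner_Integration.integral_sum)
  qed
  show "integrable P (\<lambda>y. (Z y $ i)\<^sup>2)" "(\<integral>y. (Z y $ i)\<^sup>2 \<partial>P) = C $ i $ i"
    using ZZ_int[of i i] by (simp_all add: power2_eq_square C)
  show "(\<integral>y. cos (t \<bullet> Z y + \<theta>) \<partial>P) = cos \<theta> * exp (- (\<Sum>i\<in>UNIV. \<Sum>j\<in>UNIV. t $ i * t $ j * C $ i $ j) / 2)"
    using centered_gaussian_rv(2)[OF P gauss mean_t] unfolding var .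
  have fourth: "(\<integral>y. (t \<bullet> Z y) ^ 4 \<partial>P) = 3 * (\<integral>y. (t \<bullet> Z y)\<^sup>2 \<partial>P)\<^sup>2" for t
    by (rule centered_gaussian_rv(1)[OF P gauss mean_t])
  have polar: "a\<^sup>2 * b\<^sup>2 = ((a + b) ^ 4 + (a - b) ^ 4 - 2 * a ^ 4 - 2 * b ^ 4) / 12" for a b :: real
    by (simp add: power_numeral_reduce algebra_simps)
  have int4: "integrable P (\<lambda>y. (Z y $ i + Z y $ j) ^ 4)" "integrable P (\<lambda>y. (Z y $ i - Z y $ j) ^ 4)"
    "integrable P (\<lambda>y. (Z y $ i) ^ 4)" for i j
    using pow[of "axis i 1 + axis j 1" 4] pow[of "axis i 1 - axis j 1" 4] pow[of "axis i 1" 4]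
    unfolding sum_ax ax by simp_all
  show "integrable P (\<lambda>y. (Z y $ i)\<^sup>2 * (Z y $ j)\<^sup>2)"
    unfolding polar using int4 by simp
  have plus: "(\<integral>y. (Z y $ i + Z y $ j)\<^sup>2 \<partial>P) = C $ i $ i + 2 * C $ i $ j + C $ j $ j"
  proof -
    have "(Z y $ i + Z y $ j)\<^sup>2 = Z y $ i * Z y $ i + 2 * (Z y $ i * Z y $ j) + Z y $ j * Z y $ j" for y
      by (simp add: power2_eq_square algebra_simps)
    then show ?thesis using ZZ_int by (simp add: C)
  qed
  have minus: "(\<integral>y. (Z y $ i - Z y $ j)\<^sup>2 \<partial>P) = C $ i $ i - 2 * C $ i $ j + C $ j $ j"
  proof -
    have "(Z y $ i - Z y $ j)\<^sup>2 = Z y $ i * Z y $ i - 2 * (Z y $ i * Z y $ j) + Z y $ j * Z y $ j" for y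
      by (simp add: power2_eq_square algebra_simps)
    then show ?thesis using ZZ_int by (simp add: C)
  qed
  have single: "(\<integral>y. (Z y $ i)\<^sup>2 \<partial>P) = C $ i $ i" for i by (simp add: C power2_eq_square)
  have "(\<integral>y. (Z y $ i)\<^sup>2 * (Z y $ j)\<^sup>2 \<partial>P)
      = ((\<integral>y. (Z y $ i + Z y $ j) ^ 4 \<partial>P) + (\<integral>y. (Z y $ i - Z y $ j) ^ 4 \<partial>P)
        - 2 * (\<integral>y. (Z y $ i) ^ 4 \<partial>P) - 2 * (\<integral>y. (Z y $ j) ^ 4 \<partial>P)) / 12"
    unfolding polar using int4 by simp
  also have "\<dots> = (3 * (C $ i $ i + 2 * C $ i $ j + C $ j $ j)\<^sup>2 + 3 * (C $ i $ i - 2 * C $ i $ j + C $ j $ j)\<^sup>2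
      - 2 * (3 * (C $ i $ i)\<^sup>2) - 2 * (3 * (C $ j $ j)\<^sup>2)) / 12"
    using fourth[of "axis i 1 + axis j 1"] fourth[of "axis i 1 - axis j 1"]
      fourth[of "axis i 1"] fourth[of "axis j 1"]
    unfolding sum_ax ax plus minus single by simp
  also have "\<dots> = C $ i $ i * C $ j $ j + 2 * (C $ i $ j)\<^sup>2"
    by (simp add: power2_eq_square algebra_simps)
  finally show "(\<integral>y. (Z y $ i)\<^sup>2 * (Z y $ j)\<^sup>2 \<partial>P) = C $ i $ i * C $ j $ j + 2 * (C $ i $ j)\<^sup>2" .
qed

section \<open>Convergence of expectations under uniform integrability\<close>

lemma conv_in_distribution_compose:
  assumes "conv_in_distribution M X N Y" "continuous_on UNIV g"
  shows "conv_in_distribution M (\<lambda>n x. g (X n x)) N (\<lambda>y. g (Y y))"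
  unfolding conv_in_distribution_def
proof (intro allI impI, elim conjE)
  fix f :: "'d \<Rightarrow> real" assume f: "continuous_on UNIV f" "bounded (range f)"
  have "continuous_on UNIV (\<lambda>z. f (g z))"
    by (rule continuous_on_compose2[OF f(1) assms(2)]) simp
  moreover have "bounded (range (\<lambda>z. f (g z)))"
    by (rule bounded_subset[OF f(2)]) auto
  ultimately show "(\<lambda>n. \<integral>x. f (g (X n x)) \<partial>M) \<longlonglongrightarrow> (\<integral>y. f (g (Y y)) \<partial>N)"
    using assms(1) unfolding conv_in_distribution_def by blast
qed

text \<open>Truncation at a level \<open>m\<close> gives bounded continuous functions. Uniform integrability makes the truncation error of \<open>X n\<close> small
uniformly in \<open>n\<close>, and integrability of \<open>Y\<close> does the same for the limit.\<close>

lemma conv_in_distribution_expectation: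
  fixes X :: "nat \<Rightarrow> 'a \<Rightarrow> real" and Y :: "'b \<Rightarrow> real"
  assumes conv: "conv_in_distribution M X N Y" and UI: "uniformly_integrable M X"
    and X0: "\<And>n x. 0 \<le> X n x" and Y0: "\<And>y. 0 \<le> Y y" and Y: "integrable N Y"
  shows "(\<lambda>n. \<integral>x. X n x \<partial>M) \<longlonglongrightarrow> (\<integral>y. Y y \<partial>N)"
proof (rule tendstoI)
  fix e :: real assume "e > 0"
  have X: "integrable M (X n)" for n using UI by (simp add: uniformly_integrable_def)
  have [measurable]: "X n \<in> borel_measurable M" "Y \<in> borel_measurable N" for n
    using X Y by auto
  obtain K where K: "\<And>n. (\<integral>x. \<bar>X n x\<bar> * indicator {x. \<bar>X n x\<bar> > K} x \<partial>M) < e / 3"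
    using UI \<open>e > 0\<close> unfolding uniformly_integrable_def by (meson divide_pos_pos zero_less_numeral)
  have trunc_lim: "(\<lambda>m. \<integral>y. min (Y y) (real m) \<partial>N) \<longlonglongrightarrow> (\<integral>y. Y y \<partial>N)"
  proof (rule integral_dominated_convergence[OF _ _ Y])
    show "AE y in N. (\<lambda>m. min (Y y) (real m)) \<longlonglongrightarrow> Y y"
    proof (intro AE_I2 tendsto_eventually)
      fix y
      obtain m0 where "Y y \<le> real m0" using real_arch_simple by blast
      then show "\<forall>\<^sub>F m in sequentially. min (Y y) (real m) = Y y"
        by (intro eventually_sequentiallyI[of m0]) auto
    qed
    show "AE y in N. norm (min (Y y) (real m)) \<le> Y y" for m using Y0 by (intro AE_I2) auto
  qed measurable
  have "\<forall>\<^sub>F m in sequentially. dist (\<integral>y. min (Y y) (real m) \<partial>N) (\<integral>y. Y y \<partial>N) < e / 3 \<and> m \<ge> nat \<lceil>K\<rceil>"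
    using \<open>e > 0\<close> by (intro eventually_conj tendstoD[OF trunc_lim] eventually_ge_at_top) simp
  then obtain m where m: "dist (\<integral>y. min (Y y) (real m) \<partial>N) (\<integral>y. Y y \<partial>N) < e / 3" "m \<ge> nat \<lceil>K\<rceil>"
    by (auto simp: eventually_sequentially)
  have Km: "K \<le> real m" using m(2) by linarith
  have trunc_X: "\<bar>(\<integral>x. X n x \<partial>M) - (\<integral>x. min (X n x) (real m) \<partial>M)\<bar> < e / 3" for n
  proof -
    have imin: "integrable M (\<lambda>x. min (X n x) (real m))"
      by (rule Bochner_Integration.integrable_bound[OF X[of n]]) (use X0 in auto)
    have tail: "integrable M (\<lambda>x. \<bar>X n x\<bar> * indicator {x. \<bar>X n x\<bar> > K} x)"
      by (rule Bochner_Integration.integrable_bound[OF X[of n]]) (auto simp: indicator_def)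
    have "\<bar>(\<integral>x. X n x \<partial>M) - (\<integral>x. min (X n x) (real m) \<partial>M)\<bar> = \<bar>\<integral>x. X n x - min (X n x) (real m) \<partial>M\<bar>"
      using X imin by simp
    also have "\<dots> \<le> (\<integral>x. \<bar>X n x - min (X n x) (real m)\<bar> \<partial>M)" by (rule integral_abs_bound)
    also have "\<dots> \<le> (\<integral>x. \<bar>X n x\<bar> * indicator {x. \<bar>X n x\<bar> > K} x \<partial>M)"
    proof (rule integral_mono[OF _ tail])
      show "integrable M (\<lambda>x. \<bar>X n x - min (X n x) (real m)\<bar>)" using X imin by simp
      show "\<bar>X n x - min (X n x) (real m)\<bar> \<le> \<bar>X n x\<bar> * indicator {x. \<bar>X n x\<bar> > K} x" for x
        using X0[of n x] Km by (auto simp: indicator_def min_def)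
    qed
    also have "\<dots> < e / 3" by (rule K)
    finally show ?thesis .
  qed
  \<comment> \<open>the test function has to be bounded on the negative half-line as well\<close>
  have "continuous_on UNIV (\<lambda>z. min (max z 0) (real m))" by (intro continuous_intros)
  moreover have "bounded (range (\<lambda>z. min (max z 0) (real m)))"
    by (rule boundedI[of _ "real m"]) auto
  ultimately have "(\<lambda>n. \<integral>x. min (max (X n x) 0) (real m) \<partial>M) \<longlonglongrightarrow> (\<integral>y. min (max (Y y) 0) (real m) \<partial>N)"
    using conv unfolding conv_in_distribution_def by blast
  then have "(\<lambda>n. \<integral>x. min (X n x) (real m) \<partial>M) \<longlonglongrightarrow> (\<integral>y. min (Y y) (real m) \<partial>N)"
    using X0 Y0 by (simp add: max_absorb1)
  then have "\<forall>\<^sub>F n in sequentially.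
      dist (\<integral>x. min (X n x) (real m) \<partial>M) (\<integral>y. min (Y y) (real m) \<partial>N) < e / 3"
    using \<open>e > 0\<close> by (intro tendstoD) auto
  then show "\<forall>\<^sub>F n in sequentially. dist (\<integral>x. X n x \<partial>M) (\<integral>y. Y y \<partial>N) < e"
  proof eventually_elim
    case (elim n)
    with trunc_X[of n] m(1) show ?case unfolding dist_real_def by linarith
  qed
qed

section \<open>Convergence of chaotic vectors to a Gaussian vector\<close>

theorem theorem1p2:
  fixes M :: "'a measure" and D :: "('a \<Rightarrow> real) set"
    and L :: "('a \<Rightarrow> real) \<Rightarrow> 'a \<Rightarrow> real" and lam :: "nat \<Rightarrow> real"
    and k :: "'d::finite \<Rightarrow> nat" and F :: "nat \<Rightarrow> 'a \<Rightarrow> real ^ 'd" and C :: "real ^ 'd ^ 'd"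
    and P :: "'b measure" and Z :: "'b \<Rightarrow> real ^ 'd"
  assumes "symmetric_markov_generator M D L"
    and "has_discrete_spectrum M D L lam"
    and "diffusive M D L"
    and "\<And>i. k i \<ge> 1"
    and "\<And>n. chaotic_vector M D L lam k (F n)"
    and "(\<lambda>n. cov_matrix M (F n)) \<longlonglongrightarrow> C"
    and "prob_space P"
    and "centered_gaussian_vector P Z C"
  defines "rel_i \<equiv> conv_in_distribution M F P Z"
    and "rel_ii_a \<equiv> (\<forall>i. weak_conv_m (\<lambda>n. distr M borel (\<lambda>x. F n x $ i))
                               (distr P borel (\<lambda>y. Z y $ i)))"
    and "rel_ii_b \<equiv> (\<forall>i j. (\<lambda>n. \<integral>x. (F n x $ i)\<^sup>2 * (F n x $ j)\<^sup>2 \<partial>M)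
                               \<longlonglongrightarrow> (\<integral>y. (Z y $ i)\<^sup>2 * (Z y $ j)\<^sup>2 \<partial>P))"
  shows "(rel_ii_a \<and> rel_ii_b \<longrightarrow> rel_i) \<and>
    ((\<forall>i j. uniformly_integrable M (\<lambda>n x. (F n x $ i)\<^sup>2 * (F n x $ j)\<^sup>2)) \<longrightarrow>
       rel_i \<longrightarrow> rel_ii_a \<and> rel_ii_b)"
proof -
  define f where "f n i x = F n x $ i" for n i x
  define l where "l i = lam (k i)" for i
  interpret diffusion_generator M D L lam
    by unfold_locales (rule assms)+
  interpret P: prob_space P by (rule assms)
  have chaotic: "chaotic_family M D L lam (f n) l" for n
  proof unfold_locales
    have n: "chaotic_vector M D L lam k (F n)" by (rule assms)
    show "f n i \<in> eigenspace M D L (l i)" for i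
      using n by (simp add: chaotic_vector_def f_def[abs_def] l_def)
    show "0 < l i" for i
      using assms(2) \<open>k i \<ge> 1\<close> strict_monoD[of lam 0 "k i"] by (simp add: has_discrete_spectrum_def l_def)
    show "(\<lambda>x. f n i x * f n j x) \<in> eigen_sum M D L lam {r. lam r \<le> l i + l j}" for i j
      using n by (simp add: chaotic_vector_def jointly_chaotic_def f_def l_def)
  qed
  interpret fam: chaotic_family M D L lam "f n" l for n by (rule chaotic)
  have covariance: "(\<lambda>n. \<integral>x. f n i x * f n j x \<partial>M) \<longlonglongrightarrow> C $ i $ j" for i j
  proof -
    have "cov_matrix M (F n) $ i $ j = (\<integral>x. f n i x * f n j x \<partial>M)" for n
      using fam.integral_f[of n] by (simp add: cov_matrix_def f_def)
    moreover have "(\<lambda>n. cov_matrix M (F n) $ i $ j) \<longlonglongrightarrow> C $ i $ j"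
      by (intro tendsto_vec_nth assms)
    ultimately show ?thesis by simp
  qed
  have F_measurable: "F n \<in> borel_measurable M" for n
  proof -
    have "(\<lambda>x. F n x \<bullet> b) \<in> borel_measurable M" if b: "b \<in> Basis" for b
    proof -
      obtain i where "b = axis i 1" using b by (auto simp: Basis_vec_def)
      then show ?thesis using fam.f_measurable[of n i] by (simp add: inner_axis f_def[abs_def])
    qed
    then show ?thesis by (subst borel_measurable_euclidean_space) blast
  qed
  have Z_measurable: "Z \<in> borel_measurable P"
    using assms(8) by (simp add: centered_gaussian_vector_def)
  note Z = centered_gaussian_vector_moments[OF assms(7,8)]
  have "rel_i" if ii: "rel_ii_b"
  proof -
    have "chaotic_sequence M D L lam f l (\<lambda>i j. C $ i $ j)"
    proof (intro chaotic_sequence.intro chaotic_sequence_axioms.intro diffusion_generator_axioms)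
      show "chaotic_family M D L lam (f n) l" for n by (rule chaotic)
      show "(\<lambda>n. \<integral>x. f n i x * f n j x \<partial>M) \<longlonglongrightarrow> C $ i $ j" for i j by (rule covariance)
      show "(\<lambda>n. \<integral>x. (f n i x)\<^sup>2 * (f n j x)\<^sup>2 \<partial>M) \<longlonglongrightarrow> C $ i $ i * C $ j $ j + 2 * (C $ i $ j)\<^sup>2" for i j
        using ii unfolding rel_ii_b_def f_def Z(4)[symmetric] by blast
    qed
    then interpret chaotic_sequence M D L lam f l "\<lambda>i j. C $ i $ j" .
    have "\<exists>K. \<forall>n. (\<integral>x. (F n x $ i)\<^sup>2 \<partial>M) \<le> K \<and> (\<integral>y. (Z y $ i)\<^sup>2 \<partial>P) \<le> K" for i
    proof -
      have "Bseq (\<lambda>n. \<integral>x. f n i x * f n i x \<partial>M)"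
        by (rule convergent_imp_Bseq[OF convergentI[OF covariance]])
      then obtain K where "\<And>n. norm (\<integral>x. f n i x * f n i x \<partial>M) \<le> K"
        by (auto simp: Bseq_def)
      then have "(\<integral>x. (F n x $ i)\<^sup>2 \<partial>M) \<le> max K (C $ i $ i)" for n
        by (simp add: f_def power2_eq_square le_max_iff_disj abs_le_iff)
      then show ?thesis by (intro exI[of _ "max K (C $ i $ i)"]) (simp add: Z(2))
    qed
    then obtain K where K: "\<And>n i. (\<integral>x. (F n x $ i)\<^sup>2 \<partial>M) \<le> K i" "\<And>i. (\<integral>y. (Z y $ i)\<^sup>2 \<partial>P) \<le> K i"
      by metis
    show ?thesis
      unfolding rel_i_def
    proof (rule conv_in_distribution_characteristic[OF prob_space_axioms P.prob_space_axioms
          F_measurable Z_measurable _ _ K(1) Z(1) K(2)])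
      show "integrable M (\<lambda>x. (F n x $ i)\<^sup>2)" for n i
        using L2_square_integrable[OF fam.f_L2[of n i]] by (simp add: f_def)
      show "(\<lambda>n. \<integral>x. cos (t \<bullet> F n x + \<theta>) \<partial>M) \<longlonglongrightarrow> (\<integral>y. cos (t \<bullet> Z y + \<theta>) \<partial>P)" for t \<theta>
        using characteristic_limit[of "\<lambda>i. t $ i" \<theta>] unfolding Z(5)
        by (simp add: inner_vec_def f_def)
    qed
  qed
  moreover have "rel_ii_a" if "rel_i"
    unfolding rel_ii_a_def
  proof
    fix i
    have "conv_in_distribution M (\<lambda>n x. F n x $ i) P (\<lambda>y. Z y $ i)"
      using that unfolding rel_i_def
      by (rule conv_in_distribution_compose) (rule continuous_on_component[OF continuous_on_id])
    then show "weak_conv_m (\<lambda>n. distr M borel (\<lambda>x. F n x $ i)) (distr P borel (\<lambda>y. Z y $ i))"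
      by (subst (asm) conv_in_distribution_real_iff[OF prob_space_axioms P.prob_space_axioms])
         (auto intro!: vec_nth_measurable F_measurable Z_measurable)
  qed
  moreover have "rel_ii_b" if "rel_i"
    and UI: "\<forall>i j. uniformly_integrable M (\<lambda>n x. (F n x $ i)\<^sup>2 * (F n x $ j)\<^sup>2)"
    unfolding rel_ii_b_def
  proof (intro allI)
    fix i j
    have "conv_in_distribution M (\<lambda>n x. (F n x $ i)\<^sup>2 * (F n x $ j)\<^sup>2) P (\<lambda>y. (Z y $ i)\<^sup>2 * (Z y $ j)\<^sup>2)"
      using \<open>rel_i\<close> unfolding rel_i_def
      by (rule conv_in_distribution_compose[where g = "\<lambda>z. (z $ i)\<^sup>2 * (z $ j)\<^sup>2"])
         (intro continuous_intros)
    then show "(\<lambda>n. \<integral>x. (F n x $ i)\<^sup>2 * (F n x $ j)\<^sup>2 \<partial>M) \<longlonglongrightarrow> (\<integral>y. (Z y $ i)\<^sup>2 * (Z y $ j)\<^sup>2 \<partial>P)"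
      by (rule conv_in_distribution_expectation) (use UI Z(3) in auto)
  qed
  ultimately show ?thesis by blast
qed

end
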